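(* Let $f$ be a continuous nonnegative function on $(0,\infty)$. Then the following conditions are equivalent: (b1) $f$ is operator monotone; (b2) $f(A\,\triangledown\,B)\ge f(A)\,\sigma\,f(B)$ for all $A,B\in B(\mathcal{H})^{++}$ and for all symmetric operator means $\sigma$; (b3) $f$ is operator log-concave, i.e., $f(A\,\triangledown\,B)\ge f(A)\,\#\,f(B)$ for all $A,B\in B(\mathcal{H})^{++}$; (b4) $f(A\,\triangledown\,B)\ge f(A)\,\sigma\,f(B)$ for all $A,B\in B(\mathcal{H})^{++}$ and for some symmetric operator mean $\sigma\ne\,!$.
   Context: $\mathcal{H}$ is an infinite-dimensional separable Hilbert space, $B(\mathcal{H})^+$ is the set of positive (i.e. positive semidefinite) bounded operators on $\mathcal{H}$, $B(\mathcal{H})^{++}$ is the set of invertible elements of $B(\mathcal{H})^+$, and $I$ is the identity operator. $f(A)$ is defined by continuous functional calculus. A continuous real function $f$ on $(0,\infty)$ is operator monotone if $A\ge B$ implies $f(A)\ge f(B)$ for $A,B\in B(\mathcal{H})^{++}$. Operator means (Kubo–Ando): to each nonnegative (continuous) operator monotone function $h$ on $[0,\infty)$ with $h(1)=1$ corresponds the operator mean $\sigma=\sigma_h$ given by $A\,\sigma\,B:=A^{1/2}h(A^{-1/2}BA^{-1/2})A^{1/2}$ for $A,B\in B(\mathcal{H})^{++}$, extended to $A,B\in B(\mathcal{H})^+$ by $A\,\sigma\,B:=\lim_{\varepsilon\searrow0}(A+\varepsilon I)\,\sigma\,(B+\varepsilon I)$ in the strong operator topology. An operator mean $\sigma$ is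 symmetric if $A\,\sigma\,B=B\,\sigma\,A$ for all $A,B\in B(\mathcal{H})^{++}$. For $A,B\in B(\mathcal{H})^{++}$: the arithmetic mean is $A\,\triangledown\,B:=(A+B)/2$, the geometric mean is $A\,\#\,B:=A^{1/2}(A^{-1/2}BA^{-1/2})^{1/2}A^{1/2}$ (corresponding to $h(x)=x^{1/2}$), and the harmonic mean is $A\,!\,B:=\bigl((A^{-1}+B^{-1})/2\bigr)^{-1}$ (corresponding to $h(x)=2x/(x+1)$); each $\sigma\in\{\triangledown,\#,!\}$ is extended to $A,B\in B(\mathcal{H})^+$ by $A\,\sigma\,B:=\lim_{\varepsilon\searrow0}(A+\varepsilon I)\,\sigma\,(B+\varepsilon I)$ in the strong operator topology. *)

theory Defs
  imports "HOL-Analysis.Analysis" "HOL-Computational_Algebra.Polynomial"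
begin

text \<open>
  Complex Hilbert spaces. The inner product is linear in the second argument. The real inner
  product of \<^class>\<open>real_inner\<close> is the real part of the complex one, so the norm and the topology
  are those of the complex inner product space.
\<close>

class complex_inner = real_inner +
  fixes scaleC :: "complex \<Rightarrow> 'a \<Rightarrow> 'a"  (infixr \<open>*\<^sub>C\<close> 75)
    and cinner :: "'a \<Rightarrow> 'a \<Rightarrow> complex"
  assumes scaleC_add_right: "a *\<^sub>C (x + y) = a *\<^sub>C x + a *\<^sub>C y"
    and scaleC_add_left: "(a + b) *\<^sub>C x = a *\<^sub>C x + b *\<^sub>C x"
    and scaleC_scaleC: "a *\<^sub>C b *\<^sub>C x = (a * b) *\<^sub>C x"
    and scaleC_one: "1 *\<^sub>C x = x"
    and scaleR_scaleC: "scaleR r x = complex_of_real r *\<^sub>C x"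
    and cinner_commute: "cinner x y = cnj (cinner y x)"
    and cinner_add_right: "cinner x (y + z) = cinner x y + cinner x z"
    and cinner_scaleC_right: "cinner x (a *\<^sub>C y) = a * cinner x y"
    and inner_eq_Re_cinner: "inner x y = Re (cinner x y)"

class chilbert_space = complex_inner + complete_space

global_interpretation complex_vector: vector_space "scaleC :: complex \<Rightarrow> 'a \<Rightarrow> 'a::complex_inner"
  by unfold_locales
    (simp_all add: scaleC_add_right scaleC_add_left scaleC_scaleC scaleC_one)

text \<open>
  \<^typ>\<open>'a \<Rightarrow>\<^sub>L 'a\<close> consists of the bounded real-linear operators; \<open>bounded_ops\<close> is $B(H)$, the
  complex-linear ones.
\<close>

type_synonym 'a op = "'a \<Rightarrow>\<^sub>L 'a"

definition bounded_ops :: "'a::chilbert_space op set" where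
  "bounded_ops = {A. \<forall>c x. blinfun_apply A (c *\<^sub>C x) = c *\<^sub>C blinfun_apply A x}"

definition pos_ops :: "'a::chilbert_space op set" where
  "pos_ops = {A \<in> bounded_ops. \<forall>x. cinner x (blinfun_apply A x) \<in> \<real>\<^sub>\<ge>\<^sub>0}"

definition op_le :: "'a::chilbert_space op \<Rightarrow> 'a op \<Rightarrow> bool"  (infix \<open>\<preceq>\<close> 50) where
  "A \<preceq> B \<longleftrightarrow> B - A \<in> pos_ops"

definition op_invertible :: "'a::chilbert_space op \<Rightarrow> bool" where
  "op_invertible A \<longleftrightarrow>
     (\<exists>B \<in> bounded_ops. A o\<^sub>L B = id_blinfun \<and> B o\<^sub>L A = id_blinfun)"

definition op_inv :: "'a::chilbert_space op \<Rightarrow> 'a op" where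
  "op_inv A = (THE B. B \<in> bounded_ops \<and> A o\<^sub>L B = id_blinfun \<and> B o\<^sub>L A = id_blinfun)"

definition pos_inv_ops :: "'a::chilbert_space op set" where
  "pos_inv_ops = {A \<in> pos_ops. op_invertible A}"

text \<open>
  Continuous functional calculus for positive (more generally self-adjoint) \<open>A\<close>: the spectrum
  is then contained in the real line, and $f(A)$ is the norm limit of $p_n(A)$ for real
  polynomials $p_n$ converging to $f$ uniformly on the spectrum. Only used for \<open>f\<close> continuous on
  the spectrum, where such $p_n$ exist and the limit does not depend on their choice.
\<close>

definition real_spectrum :: "'a::chilbert_space op \<Rightarrow> real set" where
  "real_spectrum A = {t. \<not> op_invertible (A - t *\<^sub>R id_blinfun)}"

definition poly_op :: "real poly \<Rightarrow> 'a::chilbert_space op \<Rightarrow> 'a op" where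
  "poly_op p A = (\<Sum>i\<le>degree p. coeff p i *\<^sub>R (((o\<^sub>L) A ^^ i) id_blinfun))"

definition fun_calc :: "(real \<Rightarrow> real) \<Rightarrow> 'a::chilbert_space op \<Rightarrow> 'a op" where
  "fun_calc f A = (THE T. \<forall>p :: nat \<Rightarrow> real poly.
     uniform_limit (real_spectrum A) (\<lambda>n. poly (p n)) f sequentially \<longrightarrow>
     (\<lambda>n. poly_op (p n) A) \<longlonglongrightarrow> T)"

text \<open>
  With \<open>D = pos_inv_ops\<close> this is operator monotonicity on $(0,\infty)$, with \<open>D = pos_ops\<close>
  operator monotonicity on $[0,\infty)$.
\<close>

definition operator_monotone_on ::
    "'a::chilbert_space op set \<Rightarrow> (real \<Rightarrow> real) \<Rightarrow> bool" where
  "operator_monotone_on D f \<longleftrightarrow>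
     (\<forall>A\<in>D. \<forall>B\<in>D. B \<preceq> A \<longrightarrow> fun_calc f B \<preceq> fun_calc f A)"

text \<open>Extension of \<open>m\<close> from invertible to all positive operators, by a strong operator limit.\<close>

definition extend_mean ::
    "('a::chilbert_space op \<Rightarrow> 'a op \<Rightarrow> 'a op) \<Rightarrow> 'a op \<Rightarrow> 'a op \<Rightarrow> 'a op" where
  "extend_mean m A B =
     (if A \<in> pos_inv_ops \<and> B \<in> pos_inv_ops then m A B
      else (THE T. \<forall>x. ((\<lambda>\<epsilon>::real. blinfun_apply
              (m (A + \<epsilon> *\<^sub>R id_blinfun) (B + \<epsilon> *\<^sub>R id_blinfun)) x)
              \<longlongrightarrow> blinfun_apply T x) (at_right 0)))"

definition mean_of :: "(real \<Rightarrow> real) \<Rightarrow> 'a::chilbert_space op \<Rightarrow> 'a op \<Rightarrow> 'a op" where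
  "mean_of h = extend_mean (\<lambda>A B.
     let R = fun_calc sqrt A; S = op_inv R
     in R o\<^sub>L fun_calc h (S o\<^sub>L B o\<^sub>L S) o\<^sub>L R)"

definition arith_mean :: "'a::chilbert_space op \<Rightarrow> 'a op \<Rightarrow> 'a op"  (infixl \<open>\<nabla>\<close> 65) where
  "arith_mean = extend_mean (\<lambda>A B. (1/2) *\<^sub>R (A + B))"

definition geom_mean :: "'a::chilbert_space op \<Rightarrow> 'a op \<Rightarrow> 'a op"  (infixl \<open>\<sharp>\<close> 65) where
  "geom_mean = mean_of sqrt"

definition harm_mean :: "'a::chilbert_space op \<Rightarrow> 'a op \<Rightarrow> 'a op" where
  "harm_mean = extend_mean (\<lambda>A B. op_inv ((1/2) *\<^sub>R (op_inv A + op_inv B)))"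

text \<open>
  A mean is a binary operation on \<open>pos_ops\<close>. Since HOL functions are total, equality of means is
  only ever required on \<open>pos_ops\<close>.
\<close>

definition mean_eq ::
    "('a::chilbert_space op \<Rightarrow> 'a op \<Rightarrow> 'a op) \<Rightarrow> ('a op \<Rightarrow> 'a op \<Rightarrow> 'a op) \<Rightarrow> bool" where
  "mean_eq \<sigma> \<tau> \<longleftrightarrow> (\<forall>A\<in>pos_ops. \<forall>B\<in>pos_ops. \<sigma> A B = \<tau> A B)"

definition operator_mean :: "('a::chilbert_space op \<Rightarrow> 'a op \<Rightarrow> 'a op) \<Rightarrow> bool" where
  "operator_mean \<sigma> \<longleftrightarrow>
     (\<exists>h. continuous_on {0..} h \<and> (\<forall>t\<ge>0. 0 \<le> h t) \<and> h 1 = 1 \<and>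
          operator_monotone_on (pos_ops :: 'a op set) h \<and> mean_eq \<sigma> (mean_of h))"

definition symmetric_mean :: "('a::chilbert_space op \<Rightarrow> 'a op \<Rightarrow> 'a op) \<Rightarrow> bool" where
  "symmetric_mean \<sigma> \<longleftrightarrow> (\<forall>A\<in>pos_inv_ops. \<forall>B\<in>pos_inv_ops. \<sigma> A B = \<sigma> B A)"

end

(*
If f is operator monotone, then for positive operators the inequality
X <= (1+d) X11 (+) (1+1/d) X22 applied to a rotation X of A (+) B shows that f is operator
concave, and every symmetric mean lies below the arithmetic one. This needs H = H (+) H, that is,
two isometries V1, V2 with V1 V1^* + V2 V2^* = 1; they are the only use of separability and
infinite dimension.

Conversely, let f satisfy the inequality for a symmetric mean with representing function h,
other than the harmonic mean. Two-by-two scalar matrices show that f vanishes identically or is positive with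
f(t) >= k/t^2 at infinity. In the latter case put g = 1/f. Since 1/h lies below the function
(1 + 1/x)/2, g is operator convex. Since the mean is not harmonic, there are even c < 1/2 and K with
1/h(x) <= c (1 + 1/x) + K/(1 + x), that is,
g((A+B)/2) <= c (g(A) + g(B)) + K (f(A) + f(B))^-1. For A, B with eigenvalues t and e
in frames at a small angle this gives g(r t) <= 2 c g(t) + C for a fixed r < 1 close to 1,
which is compatible with quadratic growth only if g is bounded at infinity. An operator convex
function that is bounded at infinity is operator decreasing, so f is operator monotone.
*)

theory Submission
  imports Defs "HOL-Computational_Algebra.Fundamental_Theorem_Algebra"
begin

section \<open>Operators and their order\<close>

text \<open>The harmonic mean is the real obstacle. For positive \<open>f\<close> the inequality
  with that mean says exactly that \<open>1/f\<close> is operator convex, and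
  \<open>f(t) = 1/t^2\<close> satisfies it without being operator monotone. So convexity of
  \<open>g = 1/f\<close> cannot suffice, and quadratic growth of \<open>g\<close> is what the strict
  inequality \<open>c < 1/2\<close> must rule out: \<open>g(r t) \<le> 2 c g(t) + C\<close> allows
  growth of order \<open>t^a\<close> only if \<open>r^a \<le> 2 c\<close>, which fails for
  \<open>a = 2\<close> once \<open>r\<close> is close to 1. The constant \<open>c\<close> exists
  because the adjoint function \<open>x \<mapsto> 1/h(1/x)\<close> is again operator monotone, hence
  concave. A symmetric concave function that leaves the line \<open>(1 + x)/2\<close> once stays
  below a smaller multiple of \<open>1 + x\<close> near 0 and near infinity, and \<open>K\<close>
  pays for the values in between. Before positivity of \<open>f\<close> is known,
  \<open>f(A)\<close> may be singular, and the mean is then only a strong limit. The lower bound for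
  \<open>f\<close> is therefore arranged so that one argument of the mean is invertible, where the
  closed formula persists by norm continuity.\<close>

instance chilbert_space \<subseteq> banach ..

notation blinfun_compose (infixl \<open>\<odot>\<close> 70)

abbreviation one_op :: "'a::chilbert_space op" where "one_op \<equiv> id_blinfun"

lemma comp_op_simps:
  fixes A B C :: "'a::chilbert_space op"
  shows "A \<odot> B \<odot> C = A \<odot> (B \<odot> C)"
    and "(A + B) \<odot> C = A \<odot> C + B \<odot> C" "C \<odot> (A + B) = C \<odot> A + C \<odot> B"
    and "(A - B) \<odot> C = A \<odot> C - B \<odot> C" "C \<odot> (A - B) = C \<odot> A - C \<odot> B"
    and "(r *\<^sub>R A) \<odot> B = r *\<^sub>R (A \<odot> B)" "A \<odot> (r *\<^sub>R B) = r *\<^sub>R (A \<odot> B)"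
    and "one_op \<odot> A = A" "A \<odot> one_op = A" "0 \<odot> A = 0" "A \<odot> 0 = 0"
    and "(- A) \<odot> B = - (A \<odot> B)" "A \<odot> (- B) = - (A \<odot> B)"
  by (auto intro!: blinfun_eqI simp: blinfun.bilinear_simps)

lemma comp_op_assoc: "A \<odot> B \<odot> C = A \<odot> (B \<odot> C)" for A B C :: "'a::chilbert_space op"
  by (rule comp_op_simps)

section \<open>Complex inner products, complex-linear operators and adjoints\<close>

lemma Re_cinner: "Re (cinner x y) = inner x y" for x :: "'a::complex_inner"
  by (simp add: inner_eq_Re_cinner)

lemma cinner_scaleC_left: "cinner (a *\<^sub>C x) y = cnj a * cinner x y"
  by (metis cinner_commute cinner_scaleC_right complex_cnj_mult)

lemma Im_cinner: "Im (cinner x y) = - inner x (\<i> *\<^sub>C y)"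
  by (simp add: inner_eq_Re_cinner cinner_scaleC_right)

lemma inner_scaleC_i_left: "inner (\<i> *\<^sub>C x) y = - inner x (\<i> *\<^sub>C y)"
  by (simp add: inner_eq_Re_cinner cinner_scaleC_right cinner_scaleC_left)

lemma inner_scaleC_left: "inner (c *\<^sub>C x) y = inner x (cnj c *\<^sub>C y)"
  by (simp add: inner_eq_Re_cinner cinner_scaleC_right cinner_scaleC_left)

lemma norm_scaleC: "norm (c *\<^sub>C x) = cmod c * norm x" for x :: "'a::complex_inner"
proof -
  have "(norm (c *\<^sub>C x))\<^sup>2 = inner x ((cnj c * c) *\<^sub>C x)"
    by (simp add: power2_norm_eq_inner inner_scaleC_left scaleC_scaleC)
  also have "(cnj c * c) *\<^sub>C x = (cmod c)\<^sup>2 *\<^sub>R x"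
    by (metis complex_norm_square mult.commute scaleR_scaleC)
  also have "inner x \<dots> = (cmod c * norm x)\<^sup>2"
    by (simp add: power2_norm_eq_inner power_mult_distrib)
  finally show ?thesis by (simp add: power2_eq_iff_nonneg)
qed

lemma scaleC_scaleR: "c *\<^sub>C (r *\<^sub>R x) = r *\<^sub>R (c *\<^sub>C x)"
  by (simp add: scaleR_scaleC scaleC_scaleC mult.commute)

lemma bounded_linear_scaleC: "bounded_linear (\<lambda>x::'a::complex_inner. c *\<^sub>C x)"
  by (rule bounded_linear_intro[where K = "cmod c"])
    (simp_all add: scaleC_add_right scaleC_scaleR norm_scaleC)

lemma bounded_opsD: "A \<in> bounded_ops \<Longrightarrow> A (c *\<^sub>C x) = c *\<^sub>C A x"
  by (simp add: bounded_ops_def)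

lemma scaleC_diff_right: "c *\<^sub>C (x - y) = c *\<^sub>C x - c *\<^sub>C (y::'a::complex_inner)"
  using linear_simps(2)[OF bounded_linear_scaleC] .

lemma scaleC_zero_right: "c *\<^sub>C (0::'a::complex_inner) = 0"
  using linear_simps(3)[OF bounded_linear_scaleC] .

lemma bounded_ops_zero: "0 \<in> bounded_ops"
  by (simp add: bounded_ops_def scaleC_zero_right)

lemma bounded_ops_one: "one_op \<in> bounded_ops"
  by (simp add: bounded_ops_def)

lemma bounded_ops_add: "A \<in> bounded_ops \<Longrightarrow> B \<in> bounded_ops \<Longrightarrow> A + B \<in> bounded_ops"
  by (simp add: bounded_ops_def blinfun.bilinear_simps scaleC_add_right)

lemma bounded_ops_diff: "A \<in> bounded_ops \<Longrightarrow> B \<in> bounded_ops \<Longrightarrow> A - B \<in> bounded_ops"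
  by (simp add: bounded_ops_def blinfun.bilinear_simps scaleC_diff_right)

lemma bounded_ops_scaleR: "A \<in> bounded_ops \<Longrightarrow> r *\<^sub>R A \<in> bounded_ops"
  by (simp add: bounded_ops_def blinfun.bilinear_simps scaleC_scaleR)

lemma bounded_ops_compose: "A \<in> bounded_ops \<Longrightarrow> B \<in> bounded_ops \<Longrightarrow> A \<odot> B \<in> bounded_ops"
  by (simp add: bounded_ops_def)

lemma tendsto_blinfun_apply: "(X \<longlongrightarrow> A) F \<Longrightarrow> ((\<lambda>n. blinfun_apply (X n) x) \<longlongrightarrow> blinfun_apply A x) F"
  by (rule blinfun.tendsto) auto

lemma bounded_ops_lim:
  assumes "(X \<longlongrightarrow> A) F" "F \<noteq> bot" "eventually (\<lambda>n. X n \<in> bounded_ops) F"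
  shows "A \<in> bounded_ops"
  unfolding bounded_ops_def
proof (intro CollectI allI)
  fix c x
  have "((\<lambda>n. blinfun_apply (X n) (c *\<^sub>C x)) \<longlongrightarrow> A (c *\<^sub>C x)) F"
    by (rule tendsto_blinfun_apply) fact
  moreover have "((\<lambda>n. c *\<^sub>C blinfun_apply (X n) x) \<longlongrightarrow> c *\<^sub>C A x) F"
    by (rule bounded_linear.tendsto[OF bounded_linear_scaleC] tendsto_blinfun_apply)+ fact
  hence "((\<lambda>n. blinfun_apply (X n) (c *\<^sub>C x)) \<longlongrightarrow> c *\<^sub>C A x) F"
    by (rule Lim_transform_eventually) (use assms(3) in eventually_elim, simp add: bounded_opsD)
  ultimately show "A (c *\<^sub>C x) = c *\<^sub>C A x"
    using assms(2) tendsto_unique by blast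
qed

text \<open>The real inner product suffices: for complex-linear operators its adjoint is the complex one.\<close>

definition adj :: "'a::chilbert_space op \<Rightarrow> 'a op \<Rightarrow> bool" where
  "adj C D \<longleftrightarrow> C \<in> bounded_ops \<and> D \<in> bounded_ops \<and> (\<forall>x y. inner (C x) y = inner x (D y))"

abbreviation sa :: "'a::chilbert_space op \<Rightarrow> bool" where "sa A \<equiv> adj A A"

lemma adj_bounded: "adj C D \<Longrightarrow> C \<in> bounded_ops" "adj C D \<Longrightarrow> D \<in> bounded_ops"
  by (simp_all add: adj_def)

lemma adj_inner: "adj C D \<Longrightarrow> inner (C x) y = inner x (D y)"
  by (simp add: adj_def)

lemma adj_sym: "adj C D \<Longrightarrow> adj D C"
  by (metis adj_def inner_commute)

lemma adj_inner': "adj C D \<Longrightarrow> inner (D x) y = inner x (C y)"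
  using adj_inner[OF adj_sym] .

lemma adj_one [simp]: "sa one_op" and adj_zero [simp]: "sa 0"
  by (simp_all add: adj_def bounded_ops_one bounded_ops_zero)

lemma adj_add: "adj A B \<Longrightarrow> adj C D \<Longrightarrow> adj (A + C) (B + D)"
  by (simp add: adj_def bounded_ops_add blinfun.bilinear_simps inner_add)

lemma adj_diff: "adj A B \<Longrightarrow> adj C D \<Longrightarrow> adj (A - C) (B - D)"
  by (simp add: adj_def bounded_ops_diff blinfun.bilinear_simps inner_diff)

lemma adj_scaleR: "adj A B \<Longrightarrow> adj (r *\<^sub>R A) (r *\<^sub>R B)"
  by (simp add: adj_def bounded_ops_scaleR blinfun.bilinear_simps)

lemma adj_minus: "adj A B \<Longrightarrow> adj (- A) (- B)"
  using adj_scaleR[of A B "-1"] by simp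

lemma adj_compose: "adj A B \<Longrightarrow> adj C D \<Longrightarrow> adj (A \<odot> C) (D \<odot> B)"
  by (simp add: adj_def bounded_ops_compose)

lemma adj_lim:
  assumes "(X \<longlongrightarrow> A) F" "(Y \<longlongrightarrow> B) F" "F \<noteq> bot" "eventually (\<lambda>n. adj (X n) (Y n)) F"
  shows "adj A B"
  unfolding adj_def
proof (intro conjI allI)
  show "A \<in> bounded_ops"
    by (rule bounded_ops_lim[OF assms(1,3)]) (use assms(4) in eventually_elim, simp add: adj_def)
  show "B \<in> bounded_ops"
    by (rule bounded_ops_lim[OF assms(2,3)]) (use assms(4) in eventually_elim, simp add: adj_def)
  fix x y
  have "((\<lambda>n. inner (blinfun_apply (X n) x) y) \<longlongrightarrow> inner (A x) y) F"
    by (intro tendsto_inner tendsto_blinfun_apply assms tendsto_const)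
  moreover have "((\<lambda>n. inner x (blinfun_apply (Y n) y)) \<longlongrightarrow> inner x (B y)) F"
    by (intro tendsto_inner tendsto_blinfun_apply assms tendsto_const)
  hence "((\<lambda>n. inner (blinfun_apply (X n) x) y) \<longlongrightarrow> inner x (B y)) F"
    by (rule Lim_transform_eventually) (use assms(4) in eventually_elim, simp add: adj_inner)
  ultimately show "inner (A x) y = inner x (B y)"
    using assms(3) tendsto_unique by blast
qed

text \<open>Over the complex numbers a real quadratic form forces symmetry: polarise the vanishing
  imaginary part of the form, then rotate one argument by the imaginary unit. Afterwards positivity
  can be handled with the real inner product alone.\<close>

lemma pos_ops_iff: "A \<in> pos_ops \<longleftrightarrow> sa A \<and> (\<forall>x. 0 \<le> inner x (A x))" for A :: "'a::chilbert_space op"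
proof (intro iffI conjI)
  assume "A \<in> pos_ops"
  hence b: "A \<in> bounded_ops" and p: "\<And>x. cinner x (A x) \<in> \<real>\<^sub>\<ge>\<^sub>0"
    by (auto simp: pos_ops_def)
  have im: "inner x (\<i> *\<^sub>C A x) = 0" for x
    using p[of x] Im_cinner[of x "A x"] by (auto simp: complex_nonneg_Reals_iff)
  have cross: "inner x (\<i> *\<^sub>C A y) + inner y (\<i> *\<^sub>C A x) = 0" for x y
    using im[of "x + y"] im[of x] im[of y]
    by (simp add: blinfun.bilinear_simps scaleC_add_right inner_add)
  have "inner (A x) y = inner x (A y)" for x y
  proof -
    have "inner x (\<i> *\<^sub>C A (\<i> *\<^sub>C y)) = - inner x (A y)"
      using b scaleC_scaleR[of "1::complex" "-1" "A y"] scaleR_scaleC[of "-1" "A y"]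
      by (simp add: bounded_opsD scaleC_scaleC scaleC_one)
    moreover have "inner (\<i> *\<^sub>C y) (\<i> *\<^sub>C A x) = inner y (A x)"
      by (simp add: inner_scaleC_left scaleC_scaleC scaleC_one)
    ultimately show ?thesis
      using cross[of x "\<i> *\<^sub>C y"] by (simp add: inner_commute)
  qed
  thus "sa A" using b by (simp add: adj_def)
  show "\<forall>x. 0 \<le> inner x (A x)"
    using p by (auto simp: complex_nonneg_Reals_iff inner_eq_Re_cinner)
next
  assume *: "sa A \<and> (\<forall>x. 0 \<le> inner x (A x))"
  have "Im (cinner x (A x)) = 0" for x
  proof -
    have "inner x (\<i> *\<^sub>C A x) = inner x (A (\<i> *\<^sub>C x))"
      using * by (metis adj_bounded(1) bounded_opsD)
    also have "\<dots> = inner (\<i> *\<^sub>C x) (A x)"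
      using * by (metis adj_inner inner_commute)
    also have "\<dots> = - inner x (\<i> *\<^sub>C A x)"
      by (rule inner_scaleC_i_left)
    finally show ?thesis by (simp add: Im_cinner)
  qed
  thus "A \<in> pos_ops"
    using * by (auto simp: pos_ops_def adj_bounded complex_nonneg_Reals_iff inner_eq_Re_cinner)
qed

lemma pos_ops_sa: "A \<in> pos_ops \<Longrightarrow> sa A" and pos_ops_inner: "A \<in> pos_ops \<Longrightarrow> 0 \<le> inner x (A x)"
  by (simp_all add: pos_ops_iff)

lemma op_leI: "sa A \<Longrightarrow> sa B \<Longrightarrow> (\<And>x. inner x (A x) \<le> inner x (B x)) \<Longrightarrow> A \<preceq> B"
  by (simp add: op_le_def pos_ops_iff adj_diff blinfun.bilinear_simps inner_diff)

lemma op_leD: "A \<preceq> B \<Longrightarrow> inner x (A x) \<le> inner x (B x)"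
  by (simp add: op_le_def pos_ops_iff blinfun.bilinear_simps inner_diff)

lemma pos_compose: "A \<in> pos_ops \<Longrightarrow> adj C D \<Longrightarrow> D \<odot> A \<odot> C \<in> pos_ops"
  using adj_compose[OF adj_compose[OF adj_sym[of C D] pos_ops_sa], of A C D]
  by (auto simp: pos_ops_iff comp_op_assoc) (metis adj_inner)

text \<open>The numerical radius of a self-adjoint operator bounds its norm: polarise with
  \<open>y\<close> parallel to \<open>T x\<close> and as long as \<open>x\<close>, then apply the
  parallelogram law.\<close>

lemma norm_le_form:
  fixes T :: "'a::chilbert_space op"
  assumes T: "sa T" and b: "\<And>x. \<bar>inner x (T x)\<bar> \<le> c * (norm x)\<^sup>2" and c: "0 \<le> c"
  shows "norm T \<le> c"
proof (rule norm_blinfun_bound[OF c])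
  fix x
  show "norm (T x) \<le> c * norm x"
  proof (cases "T x = 0 \<or> x = 0")
    case True thus ?thesis using c by (auto simp: blinfun.bilinear_simps)
  next
    case False
    define s where "s = norm x / norm (T x)"
    define y where "y = s *\<^sub>R T x"
    have ny: "norm y = norm x" using False by (simp add: y_def s_def)
    have "4 * inner y (T x) = inner (x + y) (T (x + y)) - inner (x - y) (T (x - y))"
      using adj_inner[OF T, of x y]
      by (simp add: blinfun.bilinear_simps inner_add inner_diff inner_commute)
    also have "\<dots> \<le> c * (norm (x + y))\<^sup>2 + c * (norm (x - y))\<^sup>2"
      using b[of "x + y"] b[of "x - y"] by linarith
    also have "\<dots> = 2 * c * ((norm x)\<^sup>2 + (norm y)\<^sup>2)"
      by (simp add: power2_norm_eq_inner inner_add inner_diff inner_commute algebra_simps)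
    also have "\<dots> = 4 * (c * norm x * norm x)" by (simp add: ny power2_eq_square)
    finally have "inner y (T x) \<le> c * norm x * norm x" by simp
    moreover have "inner y (T x) = norm x * norm (T x)"
      using False by (simp add: y_def s_def flip: power2_norm_eq_inner) (simp add: power2_eq_square)
    ultimately have "norm x * norm (T x) \<le> norm x * (c * norm x)" by (simp add: mult_ac)
    thus ?thesis using False by simp
  qed
qed

lemma inner_op_le_norm: "\<bar>inner x (T x)\<bar> \<le> norm T * (norm x)\<^sup>2" for T :: "'a::chilbert_space op"
proof -
  have "\<bar>inner x (T x)\<bar> \<le> norm x * norm (T x)" by (rule Cauchy_Schwarz_ineq2)
  also have "\<dots> \<le> norm x * (norm T * norm x)" by (intro mult_left_mono norm_blinfun) auto
  finally show ?thesis by (simp add: power2_eq_square mult_ac)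
qed

text \<open>Positivity of the form at \<open>x - s *\<^sub>R T x\<close>, with the step
  \<open>s = 1 / norm T\<close>. This is what turns a lower bound on \<open>norm (T x)\<close> into
  coercivity of the form.\<close>

lemma pos_ops_norm_apply:
  fixes T :: "'a::chilbert_space op"
  assumes T: "T \<in> pos_ops"
  shows "(norm (T x))\<^sup>2 \<le> norm T * inner x (T x)"
proof (cases "T = 0")
  case False
  define s where "s = 1 / norm T"
  have sa: "sa T" using T by (rule pos_ops_sa)
  have "0 \<le> inner (x - s *\<^sub>R T x) (T (x - s *\<^sub>R T x))" using T by (rule pos_ops_inner)
  also have "\<dots> = inner x (T x) - 2 * s * (norm (T x))\<^sup>2 + s\<^sup>2 * inner (T x) (T (T x))"
    using adj_inner[OF sa, of x "T x"]
    by (simp add: blinfun.bilinear_simps inner_diff power2_norm_eq_inner inner_commute algebra_simps)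
      (simp add: power2_eq_square)
  also have "\<dots> \<le> inner x (T x) - 2 * s * (norm (T x))\<^sup>2 + s\<^sup>2 * (norm T * (norm (T x))\<^sup>2)"
    using inner_op_le_norm[of "T x" T] by (intro add_left_mono mult_left_mono) auto
  also have "\<dots> = inner x (T x) - s * (norm (T x))\<^sup>2"
    using False by (simp add: s_def power2_eq_square field_simps)
  finally show ?thesis using False by (simp add: s_def field_simps)
qed (simp add: blinfun.bilinear_simps)

section \<open>Inverses and invertible positive operators\<close>

lemma op_invertibleE:
  assumes "op_invertible A"
  obtains B where "B \<in> bounded_ops" "A \<odot> B = one_op" "B \<odot> A = one_op"
  using assms by (auto simp: op_invertible_def)

lemma op_invertible_compose:
  assumes "op_invertible A" "op_invertible B"
  shows "op_invertible (A \<odot> B)"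
proof -
  obtain A' B' where 1: "A' \<in> bounded_ops" "A \<odot> A' = one_op" "A' \<odot> A = one_op"
    and 2: "B' \<in> bounded_ops" "B \<odot> B' = one_op" "B' \<odot> B = one_op"
    using assms by (metis op_invertibleE)
  have "(A \<odot> B) \<odot> (B' \<odot> A') = A \<odot> (B \<odot> B') \<odot> A'" "(B' \<odot> A') \<odot> (A \<odot> B) = B' \<odot> (A' \<odot> A) \<odot> B"
    by (simp_all only: comp_op_assoc)
  hence "(A \<odot> B) \<odot> (B' \<odot> A') = one_op" "(B' \<odot> A') \<odot> (A \<odot> B) = one_op"
    by (simp_all add: 1 2 comp_op_simps(8,9))
  thus ?thesis unfolding op_invertible_def using 1 2 bounded_ops_compose by blast
qed

lemma op_inv_eqI:
  assumes "B \<in> bounded_ops" "A \<odot> B = one_op" "B \<odot> A = one_op"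
  shows "op_inv A = B"
  unfolding op_inv_def
proof (rule the_equality)
  fix C assume "C \<in> bounded_ops \<and> A \<odot> C = one_op \<and> C \<odot> A = one_op"
  thus "C = B" using assms by (metis comp_op_simps(1,8,9))
qed (use assms in blast)

lemma op_inv:
  assumes "op_invertible A"
  shows "op_inv A \<in> bounded_ops" "A \<odot> op_inv A = one_op" "op_inv A \<odot> A = one_op"
  using assms op_inv_eqI by (metis op_invertibleE)+

lemma op_inv_apply:
  assumes "op_invertible A"
  shows "A (op_inv A x) = x" "op_inv A (A x) = x"
  using op_inv[OF assms] by (metis blinfun_apply_blinfun_compose blinfun_apply_id_blinfun)+

lemma op_inv_invertible: "op_invertible A \<Longrightarrow> A \<in> bounded_ops \<Longrightarrow> op_invertible (op_inv A)"
  using op_inv unfolding op_invertible_def by blast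

lemma op_inv_inv: "op_invertible A \<Longrightarrow> A \<in> bounded_ops \<Longrightarrow> op_inv (op_inv A) = A"
  by (rule op_inv_eqI) (auto simp: op_inv)

lemma op_inv_sa: "op_invertible A \<Longrightarrow> sa A \<Longrightarrow> sa (op_inv A)"
  unfolding adj_def by (metis op_inv(1) op_inv_apply(1))

lemma op_invertible_scaleR:
  assumes "op_invertible A" "r \<noteq> 0" shows "op_invertible (r *\<^sub>R A)"
proof -
  obtain B where "B \<in> bounded_ops" "A \<odot> B = one_op" "B \<odot> A = one_op"
    using assms(1) by (rule op_invertibleE)
  thus ?thesis using assms(2) unfolding op_invertible_def
    by (intro bexI[of _ "(1/r) *\<^sub>R B"]) (auto simp: comp_op_simps bounded_ops_scaleR)
qed

text \<open>The geometric series converges in the Banach space of real-linear operators, so complex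
  linearity of its sum has to be carried through the limit.\<close>

lemma op_invertible_Neumann:
  fixes S :: "'a::chilbert_space op"
  assumes S: "S \<in> bounded_ops" and n: "norm S < 1"
  shows "op_invertible (one_op - S)"
proof -
  define P where "P n = (((\<odot>) S) ^^ n) one_op" for n
  have P_Suc: "P (Suc n) = S \<odot> P n" for n by (simp add: P_def)
  have P0: "P 0 = one_op" by (simp add: P_def)
  have comm: "S \<odot> P n = P n \<odot> S" for n
    by (induction n) (simp_all add: P_Suc P0 comp_op_simps(8,9), metis comp_op_assoc)
  have Pb: "P n \<in> bounded_ops" for n
    by (induction n) (simp_all add: P_Suc P0 bounded_ops_one bounded_ops_compose S)
  have nP: "norm (P n) \<le> norm S ^ n * norm (one_op :: 'a op)" for n
  proof (induction n)
    case (Suc n)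
    have "norm (P (Suc n)) \<le> norm S * norm (P n)" unfolding P_Suc by (rule norm_blinfun_compose)
    also have "\<dots> \<le> norm S * (norm S ^ n * norm (one_op :: 'a op))"
      by (intro mult_left_mono Suc) auto
    finally show ?case by simp
  qed (simp add: P0)
  have sm: "summable P"
    by (rule summable_comparison_test'[where N = 0, OF _ nP])
      (use n in \<open>auto intro!: summable_mult2 summable_geometric\<close>)
  define U where "U = suminf P"
  have U: "P sums U" using sm by (simp add: U_def summable_sums)
  have Ub: "U \<in> bounded_ops"
  proof (rule bounded_ops_lim[OF U[unfolded sums_def]])
    have "sum P {..<n} \<in> bounded_ops" for n
      by (induction n) (simp_all add: bounded_ops_zero bounded_ops_add Pb)
    thus "\<forall>\<^sub>F n in sequentially. sum P {..<n} \<in> bounded_ops" by simp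
  qed simp
  have shift: "(\<lambda>n. P (Suc n)) sums (U - one_op)"
    using sums_Suc_iff[of P "U - one_op"] U by (simp add: P0)
  have L: "(\<lambda>n. S \<odot> P n) sums (S \<odot> U)"
    using bounded_linear.sums[OF bounded_bilinear.bounded_linear_right[OF bounded_bilinear_blinfun_compose] U] .
  have R: "(\<lambda>n. P n \<odot> S) sums (U \<odot> S)"
    using bounded_linear.sums[OF bounded_bilinear.bounded_linear_left[OF bounded_bilinear_blinfun_compose] U] .
  have "S \<odot> U = U - one_op" using L shift unfolding P_Suc by (rule sums_unique2)
  moreover have "U \<odot> S = U - one_op" using R shift unfolding P_Suc comm by (rule sums_unique2)
  ultimately show ?thesis unfolding op_invertible_def
    by (intro bexI[OF _ Ub]) (simp_all add: comp_op_simps)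
qed

text \<open>With \<open>M = norm T + c\<close> the operator \<open>S = 1 - T/M\<close> has its form
  between 0 and \<open>1 - c/M\<close> times the squared norm, so the Neumann series inverts
  \<open>1 - S = T/M\<close>.\<close>

lemma op_invertible_form:
  fixes T :: "'a::chilbert_space op"
  assumes T: "sa T" and c: "c > 0" and b: "\<And>x. c * (norm x)\<^sup>2 \<le> inner x (T x)"
  shows "op_invertible T"
proof -
  define M where "M = norm T + c"
  have M: "M > 0" using c by (simp add: M_def add_nonneg_pos)
  define S where "S = one_op - (1/M) *\<^sub>R T"
  have S: "sa S" unfolding S_def by (intro adj_diff adj_scaleR T adj_one)
  have "norm S \<le> 1 - c / M"
  proof (rule norm_le_form[OF S])
    show "0 \<le> 1 - c / M" using M by (simp add: M_def)
    fix x
    have e: "inner x (S x) = (norm x)\<^sup>2 - inner x (T x) / M"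
      by (simp add: S_def blinfun.bilinear_simps inner_diff power2_norm_eq_inner)
    have "inner x (T x) / M \<le> (norm x)\<^sup>2"
    proof -
      have "inner x (T x) \<le> norm T * (norm x)\<^sup>2" using inner_op_le_norm[of x T] by linarith
      also have "\<dots> \<le> M * (norm x)\<^sup>2" using c by (intro mult_right_mono) (auto simp: M_def)
      finally show ?thesis using M by (simp add: field_simps)
    qed
    moreover have "c * (norm x)\<^sup>2 / M \<le> inner x (T x) / M" using b[of x] M by (intro divide_right_mono) auto
    ultimately show "\<bar>inner x (S x)\<bar> \<le> (1 - c / M) * (norm x)\<^sup>2"
      unfolding e by (simp add: algebra_simps)
  qed
  also have "\<dots> < 1" using c M by simp
  finally have "op_invertible (one_op - S)"
    by (intro op_invertible_Neumann adj_bounded(1)[OF S])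
  hence "op_invertible (M *\<^sub>R (one_op - S))" using M by (intro op_invertible_scaleR) auto
  thus ?thesis using M by (simp add: S_def)
qed

text \<open>Being bounded below makes \<open>T \<odot> T\<close> coercive. Its inverse
  \<open>Y\<close> commutes with \<open>T\<close>, hence \<open>T \<odot> Y\<close> is a two-sided
  inverse of \<open>T\<close>.\<close>

lemma op_invertible_below:
  fixes T :: "'a::chilbert_space op"
  assumes T: "sa T" and c: "c > 0" and b: "\<And>x. c * norm x \<le> norm (T x)"
  shows "op_invertible T"
proof -
  have s: "sa (T \<odot> T)" using T by (rule adj_compose) fact
  have "op_invertible (T \<odot> T)"
  proof (rule op_invertible_form[OF s])
    show "c\<^sup>2 > 0" using c by simp
    fix x
    have "(c * norm x)\<^sup>2 \<le> (norm (T x))\<^sup>2" using b[of x] c by (intro power_mono) auto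
    thus "c\<^sup>2 * (norm x)\<^sup>2 \<le> inner x ((T \<odot> T) x)"
      using adj_inner[OF T, of x "T x"] by (simp add: power2_norm_eq_inner power_mult_distrib)
  qed
  then obtain Y where Y: "Y \<in> bounded_ops" "(T \<odot> T) \<odot> Y = one_op" "Y \<odot> (T \<odot> T) = one_op"
    by (rule op_invertibleE)
  have "Y \<odot> T = (Y \<odot> T) \<odot> ((T \<odot> T) \<odot> Y)" by (simp only: Y comp_op_simps(8,9))
  also have "\<dots> = Y \<odot> (T \<odot> T) \<odot> (T \<odot> Y)" by (simp add: comp_op_assoc)
  also have "\<dots> = T \<odot> Y" by (simp only: Y comp_op_simps(8,9))
  finally have "Y \<odot> T = T \<odot> Y" .
  thus ?thesis unfolding op_invertible_def
    using Y adj_bounded(1)[OF T] by (intro bexI[of _ "T \<odot> Y"]) (auto simp: comp_op_assoc bounded_ops_compose)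
qed

lemma op_invertible_imp_below:
  fixes T :: "'a::chilbert_space op"
  assumes "op_invertible T"
  shows "\<exists>c>0. \<forall>x. c * norm x \<le> norm (T x)"
proof -
  define M where "M = norm (op_inv T) + 1"
  have M: "M > 0" by (simp add: M_def add_nonneg_pos)
  have "norm x \<le> M * norm (T x)" for x
  proof -
    have "norm x = norm (op_inv T (T x))" by (simp add: op_inv_apply[OF assms])
    also have "\<dots> \<le> norm (op_inv T) * norm (T x)" by (rule norm_blinfun)
    also have "\<dots> \<le> M * norm (T x)" by (intro mult_right_mono) (auto simp: M_def)
    finally show ?thesis .
  qed
  thus ?thesis using M by (intro exI[of _ "1 / M"]) (auto simp: field_simps)
qed

text \<open>Invertibility in quantitative form: a coercivity constant survives sums, congruences and
  small perturbations, which the bare existence of an inverse does not show. The summand 1 in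
  \<open>M\<close> keeps it positive for \<open>A = 0\<close>.\<close>

lemma pos_inv_ops_iff:
  "A \<in> pos_inv_ops \<longleftrightarrow> sa A \<and> (\<exists>c>0. \<forall>x. c * (norm x)\<^sup>2 \<le> inner x (A x))"
  for A :: "'a::chilbert_space op"
proof (intro iffI conjI)
  assume "A \<in> pos_inv_ops"
  hence p: "A \<in> pos_ops" and i: "op_invertible A" by (auto simp: pos_inv_ops_def)
  show "sa A" using p by (rule pos_ops_sa)
  obtain c where c: "c > 0" "\<And>x. c * norm x \<le> norm (A x)" using op_invertible_imp_below[OF i] by blast
  define M where "M = norm A + 1"
  have M: "M > 0" by (simp add: M_def add_nonneg_pos)
  have "c\<^sup>2 / M * (norm x)\<^sup>2 \<le> inner x (A x)" for x
  proof -
    have "(c * norm x)\<^sup>2 \<le> (norm (A x))\<^sup>2" using c(2)[of x] c(1) by (intro power_mono) auto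
    also have "\<dots> \<le> norm A * inner x (A x)" by (rule pos_ops_norm_apply[OF p])
    also have "\<dots> \<le> M * inner x (A x)" using pos_ops_inner[OF p] by (intro mult_right_mono) (auto simp: M_def)
    finally show ?thesis using M by (simp add: field_simps)
  qed
  thus "\<exists>c>0. \<forall>x. c * (norm x)\<^sup>2 \<le> inner x (A x)"
    using M c(1) by (intro exI[of _ "c\<^sup>2 / M"]) auto
next
  assume *: "sa A \<and> (\<exists>c>0. \<forall>x. c * (norm x)\<^sup>2 \<le> inner x (A x))"
  then obtain c where c: "c > 0" "\<And>x. c * (norm x)\<^sup>2 \<le> inner x (A x)" by blast
  have "0 \<le> inner x (A x)" for x using c(2)[of x] c(1) by (meson less_eq_real_def mult_nonneg_nonneg order_trans zero_le_power2)
  thus "A \<in> pos_inv_ops"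
    using * c op_invertible_form[of A c] by (auto simp: pos_inv_ops_def pos_ops_iff)
qed

lemma pos_inv_opsI: "sa A \<Longrightarrow> c > 0 \<Longrightarrow> (\<And>x. c * (norm x)\<^sup>2 \<le> inner x (A x)) \<Longrightarrow> A \<in> pos_inv_ops"
  by (auto simp: pos_inv_ops_iff)

lemma pos_inv_opsE:
  assumes "A \<in> pos_inv_ops"
  obtains c where "c > 0" "\<And>x. c * (norm x)\<^sup>2 \<le> inner x (A x)"
  using assms by (auto simp: pos_inv_ops_iff)

lemma pos_inv_opsD: "A \<in> pos_inv_ops \<Longrightarrow> A \<in> pos_ops" "A \<in> pos_inv_ops \<Longrightarrow> op_invertible A"
  "A \<in> pos_inv_ops \<Longrightarrow> sa A"
  by (auto simp: pos_inv_ops_def pos_ops_sa)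

lemma op_inv_pos_inv: assumes "A \<in> pos_inv_ops" shows "op_inv A \<in> pos_inv_ops"
proof -
  note A = pos_inv_opsD[OF assms]
  have "0 \<le> inner x (op_inv A x)" for x
    using pos_ops_inner[OF A(1), of "op_inv A x"] by (simp add: op_inv_apply A inner_commute)
  thus ?thesis using A op_inv_sa op_inv_invertible adj_bounded(1)[OF A(3)] by (auto simp: pos_inv_ops_def pos_ops_iff)
qed

lemma op_inv_antimono:
  assumes "A \<in> pos_inv_ops" "B \<in> pos_inv_ops" "A \<preceq> B"
  shows "op_inv B \<preceq> op_inv A"
proof (rule op_leI)
  note A = pos_inv_opsD[OF assms(1)] and B = pos_inv_opsD[OF assms(2)]
  show "sa (op_inv B)" "sa (op_inv A)" using A B op_inv_sa by blast+
  fix x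
  define y z where "y = op_inv B x" and "z = op_inv A x"
  have y: "B y = x" and z: "A z = x" by (simp_all add: y_def z_def op_inv_apply A B)
  have "0 \<le> inner (z - y) (A (z - y))" using A(1) by (rule pos_ops_inner)
  also have "\<dots> = inner z x - 2 * inner y x + inner y (A y)"
    using adj_inner[OF A(3), of z y] by (simp add: blinfun.bilinear_simps inner_diff z inner_commute)
  also have "\<dots> \<le> inner z x - 2 * inner y x + inner y (B y)" using op_leD[OF assms(3)] by simp
  also have "\<dots> = inner z x - inner y x" by (simp add: y)
  finally show "inner x (op_inv B x) \<le> inner x (op_inv A x)" by (simp add: y_def z_def inner_commute)
qed

section \<open>Spectrum of self-adjoint operators\<close>

text \<open>A self-adjoint operator has no residual spectrum: a real number lies in the spectrum if
  and only if there are approximate eigenvectors for it.\<close>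

lemma in_spectrum_iff:
  assumes "sa A"
  shows "t \<notin> real_spectrum A \<longleftrightarrow> (\<exists>c>0. \<forall>x. c * norm x \<le> norm (A x - t *\<^sub>R x))"
proof -
  have s: "sa (A - t *\<^sub>R one_op)" using assms by (intro adj_diff adj_scaleR adj_one)
  have e: "(A - t *\<^sub>R one_op) x = A x - t *\<^sub>R x" for x by (simp add: blinfun.bilinear_simps)
  show ?thesis
    using op_invertible_below[OF s] op_invertible_imp_below[of "A - t *\<^sub>R one_op"]
    unfolding real_spectrum_def e by blast
qed

lemma closed_real_spectrum:
  assumes A: "sa A"
  shows "closed (real_spectrum A)"
proof -
  have "open (- real_spectrum A)"
    unfolding open_dist
  proof
    fix t assume "t \<in> - real_spectrum A"
    then obtain c where c: "c > 0" "\<And>x. c * norm x \<le> norm (A x - t *\<^sub>R x)"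
      using in_spectrum_iff[OF A] by auto
    show "\<exists>e>0. \<forall>s. dist s t < e \<longrightarrow> s \<in> - real_spectrum A"
    proof (intro exI conjI allI impI)
      show "c / 2 > 0" using c by simp
      fix s assume s: "dist s t < c / 2"
      have "c / 2 * norm x \<le> norm (A x - s *\<^sub>R x)" for x
      proof -
        have "A x - t *\<^sub>R x = (A x - s *\<^sub>R x) + (s - t) *\<^sub>R x" by (simp add: algebra_simps)
        hence "norm (A x - t *\<^sub>R x) \<le> norm (A x - s *\<^sub>R x) + \<bar>s - t\<bar> * norm x"
          using norm_triangle_ineq[of "A x - s *\<^sub>R x" "(s - t) *\<^sub>R x"] by (metis norm_scaleR)
        hence "c * norm x \<le> norm (A x - s *\<^sub>R x) + \<bar>s - t\<bar> * norm x"
          using c(2)[of x] by linarith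
        moreover have "\<bar>s - t\<bar> * norm x \<le> c / 2 * norm x"
          using s by (intro mult_right_mono) (auto simp: dist_real_def)
        ultimately show ?thesis by simp
      qed
      thus "s \<in> - real_spectrum A" using in_spectrum_iff[OF A] c(1) by (auto intro!: exI[of _ "c / 2"])
    qed
  qed
  thus ?thesis by (simp add: closed_def)
qed

lemma real_spectrum_subset_form:
  assumes A: "sa A" and b: "\<And>x. a * (norm x)\<^sup>2 \<le> inner x (A x)" "\<And>x. inner x (A x) \<le> b * (norm x)\<^sup>2"
  shows "real_spectrum A \<subseteq> {a..b}"
proof
  fix t assume t: "t \<in> real_spectrum A"
  have "a \<le> t"
  proof (rule ccontr)
    assume "\<not> a \<le> t"
    hence "op_invertible (A - t *\<^sub>R one_op)"
      using b(1) by (intro op_invertible_form[where c = "a - t"] adj_diff adj_scaleR A adj_one)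
        (auto simp: blinfun.bilinear_simps inner_diff power2_norm_eq_inner algebra_simps)
    thus False using t by (simp add: real_spectrum_def)
  qed
  moreover have "t \<le> b"
  proof (rule ccontr)
    assume "\<not> t \<le> b"
    hence "op_invertible (t *\<^sub>R one_op - A)"
      using b(2) by (intro op_invertible_form[where c = "t - b"] adj_diff adj_scaleR A adj_one)
        (auto simp: blinfun.bilinear_simps inner_diff power2_norm_eq_inner algebra_simps)
    hence "op_invertible ((-1) *\<^sub>R (t *\<^sub>R one_op - A))" by (rule op_invertible_scaleR) simp
    thus False using t by (simp add: real_spectrum_def)
  qed
  ultimately show "t \<in> {a..b}" by simp
qed

lemma real_spectrum_subset_norm: "sa A \<Longrightarrow> real_spectrum A \<subseteq> {- norm A..norm A}"
  using inner_op_le_norm[of _ A] by (intro real_spectrum_subset_form) (auto simp: abs_le_iff minus_le_iff)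

lemma compact_real_spectrum: "sa A \<Longrightarrow> compact (real_spectrum A)"
  using real_spectrum_subset_norm bounded_closed_interval bounded_subset closed_real_spectrum
  by (metis compact_eq_bounded_closed)

lemma real_spectrum_shift:
  "t \<in> real_spectrum (A - s *\<^sub>R one_op) \<longleftrightarrow> t + s \<in> real_spectrum A"
  by (simp add: real_spectrum_def scaleR_add_left diff_diff_eq add.commute)

lemma real_spectrum_uminus: "t \<in> real_spectrum (- A) \<longleftrightarrow> - t \<in> real_spectrum A"
proof -
  have "op_invertible (- B)" if "op_invertible B" for B :: "'a op"
    using op_invertible_scaleR[OF that, of "-1"] by simp
  hence "op_invertible (- B) \<longleftrightarrow> op_invertible B" for B :: "'a op" by (metis minus_minus)
  from this[of "A + t *\<^sub>R one_op"] show ?thesis by (simp add: real_spectrum_def)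
qed

text \<open>If the supremum \<open>l\<close> of the numerical range were outside the spectrum, the
  positive operator \<open>l - D\<close> would be invertible, hence coercive, and the supremum would
  drop by the coercivity constant. The vector \<open>x0\<close> makes \<open>l\<close>
  positive.\<close>

lemma spectrum_top:
  fixes D :: "'a::chilbert_space op"
  assumes D: "sa D" and x0: "inner x0 (D x0) > 0"
  shows "\<exists>l>0. l \<in> real_spectrum D \<and> (\<forall>x. inner x (D x) \<le> l * (norm x)\<^sup>2)"
proof -
  define Q where "Q = {inner x (D x) |x. norm x = 1}"
  have bdd: "bdd_above Q" unfolding Q_def bdd_above_def
  proof (intro exI ballI)
    fix q assume "q \<in> {inner x (D x) |x. norm x = 1}"
    then obtain x where "norm x = 1" "q = inner x (D x)" by blast
    thus "q \<le> norm D" using inner_op_le_norm[of x D] by simp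
  qed
  have form: "inner x (D x) = (norm x)\<^sup>2 * inner (x /\<^sub>R norm x) (D (x /\<^sub>R norm x))" for x
    by (cases "x = 0") (simp_all add: blinfun.bilinear_simps power2_eq_square field_simps)
  define l where "l = Sup Q"
  have mem: "inner (x /\<^sub>R norm x) (D (x /\<^sub>R norm x)) \<in> Q" if "x \<noteq> 0" for x
    unfolding Q_def by (intro CollectI exI[of _ "x /\<^sub>R norm x"] conjI refl) (use that in simp)
  have le: "inner x (D x) \<le> l * (norm x)\<^sup>2" for x
    using cSup_upper[OF mem bdd, of x] unfolding form[of x] l_def
    by (cases "x = 0") (auto simp: mult.commute intro!: mult_right_mono)
  have "x0 \<noteq> 0" using x0 by auto
  hence l: "l > 0" using le[of x0] x0 by (metis less_le_trans zero_less_mult_pos2 zero_less_norm_iff zero_less_power)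
  have "l \<in> real_spectrum D"
  proof (rule ccontr)
    assume "l \<notin> real_spectrum D"
    hence "op_invertible ((-1) *\<^sub>R (D - l *\<^sub>R one_op))"
      by (intro op_invertible_scaleR) (simp_all add: real_spectrum_def)
    hence i: "op_invertible (l *\<^sub>R one_op - D)" by simp
    have "l *\<^sub>R one_op - D \<in> pos_ops"
      using le by (auto simp: pos_ops_iff blinfun.bilinear_simps inner_diff power2_norm_eq_inner
        intro!: adj_diff adj_scaleR D)
    then obtain c where c: "c > 0" "\<And>x. c * (norm x)\<^sup>2 \<le> inner x ((l *\<^sub>R one_op - D) x)"
      using i by (metis mem_Collect_eq pos_inv_opsE pos_inv_ops_def)
    have "l \<le> l - c" unfolding l_def
    proof (rule cSup_least)
      show "Q \<noteq> {}" using mem[OF \<open>x0 \<noteq> 0\<close>] by auto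
      fix q assume "q \<in> Q"
      then obtain x where "norm x = 1" "q = inner x (D x)" by (auto simp: Q_def)
      thus "q \<le> Sup Q - c"
        using c(2)[of x] by (simp add: blinfun.bilinear_simps inner_diff l_def flip: power2_norm_eq_inner)
    qed
    thus False using c by simp
  qed
  thus ?thesis using l le by blast
qed

lemma spectrum_le_imp_form_le:
  fixes A :: "'a::chilbert_space op"
  assumes A: "sa A" and b: "\<And>t. t \<in> real_spectrum A \<Longrightarrow> t \<le> b"
  shows "inner x (A x) \<le> b * (norm x)\<^sup>2"
proof (rule ccontr)
  assume "\<not> ?thesis"
  hence "inner x ((A - b *\<^sub>R one_op) x) > 0"
    by (simp add: blinfun.bilinear_simps inner_diff power2_norm_eq_inner)
  moreover have "sa (A - b *\<^sub>R one_op)" by (intro adj_diff adj_scaleR A adj_one)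
  ultimately obtain l where "l > 0" "l \<in> real_spectrum (A - b *\<^sub>R one_op)" using spectrum_top by blast
  thus False using b[of "l + b"] by (simp add: real_spectrum_shift)
qed

lemma spectrum_ge_imp_form_ge:
  fixes A :: "'a::chilbert_space op"
  assumes A: "sa A" and b: "\<And>t. t \<in> real_spectrum A \<Longrightarrow> a \<le> t"
  shows "a * (norm x)\<^sup>2 \<le> inner x (A x)"
  using spectrum_le_imp_form_le[OF adj_minus[OF A], of "- a" x] b
  by (force simp: real_spectrum_uminus blinfun.bilinear_simps)

lemma norm_le_spectrum:
  fixes A :: "'a::chilbert_space op"
  assumes A: "sa A" and c: "0 \<le> c" and b: "\<And>t. t \<in> real_spectrum A \<Longrightarrow> \<bar>t\<bar> \<le> c"
  shows "norm A \<le> c"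
proof (rule norm_le_form[OF A _ c])
  fix x
  have "inner x (A x) \<le> c * (norm x)\<^sup>2" using b by (intro spectrum_le_imp_form_le A) force
  moreover have "(- c) * (norm x)\<^sup>2 \<le> inner x (A x)" using b by (intro spectrum_ge_imp_form_ge A) force
  ultimately show "\<bar>inner x (A x)\<bar> \<le> c * (norm x)\<^sup>2" by simp
qed

section \<open>Polynomials of an operator and their norms\<close>

lemma poly_op_0 [simp]: "poly_op 0 A = 0"
  by (simp add: poly_op_def)

lemma poly_op_pCons: "poly_op (pCons a p) A = a *\<^sub>R one_op + A \<odot> poly_op p A"
proof (cases "p = 0")
  case True thus ?thesis by (simp add: poly_op_def comp_op_simps)
next
  case False
  have "A \<odot> (\<Sum>i\<in>S. X i) = (\<Sum>i\<in>S. A \<odot> X i)" for S and X :: "nat \<Rightarrow> 'a op"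
    by (induction S rule: infinite_finite_induct) (simp_all add: comp_op_simps)
  thus ?thesis using False
    by (simp add: poly_op_def sum.atMost_Suc_shift comp_op_simps del: sum.atMost_Suc)
qed

lemma poly_op_const: "poly_op [:a:] A = a *\<^sub>R one_op"
  by (simp add: poly_op_pCons comp_op_simps)

lemma poly_op_add: "poly_op (p + q) A = poly_op p A + poly_op q A"
  by (induction p q rule: poly_induct2) (simp_all add: poly_op_pCons comp_op_simps algebra_simps)

lemma poly_op_smult: "poly_op (smult a p) A = a *\<^sub>R poly_op p A"
  by (induction p) (simp_all add: poly_op_pCons comp_op_simps algebra_simps)

lemma poly_op_minus: "poly_op (- p) A = - poly_op p A"
  using poly_op_smult[of "-1" p A] by simp

lemma poly_op_diff: "poly_op (p - q) A = poly_op p A - poly_op q A"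
  using poly_op_add[of p "- q" A] by (simp add: poly_op_minus)

lemma poly_op_mult: "poly_op (p * q) A = poly_op p A \<odot> poly_op q A"
  by (induction p) (simp_all add: poly_op_pCons poly_op_add poly_op_smult comp_op_simps)

lemma poly_op_intertwine:
  fixes A B C :: "'a::chilbert_space op"
  assumes "A \<odot> C = C \<odot> B"
  shows "poly_op p A \<odot> C = C \<odot> poly_op p B"
proof (induction p)
  case (pCons a p)
  have "A \<odot> (poly_op p A \<odot> C) = C \<odot> (B \<odot> poly_op p B)"
    unfolding pCons(2) comp_op_assoc[symmetric] assms ..
  thus ?case by (simp add: poly_op_pCons comp_op_simps)
qed (simp add: comp_op_simps)

lemma poly_op_sa: "sa A \<Longrightarrow> sa (poly_op p A)"
proof (induction p)
  case (pCons a p)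
  have "A \<odot> poly_op p A = poly_op p A \<odot> A" using poly_op_intertwine[of A A A p] by simp
  hence "sa (A \<odot> poly_op p A)" using adj_compose[OF pCons(3) pCons(2)[OF pCons(3)]] by simp
  thus ?case by (simp add: poly_op_pCons adj_add adj_scaleR)
qed simp

lemma poly_op_tendsto: "(X \<longlongrightarrow> A) F \<Longrightarrow> ((\<lambda>n. poly_op p (X n)) \<longlongrightarrow> poly_op p A) F"
proof (induction p)
  case (pCons a p)
  thus ?case unfolding poly_op_pCons
    by (intro tendsto_add tendsto_const bounded_bilinear.tendsto[OF bounded_bilinear_blinfun_compose]) auto
qed simp

text \<open>A complex root is non-real here and is also a root of \<open>Q\<close>. The remainder of
  \<open>p\<close> modulo \<open>Q\<close> is real, of degree at most one, and vanishes at a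
  non-real point, so it is zero. Real factors keep the polynomials of operators inside
  \<open>poly_op\<close>, which takes real coefficients.\<close>

lemma real_poly_quadratic_factor:
  fixes p :: "real poly"
  assumes deg: "degree p > 0" and nr: "\<And>x. poly p x \<noteq> 0"
  shows "\<exists>a b q. b \<noteq> 0 \<and> p = [:a\<^sup>2 + b\<^sup>2, -2 * a, 1:] * q"
proof -
  define ev where "ev p z = poly (map_poly complex_of_real p) z" for p z
  have ev0: "ev 0 z = 0" for z by (simp add: ev_def)
  have evC: "ev (pCons a p) z = of_real a + z * ev p z" for a p z
    by (simp add: ev_def map_poly_pCons)
  have ev_add: "ev (p + q) z = ev p z + ev q z" for p q z
    by (induction p q rule: poly_induct2) (simp_all add: ev0 evC algebra_simps)
  have ev_smult: "ev (smult a p) z = of_real a * ev p z" for a p z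
    by (induction p) (simp_all add: ev0 evC algebra_simps)
  have ev_mult: "ev (p * q) z = ev p z * ev q z" for p q z
    by (induction p) (simp_all add: ev0 evC ev_add ev_smult algebra_simps)
  have "degree (map_poly complex_of_real p) = degree p" by (rule degree_map_poly) auto
  hence "\<not> constant (poly (map_poly complex_of_real p))" using deg by (simp add: constant_degree)
  then obtain z where z: "ev p z = 0" unfolding ev_def using fundamental_theorem_of_algebra by blast
  define a b where "a = Re z" and "b = Im z"
  have zab: "z = Complex a b" by (simp add: a_def b_def)
  have b: "b \<noteq> 0"
  proof
    assume "b = 0"
    hence "z = of_real a" using zab by (simp add: complex_eq_iff)
    moreover have "ev q (of_real a) = of_real (poly q a)" for q
      by (induction q) (simp_all add: ev0 evC)
    ultimately have "complex_of_real (poly p a) = 0" using z by simp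
    thus False using nr by simp
  qed
  define Q where "Q = [:a\<^sup>2 + b\<^sup>2, -2 * a, 1:]"
  have Qz: "ev Q z = 0"
    by (simp add: Q_def ev0 evC zab complex_eq_iff power2_eq_square algebra_simps)
  define r where "r = p mod Q"
  have "degree Q = 2" "Q \<noteq> 0" by (simp_all add: Q_def)
  hence "degree r \<le> 1" using degree_mod_less[of Q p] by (auto simp: r_def)
  hence "r = [:coeff r 0, coeff r 1:]"
    by (intro poly_eqI) (auto simp: coeff_pCons split: nat.split intro!: coeff_eq_0)
  then obtain u v where r: "r = [:u, v:]" by blast
  have "p = Q * (p div Q) + r" by (simp add: r_def)
  hence "ev p z = ev Q z * ev (p div Q) z + ev r z" by (metis ev_add ev_mult)
  hence "ev r z = 0" using z Qz by simp
  hence "u + v * a = 0" "v * b = 0"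
    by (simp_all add: r ev0 evC zab complex_eq_iff algebra_simps)
  hence "r = 0" using b by (simp add: r)
  hence "p = Q * (p div Q)" using \<open>p = Q * (p div Q) + r\<close> by simp
  thus ?thesis using b Q_def by blast
qed

text \<open>Split off real factors: a linear one is invertible because its root is outside the
  spectrum, and a quadratic one is \<open>(A - a)^2 + b^2\<close>, which is coercive with constant
  \<open>b^2\<close>.\<close>

lemma poly_op_invertible:
  fixes A :: "'a::chilbert_space op"
  assumes A: "sa A"
  shows "p \<noteq> 0 \<Longrightarrow> (\<And>t. t \<in> real_spectrum A \<Longrightarrow> poly p t \<noteq> 0) \<Longrightarrow> op_invertible (poly_op p A)"
proof (induction "degree p" arbitrary: p rule: less_induct)
  case less
  consider "degree p = 0" | r where "poly p r = 0" | "degree p > 0" "\<And>x. poly p x \<noteq> 0" by auto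
  thus ?case
  proof cases
    case 1
    then obtain a where a: "p = [:a:]" by (auto elim: degree_eq_zeroE)
    have "op_invertible one_op" unfolding op_invertible_def using bounded_ops_one comp_op_simps(8) by blast
    moreover have "a \<noteq> 0" using less.prems(1) a by auto
    ultimately show ?thesis unfolding a poly_op_const by (rule op_invertible_scaleR)
  next
    case 2
    then obtain q where q: "p = [:-r, 1:] * q" by (auto simp: poly_eq_0_iff_dvd dvd_def)
    have "q \<noteq> 0" using q less.prems(1) by auto
    hence "degree q < degree p" unfolding q by (subst degree_mult_eq) auto
    moreover have "poly q t \<noteq> 0" if "t \<in> real_spectrum A" for t using less.prems(2)[OF that] q by auto
    ultimately have "op_invertible (poly_op q A)" using less.hyps[of q] \<open>q \<noteq> 0\<close> by blast
    moreover have "r \<notin> real_spectrum A" using less.prems(2) 2 by blast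
    hence "op_invertible (poly_op [:-r, 1:] A)"
      by (simp add: poly_op_pCons comp_op_simps real_spectrum_def)
    ultimately show ?thesis unfolding q poly_op_mult by (intro op_invertible_compose)
  next
    case 3
    then obtain a b q where b: "b \<noteq> 0" and q: "p = [:a\<^sup>2 + b\<^sup>2, -2 * a, 1:] * q"
      using real_poly_quadratic_factor by metis
    have "q \<noteq> 0" using q less.prems(1) by auto
    hence "degree q < degree p" unfolding q by (subst degree_mult_eq) auto
    moreover have "poly q t \<noteq> 0" for t using 3(2)[of t] q by auto
    ultimately have "op_invertible (poly_op q A)" using less.hyps[of q] \<open>q \<noteq> 0\<close> by blast
    moreover have "op_invertible (poly_op [:a\<^sup>2 + b\<^sup>2, -2 * a, 1:] A)"
    proof (rule op_invertible_form[OF poly_op_sa[OF A]])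
      show "b\<^sup>2 > 0" using b by simp
      fix x
      define y where "y = A x - a *\<^sub>R x"
      have "inner x (poly_op [:a\<^sup>2 + b\<^sup>2, -2 * a, 1:] A x) = inner y y + b\<^sup>2 * inner x x"
        using adj_inner[OF A, of x "A x"]
        by (simp add: y_def poly_op_pCons comp_op_simps blinfun.bilinear_simps inner_diff inner_add
            power2_eq_square inner_commute algebra_simps)
      thus "b\<^sup>2 * (norm x)\<^sup>2 \<le> inner x (poly_op [:a\<^sup>2 + b\<^sup>2, -2 * a, 1:] A x)"
        by (simp add: power2_norm_eq_inner)
    qed
    ultimately show ?thesis unfolding q poly_op_mult by (intro op_invertible_compose)
  qed
qed

text \<open>The spectrum of \<open>poly_op p A\<close> lies in the image of the spectrum of
  \<open>A\<close> under \<open>p\<close>, and the norm of a self-adjoint operator is controlled by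
  its spectrum. Through this estimate uniform convergence on the spectrum becomes norm
  convergence.\<close>

lemma norm_poly_op_le:
  fixes A :: "'a::chilbert_space op"
  assumes A: "sa A" and c: "0 \<le> c" and b: "\<And>t. t \<in> real_spectrum A \<Longrightarrow> \<bar>poly p t\<bar> \<le> c"
  shows "norm (poly_op p A) \<le> c"
proof (rule norm_le_spectrum[OF poly_op_sa[OF A] c])
  fix s assume s: "s \<in> real_spectrum (poly_op p A)"
  have "\<exists>t\<in>real_spectrum A. poly p t = s"
  proof (rule ccontr)
    assume n: "\<not> ?thesis"
    have e: "poly_op (p - [:s:]) A = poly_op p A - s *\<^sub>R one_op"
      by (simp add: poly_op_diff poly_op_const)
    have "\<not> op_invertible (poly_op (p - [:s:]) A)" using s by (simp add: e real_spectrum_def)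
    hence p: "p - [:s:] = 0" using poly_op_invertible[OF A, of "p - [:s:]"] n by auto
    hence "real_spectrum A = {}" using n by auto
    \<comment> \<open>The exceptional case: \<open>p\<close> is the constant \<open>s\<close> and no
      spectral point attains it, so the spectrum is empty. This happens only in the zero space,
      where every operator is invertible, with inverse 0.\<close>
    have zero: "x = 0" for x :: 'a
    proof (rule ccontr)
      assume x: "x \<noteq> 0"
      define D where "D = A - (- norm A - 1) *\<^sub>R one_op"
      have "sa D" unfolding D_def by (intro adj_diff adj_scaleR A adj_one)
      moreover have "inner x (D x) > 0"
      proof -
        have "inner x (D x) = inner x (A x) + norm A * (norm x)\<^sup>2 + (norm x)\<^sup>2"
          by (simp add: D_def blinfun.bilinear_simps inner_diff power2_norm_eq_inner algebra_simps)
        thus ?thesis using inner_op_le_norm[of x A] x by (smt (verit) zero_less_norm_iff zero_less_power)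
      qed
      ultimately obtain l where "l \<in> real_spectrum D" using spectrum_top by blast
      thus False using \<open>real_spectrum A = {}\<close> unfolding D_def by (simp only: real_spectrum_shift empty_iff)
    qed
    have "X = Y" for X Y :: "'a op" by (rule blinfun_eqI) (rule trans[OF zero zero[symmetric]])
    hence "poly_op (p - [:s:]) A \<odot> 0 = one_op" "0 \<odot> poly_op (p - [:s:]) A = one_op" by blast+
    hence "op_invertible (poly_op (p - [:s:]) A)"
      unfolding op_invertible_def using bounded_ops_zero by blast
    thus False using s by (simp add: e real_spectrum_def)
  qed
  thus "\<bar>s\<bar> \<le> c" using b by auto
qed

section \<open>Polynomial approximation and existence of the functional calculus\<close>

lemma Weierstrass_poly:
  fixes f :: "real \<Rightarrow> real"
  assumes K: "compact K" and f: "continuous_on K f" and e: "e > 0"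
  shows "\<exists>p. \<forall>t\<in>K. \<bar>f t - poly p t\<bar> < e"
proof -
  obtain g where g: "real_polynomial_function g" "\<And>x. x \<in> K \<Longrightarrow> \<bar>f x - g x\<bar> < e"
    using Stone_Weierstrass_real_polynomial_function[OF K f e] by blast
  then obtain a n where "g = (\<lambda>x. \<Sum>i\<le>n. a i * x ^ i)" by (auto simp: real_polynomial_function_iff_sum)
  hence "g x = poly (\<Sum>i\<le>n. monom (a i) i) x" for x by (simp add: poly_sum poly_monom)
  thus ?thesis using g(2) by (intro exI[of _ "\<Sum>i\<le>n. monom (a i) i"]) auto
qed

lemma Weierstrass_poly_seq:
  fixes f :: "real \<Rightarrow> real"
  assumes K: "compact K" and f: "continuous_on K f"
  shows "\<exists>p. uniform_limit K (\<lambda>n. poly (p n)) f sequentially"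
proof -
  have "\<exists>p. \<forall>t\<in>K. \<bar>f t - poly p t\<bar> < 1 / real (Suc n)" for n by (intro Weierstrass_poly K f) simp
  then obtain p where p: "\<And>n t. t \<in> K \<Longrightarrow> \<bar>f t - poly (p n) t\<bar> < 1 / real (Suc n)" by metis
  have "uniform_limit K (\<lambda>n. poly (p n)) f sequentially"
  proof (rule uniform_limitI)
    fix e :: real assume "e > 0"
    then obtain N where N: "1 / real (Suc N) < e" using nat_approx_posE by blast
    show "\<forall>\<^sub>F n in sequentially. \<forall>x\<in>K. dist (poly (p n) x) (f x) < e"
      unfolding eventually_sequentially
    proof (intro exI allI impI ballI)
      fix n x assume n: "N \<le> n" and x: "x \<in> K"
      have "1 / real (Suc n) \<le> 1 / real (Suc N)" using n by (simp add: frac_le)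
      thus "dist (poly (p n) x) (f x) < e" using p[OF x, of n] N by (simp add: dist_real_def abs_minus_commute)
    qed
  qed
  thus ?thesis by blast
qed

text \<open>This justifies the definite description in \<open>fun_calc\<close>: an approximating
  sequence yields a Cauchy sequence of operators, and any two approximating sequences have the same
  limit. The quarters of \<open>e\<close> leave room because the norm estimate is not
  strict.\<close>

lemma fun_calc_lim:
  fixes A :: "'a::chilbert_space op"
  assumes A: "sa A" and f: "continuous_on (real_spectrum A) f"
    and p: "uniform_limit (real_spectrum A) (\<lambda>n. poly (p n)) f sequentially"
  shows "(\<lambda>n. poly_op (p n) A) \<longlonglongrightarrow> fun_calc f A"
proof -
  let ?S = "real_spectrum A"
  have diff: "\<forall>\<^sub>F n in sequentially. norm (poly_op (p n) A - poly_op (q n) A) < e"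
    if p: "uniform_limit ?S (\<lambda>n. poly (p n)) f sequentially"
      and q: "uniform_limit ?S (\<lambda>n. poly (q n)) f sequentially" and e: "e > 0" for p q :: "nat \<Rightarrow> real poly" and e
  proof -
    have "\<forall>\<^sub>F n in sequentially. \<forall>x\<in>?S. dist (poly (p n) x) (f x) < e / 4"
      "\<forall>\<^sub>F n in sequentially. \<forall>x\<in>?S. dist (poly (q n) x) (f x) < e / 4"
      using uniform_limitD[OF p, of "e / 4"] uniform_limitD[OF q, of "e / 4"] e by auto
    thus ?thesis
    proof eventually_elim
      case (elim n)
      have "norm (poly_op (p n - q n) A) \<le> e / 2"
      proof (rule norm_poly_op_le[OF A])
        fix t assume t: "t \<in> ?S"
        have "\<bar>poly (p n) t - f t\<bar> < e / 4" "\<bar>poly (q n) t - f t\<bar> < e / 4"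
          using elim t by (auto simp: dist_real_def)
        thus "\<bar>poly (p n - q n) t\<bar> \<le> e / 2" unfolding poly_diff by linarith
      qed (use e in simp)
      thus ?case using e by (simp add: poly_op_diff)
    qed
  qed
  have conv: "convergent (\<lambda>n. poly_op (p n) A)"
  proof (rule Cauchy_convergent, rule CauchyI)
    fix e :: real assume e: "e > 0"
    obtain N where N: "\<And>n x. n \<ge> N \<Longrightarrow> x \<in> ?S \<Longrightarrow> dist (poly (p n) x) (f x) < e / 4"
      using uniform_limitD[OF p, of "e / 4"] e unfolding eventually_sequentially by auto
    show "\<exists>M. \<forall>m\<ge>M. \<forall>n\<ge>M. norm (poly_op (p m) A - poly_op (p n) A) < e"
    proof (intro exI allI impI)
      fix m n assume mn: "N \<le> m" "N \<le> n"
      have "norm (poly_op (p m - p n) A) \<le> e / 2"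
      proof (rule norm_poly_op_le[OF A])
        fix t assume t: "t \<in> ?S"
        have "\<bar>poly (p m) t - f t\<bar> < e / 4" "\<bar>poly (p n) t - f t\<bar> < e / 4"
          using N[OF mn(1) t] N[OF mn(2) t] by (auto simp: dist_real_def)
        thus "\<bar>poly (p m - p n) t\<bar> \<le> e / 2" unfolding poly_diff by linarith
      qed (use e in simp)
      thus "norm (poly_op (p m) A - poly_op (p n) A) < e" using e by (simp add: poly_op_diff)
    qed
  qed
  then obtain L where L: "(\<lambda>n. poly_op (p n) A) \<longlonglongrightarrow> L" by (auto simp: convergent_def)
  have all: "(\<lambda>n. poly_op (q n) A) \<longlonglongrightarrow> L"
    if q: "uniform_limit ?S (\<lambda>n. poly (q n)) f sequentially" for q
  proof -
    have "(\<lambda>n. poly_op (q n) A - poly_op (p n) A) \<longlonglongrightarrow> 0"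
      by (rule tendstoI) (use diff[OF q p] in \<open>simp add: dist_norm\<close>)
    from tendsto_add[OF this L] show ?thesis by simp
  qed
  have "fun_calc f A = L" unfolding fun_calc_def
  proof (rule the_equality)
    fix T assume "\<forall>p. uniform_limit ?S (\<lambda>n. poly (p n)) f sequentially \<longrightarrow> (\<lambda>n. poly_op (p n) A) \<longlonglongrightarrow> T"
    thus "T = L" using p L LIMSEQ_unique by blast
  qed (use all in blast)
  thus ?thesis using L by simp
qed

section \<open>Continuous functional calculus\<close>

lemma tendsto_comp_op: "(X \<longlongrightarrow> A) F \<Longrightarrow> (Y \<longlongrightarrow> B) F \<Longrightarrow> ((\<lambda>n. X n \<odot> Y n) \<longlongrightarrow> A \<odot> B) F"
  for A B :: "'a::chilbert_space op"
  by (rule bounded_bilinear.tendsto[OF bounded_bilinear_blinfun_compose])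

lemma fun_calc_cong:
  assumes "\<And>t. t \<in> real_spectrum A \<Longrightarrow> f t = g t"
  shows "fun_calc f A = fun_calc g A"
proof -
  have "uniform_limit (real_spectrum A) (\<lambda>n. poly (p n)) f sequentially \<longleftrightarrow>
      uniform_limit (real_spectrum A) (\<lambda>n. poly (p n)) g sequentially" for p :: "nat \<Rightarrow> real poly"
    by (rule uniform_limit_cong') (use assms in auto)
  thus ?thesis unfolding fun_calc_def by simp
qed

lemma fun_calc_poly: "sa A \<Longrightarrow> fun_calc (poly p) A = poly_op p A"
proof -
  assume A: "sa A"
  have "(\<lambda>n::nat. poly_op p A) \<longlonglongrightarrow> fun_calc (poly p) A"
    by (rule fun_calc_lim[OF A]) (auto intro!: continuous_intros uniform_limit_const)
  thus ?thesis by (simp add: LIMSEQ_const_iff)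
qed

lemma poly_fun:
  fixes c :: real and p q :: "real poly"
  shows "poly [:c:] = (\<lambda>t. c)" "poly [:0, 1:] = (\<lambda>t::real. t)" "poly (smult c p) = (\<lambda>t. c * poly p t)"
  "poly (p + q) = (\<lambda>t. poly p t + poly q t)" "poly (p * q) = (\<lambda>t. poly p t * poly q t)"
  by (rule ext, simp)+

lemma fun_calc_const: "sa A \<Longrightarrow> fun_calc (\<lambda>t. c) A = c *\<^sub>R one_op"
  using fun_calc_poly[of A "[:c:]"] by (simp add: poly_op_const poly_fun)

lemma fun_calc_id: "sa A \<Longrightarrow> fun_calc (\<lambda>t. t) A = A"
  using fun_calc_poly[of A "[:0, 1:]"] by (simp add: poly_op_pCons comp_op_simps poly_fun)

context
  fixes A :: "'a::chilbert_space op" and f g :: "real \<Rightarrow> real"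
  assumes A: "sa A" and f: "continuous_on (real_spectrum A) f"
begin

lemma fun_calc_approx:
  obtains p where "uniform_limit (real_spectrum A) (\<lambda>n. poly (p n)) f sequentially"
    "(\<lambda>n. poly_op (p n) A) \<longlonglongrightarrow> fun_calc f A"
  using Weierstrass_poly_seq[OF compact_real_spectrum[OF A] f] fun_calc_lim[OF A f] by blast

lemma fun_calc_sa: "sa (fun_calc f A)"
proof -
  obtain p where "(\<lambda>n. poly_op (p n) A) \<longlonglongrightarrow> fun_calc f A" using fun_calc_approx by blast
  thus ?thesis using poly_op_sa[OF A] by (intro adj_lim[OF _ _ sequentially_bot]) (assumption | simp)+
qed

lemma fun_calc_scaleR: "fun_calc (\<lambda>t. c * f t) A = c *\<^sub>R fun_calc f A"
proof -
  obtain p where p: "uniform_limit (real_spectrum A) (\<lambda>n. poly (p n)) f sequentially"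
    "(\<lambda>n. poly_op (p n) A) \<longlonglongrightarrow> fun_calc f A" using fun_calc_approx by blast
  have "uniform_limit (real_spectrum A) (\<lambda>n. poly (smult c (p n))) (\<lambda>t. c * f t) sequentially"
    using bounded_linear.uniform_limit[OF bounded_linear_mult_right[of c] p(1)] by (simp add: poly_fun)
  from fun_calc_lim[OF A _ this]
  have "(\<lambda>n. c *\<^sub>R poly_op (p n) A) \<longlonglongrightarrow> fun_calc (\<lambda>t. c * f t) A"
    using f by (simp add: poly_op_smult continuous_intros)
  thus ?thesis using tendsto_scaleR[OF tendsto_const p(2)] LIMSEQ_unique by blast
qed

context
  assumes g: "continuous_on (real_spectrum A) g"
begin

lemma fun_calc_add: "fun_calc (\<lambda>t. f t + g t) A = fun_calc f A + fun_calc g A"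
proof -
  obtain p where p: "uniform_limit (real_spectrum A) (\<lambda>n. poly (p n)) f sequentially"
    using Weierstrass_poly_seq[OF compact_real_spectrum[OF A] f] by blast
  obtain q where q: "uniform_limit (real_spectrum A) (\<lambda>n. poly (q n)) g sequentially"
    using Weierstrass_poly_seq[OF compact_real_spectrum[OF A] g] by blast
  have "uniform_limit (real_spectrum A) (\<lambda>n. poly (p n + q n)) (\<lambda>t. f t + g t) sequentially"
    using uniform_limit_add[OF p q] by (simp add: poly_fun)
  from fun_calc_lim[OF A _ this]
  have "(\<lambda>n. poly_op (p n) A + poly_op (q n) A) \<longlonglongrightarrow> fun_calc (\<lambda>t. f t + g t) A"
    using f g by (simp add: poly_op_add continuous_intros)
  thus ?thesis
    using tendsto_add[OF fun_calc_lim[OF A f p] fun_calc_lim[OF A g q]] LIMSEQ_unique by blast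
qed

lemma fun_calc_mult: "fun_calc (\<lambda>t. f t * g t) A = fun_calc f A \<odot> fun_calc g A"
proof -
  obtain p where p: "uniform_limit (real_spectrum A) (\<lambda>n. poly (p n)) f sequentially"
    using Weierstrass_poly_seq[OF compact_real_spectrum[OF A] f] by blast
  obtain q where q: "uniform_limit (real_spectrum A) (\<lambda>n. poly (q n)) g sequentially"
    using Weierstrass_poly_seq[OF compact_real_spectrum[OF A] g] by blast
  have "uniform_limit (real_spectrum A) (\<lambda>n. poly (p n * q n)) (\<lambda>t. f t * g t) sequentially"
    using uniform_lim_mult[OF p q compact_imp_bounded[OF compact_continuous_image]
        compact_imp_bounded[OF compact_continuous_image]] f g compact_real_spectrum[OF A]
    by (simp add: poly_fun)
  from fun_calc_lim[OF A _ this]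
  have "(\<lambda>n. poly_op (p n) A \<odot> poly_op (q n) A) \<longlonglongrightarrow> fun_calc (\<lambda>t. f t * g t) A"
    using f g by (simp add: poly_op_mult continuous_intros)
  thus ?thesis
    using tendsto_comp_op[OF fun_calc_lim[OF A f p] fun_calc_lim[OF A g q]] LIMSEQ_unique by blast
qed

end

end

lemma fun_calc_diff:
  assumes "sa A" "continuous_on (real_spectrum A) f" "continuous_on (real_spectrum A) g"
  shows "fun_calc (\<lambda>t. f t - g t) A = fun_calc f A - fun_calc g A"
  using fun_calc_add[OF assms(1,2), of "\<lambda>t. (-1) * g t"] fun_calc_scaleR[OF assms(1,3), of "-1"] assms(3)
  by (simp add: continuous_intros)

text \<open>\<open>f(A)\<close> is the square of the self-adjoint operator obtained from the root of
  \<open>f\<close>.\<close>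

lemma fun_calc_pos:
  assumes A: "sa A" and f: "continuous_on (real_spectrum A) f" and pos: "\<And>t. t \<in> real_spectrum A \<Longrightarrow> 0 \<le> f t"
  shows "fun_calc f A \<in> pos_ops"
proof -
  define S where "S = fun_calc (\<lambda>t. sqrt (f t)) A"
  have c: "continuous_on (real_spectrum A) (\<lambda>t. sqrt (f t))" using f by (intro continuous_intros)
  have S: "sa S" unfolding S_def by (rule fun_calc_sa[OF A c])
  have "fun_calc f A = fun_calc (\<lambda>t. sqrt (f t) * sqrt (f t)) A"
    by (rule fun_calc_cong) (simp add: pos)
  also have "\<dots> = S \<odot> S" unfolding S_def by (rule fun_calc_mult[OF A c c])
  finally have "fun_calc f A = S \<odot> S" .
  thus ?thesis using adj_compose[OF S S] adj_inner[OF S] by (metis blinfun_apply_blinfun_compose inner_ge_zero pos_ops_iff)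
qed

lemma fun_calc_mono:
  assumes "sa A" "continuous_on (real_spectrum A) f" "continuous_on (real_spectrum A) g"
    and "\<And>t. t \<in> real_spectrum A \<Longrightarrow> f t \<le> g t"
  shows "fun_calc f A \<preceq> fun_calc g A"
  unfolding op_le_def fun_calc_diff[OF assms(1,3,2), symmetric]
  by (rule fun_calc_pos) (use assms in \<open>auto intro!: continuous_intros\<close>)

lemma fun_calc_form_ge:
  assumes "sa A" "continuous_on (real_spectrum A) f" "\<And>t. t \<in> real_spectrum A \<Longrightarrow> c \<le> f t"
  shows "c * (norm x)\<^sup>2 \<le> inner x (fun_calc f A x)"
  using op_leD[OF fun_calc_mono[OF assms(1) continuous_on_const assms(2,3)], of x]
  by (simp add: fun_calc_const assms(1) blinfun.bilinear_simps power2_norm_eq_inner)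

lemma fun_calc_form_le:
  assumes "sa A" "continuous_on (real_spectrum A) f" "\<And>t. t \<in> real_spectrum A \<Longrightarrow> f t \<le> c"
  shows "inner x (fun_calc f A x) \<le> c * (norm x)\<^sup>2"
  using op_leD[OF fun_calc_mono[OF assms(1,2) continuous_on_const assms(3)], of x]
  by (simp add: fun_calc_const assms(1) blinfun.bilinear_simps power2_norm_eq_inner)

lemma norm_fun_calc_le:
  assumes A: "sa A" and f: "continuous_on (real_spectrum A) f" and c: "0 \<le> c"
    and b: "\<And>t. t \<in> real_spectrum A \<Longrightarrow> \<bar>f t\<bar> \<le> c"
  shows "norm (fun_calc f A) \<le> c"
proof (rule norm_le_form[OF fun_calc_sa[OF A f] _ c])
  fix x
  have "inner x (fun_calc f A x) \<le> c * (norm x)\<^sup>2" using b by (intro fun_calc_form_le A f) force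
  moreover have "(- c) * (norm x)\<^sup>2 \<le> inner x (fun_calc f A x)" using b by (intro fun_calc_form_ge A f) force
  ultimately show "\<bar>inner x (fun_calc f A x)\<bar> \<le> c * (norm x)\<^sup>2" by simp
qed

lemma fun_calc_spectrum:
  assumes "sa A" "continuous_on (real_spectrum A) f" "\<And>t. t \<in> real_spectrum A \<Longrightarrow> f t \<in> {a..b}"
  shows "real_spectrum (fun_calc f A) \<subseteq> {a..b}"
  using assms by (intro real_spectrum_subset_form fun_calc_sa fun_calc_form_ge fun_calc_form_le) auto

text \<open>\<open>A\<close> and \<open>B\<close> may have different spectra, so one sequence of
  polynomials must approximate \<open>f\<close> on the union of both. The relation passes from
  polynomials to the limit. With an isometry for \<open>C\<close> it computes functions of block
  operators.\<close>

lemma fun_calc_intertwine: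
  fixes A B C :: "'a::chilbert_space op"
  assumes A: "sa A" and B: "sa B" and AB: "A \<odot> C = C \<odot> B"
    and f: "continuous_on (real_spectrum A) f" "continuous_on (real_spectrum B) f"
  shows "fun_calc f A \<odot> C = C \<odot> fun_calc f B"
proof -
  let ?S = "real_spectrum A \<union> real_spectrum B"
  have "continuous_on ?S f" using f A B by (intro continuous_on_closed_Un closed_real_spectrum)
  then obtain p where p: "uniform_limit ?S (\<lambda>n. poly (p n)) f sequentially"
    using Weierstrass_poly_seq compact_real_spectrum A B by (metis compact_Un)
  have "(\<lambda>n. poly_op (p n) A) \<longlonglongrightarrow> fun_calc f A" "(\<lambda>n. poly_op (p n) B) \<longlonglongrightarrow> fun_calc f B"
    using p by (auto intro!: fun_calc_lim A B f elim: uniform_limit_on_subset)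
  hence "(\<lambda>n. poly_op (p n) A \<odot> C) \<longlonglongrightarrow> fun_calc f A \<odot> C" "(\<lambda>n. C \<odot> poly_op (p n) B) \<longlonglongrightarrow> C \<odot> fun_calc f B"
    by (auto intro!: tendsto_comp_op)
  thus ?thesis unfolding poly_op_intertwine[OF AB] using LIMSEQ_unique by blast
qed

text \<open>A single polynomial close to \<open>f\<close> on \<open>K\<close> serves all the spectra
  at once, and polynomials of operators are norm continuous.\<close>

lemma fun_calc_tendsto:
  fixes A :: "'a::chilbert_space op"
  assumes X: "(X \<longlongrightarrow> A) F" and A: "sa A" and K: "compact K" "continuous_on K f" "real_spectrum A \<subseteq> K"
    and ev: "eventually (\<lambda>n. sa (X n) \<and> real_spectrum (X n) \<subseteq> K) F"
  shows "((\<lambda>n. fun_calc f (X n)) \<longlongrightarrow> fun_calc f A) F"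
proof (rule tendstoI)
  fix e :: real assume e: "e > 0"
  obtain p where p: "\<And>t. t \<in> K \<Longrightarrow> \<bar>f t - poly p t\<bar> < e / 3"
    using Weierstrass_poly[OF K(1,2), of "e / 3"] e by auto
  have est: "norm (fun_calc f Y - poly_op p Y) \<le> e / 3" if Y: "sa Y" "real_spectrum Y \<subseteq> K" for Y :: "'a op"
  proof -
    have c: "continuous_on (real_spectrum Y) f" using K(2) Y(2) by (rule continuous_on_subset)
    have "fun_calc f Y - poly_op p Y = fun_calc (\<lambda>t. f t - poly p t) Y"
      using fun_calc_diff[OF Y(1) c, of "poly p"] by (simp add: fun_calc_poly Y continuous_intros)
    also have "norm \<dots> \<le> e / 3"
      by (rule norm_fun_calc_le[OF Y(1)]) (use c e p Y in \<open>auto intro!: continuous_intros less_imp_le[OF p] simp del: less_divide_eq_numeral1 le_divide_eq_numeral1\<close>)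
    finally show ?thesis .
  qed
  have "\<forall>\<^sub>F n in F. dist (poly_op p (X n)) (poly_op p A) < e / 3"
    using tendstoD[OF poly_op_tendsto[OF X, of p], of "e / 3"] e by simp
  with ev show "\<forall>\<^sub>F n in F. dist (fun_calc f (X n)) (fun_calc f A) < e"
  proof eventually_elim
    case (elim n)
    have "norm (fun_calc f (X n) - poly_op p (X n)) \<le> e / 3" "norm (fun_calc f A - poly_op p A) \<le> e / 3"
      using elim est A K(3) by auto
    moreover have "fun_calc f (X n) - fun_calc f A = (fun_calc f (X n) - poly_op p (X n))
       - (fun_calc f A - poly_op p A) + (poly_op p (X n) - poly_op p A)" by simp
    hence "norm (fun_calc f (X n) - fun_calc f A) \<le> norm (fun_calc f (X n) - poly_op p (X n))
       + norm (fun_calc f A - poly_op p A) + norm (poly_op p (X n) - poly_op p A)"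
      by (metis (no_types) norm_triangle_ineq norm_triangle_ineq4 add_right_mono order_trans)
    ultimately show ?case using elim by (simp add: dist_norm)
  qed
qed

text \<open>Multiplicativity settles polynomial \<open>f\<close>. For the limit, the interval
  contains both the values of \<open>g\<close> on the spectrum and the spectrum of
  \<open>g(A)\<close>, so one approximation of \<open>f\<close> works on both sides.\<close>

lemma fun_calc_comp:
  fixes A :: "'a::chilbert_space op"
  assumes A: "sa A" and g: "continuous_on (real_spectrum A) g" and K: "continuous_on {a..b} f"
    and gab: "\<And>t. t \<in> real_spectrum A \<Longrightarrow> g t \<in> {a..b}"
  shows "fun_calc f (fun_calc g A) = fun_calc (\<lambda>t. f (g t)) A"
proof -
  let ?B = "fun_calc g A"
  have B: "sa ?B" by (rule fun_calc_sa[OF A g])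
  have sB: "real_spectrum ?B \<subseteq> {a..b}" by (rule fun_calc_spectrum[OF A g gab])
  obtain p where p: "uniform_limit {a..b} (\<lambda>n. poly (p n)) f sequentially"
    using Weierstrass_poly_seq[OF _ K] by auto
  have poly_comp: "poly_op q ?B = fun_calc (\<lambda>t. poly q (g t)) A" for q
  proof (induction q)
    case 0 thus ?case using fun_calc_const[OF A, of 0] by simp
  next
    case (pCons c q)
    have c: "continuous_on (real_spectrum A) (\<lambda>t. g t * poly q (g t))" using g by (intro continuous_intros)
    have "fun_calc (\<lambda>t. g t * poly q (g t)) A = ?B \<odot> fun_calc (\<lambda>t. poly q (g t)) A"
      using g by (intro fun_calc_mult A) (auto intro!: continuous_intros)
    thus ?case using fun_calc_add[OF A continuous_on_const c, of c]
      by (simp add: poly_op_pCons fun_calc_const A pCons)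
  qed
  have 1: "(\<lambda>n. poly_op (p n) ?B) \<longlonglongrightarrow> fun_calc f ?B"
    using p sB K by (intro fun_calc_lim B) (auto elim: uniform_limit_on_subset continuous_on_subset)
  have cfg: "continuous_on (real_spectrum A) (\<lambda>t. f (g t))"
    using gab by (intro continuous_on_compose2[OF K g]) auto
  have "(\<lambda>n. fun_calc (\<lambda>t. poly (p n) (g t)) A) \<longlonglongrightarrow> fun_calc (\<lambda>t. f (g t)) A"
  proof (rule tendstoI)
    fix e :: real assume e: "e > 0"
    have "\<forall>\<^sub>F n in sequentially. \<forall>x\<in>{a..b}. dist (poly (p n) x) (f x) < e / 2"
      using uniform_limitD[OF p, of "e / 2"] e by auto
    thus "\<forall>\<^sub>F n in sequentially. dist (fun_calc (\<lambda>t. poly (p n) (g t)) A) (fun_calc (\<lambda>t. f (g t)) A) < e"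
    proof eventually_elim
      case (elim n)
      have c: "continuous_on (real_spectrum A) (\<lambda>t. poly (p n) (g t))" using g by (intro continuous_intros)
      have "norm (fun_calc (\<lambda>t. poly (p n) (g t) - f (g t)) A) \<le> e / 2"
      proof (rule norm_fun_calc_le[OF A])
        fix t assume "t \<in> real_spectrum A"
        thus "\<bar>poly (p n) (g t) - f (g t)\<bar> \<le> e / 2" using elim gab[of t] by (auto simp: dist_real_def intro: less_imp_le)
      qed (use e c cfg in \<open>auto intro!: continuous_intros\<close>)
      thus ?case using e by (simp add: dist_norm fun_calc_diff[OF A c cfg])
    qed
  qed
  thus ?thesis using 1 unfolding poly_comp using LIMSEQ_unique by blast
qed

lemma real_spectrum_scalar: "real_spectrum (a *\<^sub>R one_op) \<subseteq> {a}"
proof -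
  have "real_spectrum (a *\<^sub>R one_op) \<subseteq> {a..a}"
    by (rule real_spectrum_subset_form) (auto intro!: adj_scaleR simp: blinfun.bilinear_simps power2_norm_eq_inner)
  thus ?thesis by simp
qed

lemma fun_calc_scalar: "fun_calc f (a *\<^sub>R one_op) = f a *\<^sub>R one_op"
proof -
  have "fun_calc f (a *\<^sub>R one_op) = fun_calc (\<lambda>t. f a) (a *\<^sub>R one_op)"
    by (rule fun_calc_cong) (use real_spectrum_scalar[of a] in auto)
  thus ?thesis by (simp add: fun_calc_const adj_scaleR)
qed

section \<open>Functional calculus of positive operators, inverses and square roots\<close>

lemma pos_ops_spectrum: "A \<in> pos_ops \<Longrightarrow> real_spectrum A \<subseteq> {0..norm A}"
  using inner_op_le_norm[of _ A] by (intro real_spectrum_subset_form) (auto simp: pos_ops_iff abs_le_iff)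

lemma pos_inv_spectrum:
  assumes "A \<in> pos_inv_ops"
  obtains a b where "0 < a" "a \<le> b" "real_spectrum A \<subseteq> {a..b}"
proof -
  obtain c where c: "c > 0" "\<And>x. c * (norm x)\<^sup>2 \<le> inner x (A x)" using assms by (rule pos_inv_opsE) blast
  have "real_spectrum A \<subseteq> {c..norm A}"
    using c inner_op_le_norm[of _ A] assms by (intro real_spectrum_subset_form pos_inv_opsD) (auto simp: abs_le_iff)
  hence "real_spectrum A \<subseteq> {c..max c (norm A)}" by auto
  thus ?thesis using that[of c "max c (norm A)"] c by simp
qed

lemma pos_inv_spectrum_pos: "A \<in> pos_inv_ops \<Longrightarrow> real_spectrum A \<subseteq> {0<..}"
  by (erule pos_inv_spectrum) auto

lemma pos_inv_continuous:
  "A \<in> pos_inv_ops \<Longrightarrow> continuous_on {0<..} f \<Longrightarrow> continuous_on (real_spectrum A) f"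
  using pos_inv_spectrum_pos continuous_on_subset by blast

lemma pos_continuous: "A \<in> pos_ops \<Longrightarrow> continuous_on {0..} f \<Longrightarrow> continuous_on (real_spectrum A) f"
  using pos_ops_spectrum by (metis atLeastAtMost_subseteq_atLeastLessThan_iff continuous_on_subset atLeastatMost_subset_iff Icc_subset_Ici_iff order_refl order_trans)

text \<open>Compactness of the spectrum turns pointwise positivity into a uniform lower bound, which
  is the coercivity constant.\<close>

lemma fun_calc_pos_inv:
  assumes A: "sa A" and f: "continuous_on (real_spectrum A) f" and pos: "\<And>t. t \<in> real_spectrum A \<Longrightarrow> 0 < f t"
  shows "fun_calc f A \<in> pos_inv_ops"
proof -
  have "\<exists>m>0. \<forall>t\<in>real_spectrum A. m \<le> f t"
  proof (cases "real_spectrum A = {}")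
    case False
    then obtain t where "t \<in> real_spectrum A" "\<forall>s\<in>real_spectrum A. f t \<le> f s"
      using continuous_attains_inf[OF compact_real_spectrum[OF A] _ f] by blast
    thus ?thesis using pos by blast
  qed (auto intro: exI[of _ 1])
  then obtain m where m: "m > 0" "\<And>t. t \<in> real_spectrum A \<Longrightarrow> m \<le> f t" by blast
  show ?thesis by (rule pos_inv_opsI[OF fun_calc_sa[OF A f] m(1)]) (rule fun_calc_form_ge[OF A f m(2)])
qed

lemma op_inv_fun_calc:
  assumes A: "sa A" and f: "continuous_on (real_spectrum A) f" and nz: "\<And>t. t \<in> real_spectrum A \<Longrightarrow> f t \<noteq> 0"
  shows "op_inv (fun_calc f A) = fun_calc (\<lambda>t. 1 / f t) A"
proof -
  have g: "continuous_on (real_spectrum A) (\<lambda>t. 1 / f t)" using f nz by (intro continuous_intros) auto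
  have 1: "fun_calc (\<lambda>t. f t * (1 / f t)) A = one_op"
    using fun_calc_const[OF A, of 1] by (subst fun_calc_cong[where g = "\<lambda>t. 1"]) (use nz in auto)
  have 2: "fun_calc (\<lambda>t. 1 / f t * f t) A = one_op"
    using fun_calc_const[OF A, of 1] by (subst fun_calc_cong[where g = "\<lambda>t. 1"]) (use nz in auto)
  show ?thesis
    using 1 2 unfolding fun_calc_mult[OF A f g] fun_calc_mult[OF A g f]
    by (intro op_inv_eqI adj_bounded(1)[OF fun_calc_sa[OF A g]])
qed

lemma op_inv_eq_fun_calc: "A \<in> pos_inv_ops \<Longrightarrow> op_inv A = fun_calc (\<lambda>t. 1 / t) A"
  using op_inv_fun_calc[of A "\<lambda>t. t"] pos_inv_spectrum_pos[of A]
  by (force simp: fun_calc_id pos_inv_opsD)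

lemma sqrt_op_pos: "A \<in> pos_ops \<Longrightarrow> fun_calc sqrt A \<in> pos_ops"
  using pos_ops_spectrum[of A] by (intro fun_calc_pos) (auto simp: pos_ops_sa intro!: continuous_intros)

lemma sqrt_op_pos_inv: "A \<in> pos_inv_ops \<Longrightarrow> fun_calc sqrt A \<in> pos_inv_ops"
  using pos_inv_spectrum_pos[of A] by (intro fun_calc_pos_inv) (auto simp: pos_inv_opsD intro!: continuous_intros)

lemma sqrt_op_square: assumes "A \<in> pos_ops" shows "fun_calc sqrt A \<odot> fun_calc sqrt A = A"
proof -
  have A: "sa A" using assms by (rule pos_ops_sa)
  have "fun_calc (\<lambda>t. sqrt t * sqrt t) A = fun_calc (\<lambda>t. t) A"
    using pos_ops_spectrum[OF assms] by (intro fun_calc_cong) auto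
  thus ?thesis using fun_calc_mult[OF A, of sqrt sqrt] by (simp add: fun_calc_id A continuous_intros)
qed

lemma sqrt_op_unique:
  assumes "X \<in> pos_ops"
  shows "fun_calc sqrt (X \<odot> X) = X"
proof -
  have X: "sa X" using assms by (rule pos_ops_sa)
  have "X \<odot> X = fun_calc (\<lambda>t. t * t) X" using fun_calc_mult[OF X, of "\<lambda>t. t" "\<lambda>t. t"] by (simp add: fun_calc_id X)
  moreover have "fun_calc sqrt (fun_calc (\<lambda>t. t * t) X) = fun_calc (\<lambda>t. sqrt (t * t)) X"
    by (rule fun_calc_comp[where a = 0 and b = "norm X * norm X"])
      (use pos_ops_spectrum[OF assms] X in \<open>auto intro!: continuous_intros mult_mono\<close>)
  moreover have "\<dots> = fun_calc (\<lambda>t. t) X" using pos_ops_spectrum[OF assms] by (intro fun_calc_cong) auto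
  ultimately show ?thesis by (simp add: fun_calc_id X)
qed

section \<open>Splitting a separable infinite-dimensional space as a direct sum of two copies of itself\<close>

lemma cinner_zero_right [simp]: "cinner x 0 = 0" for x :: "'a::complex_inner"
  using cinner_add_right[of x 0 0] by simp

lemma cinner_sum_right: "cinner x (\<Sum>i\<in>S. f i) = (\<Sum>i\<in>S. cinner x (f i))"
  by (induction S rule: infinite_finite_induct) (simp_all add: cinner_add_right)

lemma cinner_self: "cinner x x = complex_of_real ((norm x)\<^sup>2)"
proof -
  have "Im (cinner x x) = 0" using arg_cong[OF cinner_commute[of x x], of Im] by simp
  thus ?thesis by (simp add: complex_eq_iff Re_cinner power2_norm_eq_inner)
qed

lemma cinner_minus_right: "cinner x (- y) = - cinner x (y::'a::complex_inner)"
  using cinner_add_right[of x y "- y"] by (simp add: add_eq_0_iff)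

lemma cinner_diff_right: "cinner x (y - z) = cinner x y - cinner x (z::'a::complex_inner)"
  using cinner_add_right[of x y "- z"] by (simp add: cinner_minus_right)

lemma bounded_linear_cinner: "bounded_linear (\<lambda>y::'a::complex_inner. cinner x y)"
proof -
  have "cinner x y = complex_of_real (inner x y) - \<i> * complex_of_real (inner x (\<i> *\<^sub>C y))" for y
    by (simp add: complex_eq_iff Re_cinner Im_cinner)
  moreover have "bounded_linear (\<lambda>y. complex_of_real (inner x y) - \<i> * complex_of_real (inner x (\<i> *\<^sub>C y)))"
    by (intro bounded_linear_sub bounded_linear_const_mult
        bounded_linear_compose[OF bounded_linear_of_real]
        bounded_linear_compose[OF bounded_linear_inner_right] bounded_linear_inner_right
        bounded_linear_scaleC)
  ultimately show ?thesis by presburger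
qed

section \<open>Orthonormal sequences and the partial isometries between them\<close>

definition orthonormal :: "(nat \<Rightarrow> 'a::complex_inner) \<Rightarrow> bool" where
  "orthonormal e \<longleftrightarrow> (\<forall>m n. cinner (e m) (e n) = (if m = n then 1 else 0))"

lemma orthonormal_norm_sum:
  assumes e: "orthonormal e" and F: "finite F"
  shows "(norm (\<Sum>k\<in>F. c k *\<^sub>C e k))\<^sup>2 = (\<Sum>k\<in>F. (cmod (c k))\<^sup>2)"
proof -
  define x where "x = (\<Sum>k\<in>F. c k *\<^sub>C e k)"
  have 1: "cinner (e j) x = c j" if "j \<in> F" for j
  proof -
    have "cinner (e j) x = (\<Sum>k\<in>F. if j = k then c k else 0)"
      unfolding x_def cinner_sum_right cinner_scaleC_right
      using e by (intro sum.cong) (auto simp: orthonormal_def)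
    thus ?thesis using that F by simp
  qed
  have "cinner x x = (\<Sum>k\<in>F. c k * cinner x (e k))"
    unfolding x_def cinner_sum_right cinner_scaleC_right ..
  also have "\<dots> = (\<Sum>k\<in>F. c k * cnj (c k))"
    using 1 by (intro sum.cong refl) (metis cinner_commute)
  also have "\<dots> = complex_of_real (\<Sum>k\<in>F. (cmod (c k))\<^sup>2)"
    unfolding of_real_sum by (intro sum.cong refl) (simp add: complex_norm_square flip: of_real_power)
  finally show ?thesis unfolding cinner_self x_def of_real_eq_iff .
qed

lemma Bessel:
  assumes e: "orthonormal e" and F: "finite F"
  shows "(\<Sum>k\<in>F. (cmod (cinner (e k) x))\<^sup>2) \<le> (norm x)\<^sup>2"
proof -
  define P where "P = (\<Sum>k\<in>F. cinner (e k) x *\<^sub>C e k)"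
  have P: "(norm P)\<^sup>2 = (\<Sum>k\<in>F. (cmod (cinner (e k) x))\<^sup>2)"
    unfolding P_def by (rule orthonormal_norm_sum[OF e F])
  have "cinner x P = (\<Sum>k\<in>F. cinner (e k) x * cnj (cinner (e k) x))"
    unfolding P_def cinner_sum_right cinner_scaleC_right by (intro sum.cong refl) (metis cinner_commute)
  also have "\<dots> = complex_of_real (\<Sum>k\<in>F. (cmod (cinner (e k) x))\<^sup>2)"
    unfolding of_real_sum by (intro sum.cong refl) (simp add: complex_norm_square flip: of_real_power)
  finally have "inner x P = (norm P)\<^sup>2" unfolding P by (metis Re_cinner Re_complex_of_real)
  moreover have "0 \<le> (norm (x - P))\<^sup>2" by simp
  ultimately show ?thesis
    unfolding P[symmetric] by (simp add: power2_norm_eq_inner inner_diff inner_commute)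
qed

text \<open>Bessel's inequality for \<open>a\<close> makes the squared coefficients summable, and
  orthonormality of \<open>b\<close> turns their tails into the squared norms of the tails of the
  series.\<close>

lemma summable_orthonormal:
  fixes a b :: "nat \<Rightarrow> 'a::chilbert_space"
  assumes a: "orthonormal a" and b: "orthonormal b"
  shows "summable (\<lambda>k. cinner (a k) x *\<^sub>C b k)"
proof -
  have sq: "summable (\<lambda>k. (cmod (cinner (a k) x))\<^sup>2)"
    by (rule summableI_nonneg_bounded[where x = "(norm x)\<^sup>2"]) (auto intro: Bessel[OF a])
  show ?thesis
    unfolding summable_Cauchy
  proof (intro allI impI)
    fix \<epsilon> :: real assume e: "\<epsilon> > 0"
    hence "\<epsilon>\<^sup>2 > 0" by simp
    then obtain N where N: "\<And>m n. m \<ge> N \<Longrightarrow> norm (\<Sum>k\<in>{m..<n}. (cmod (cinner (a k) x))\<^sup>2) < \<epsilon>\<^sup>2"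
      using sq unfolding summable_Cauchy by blast
    show "\<exists>N. \<forall>m\<ge>N. \<forall>n. norm (\<Sum>k = m..<n. cinner (a k) x *\<^sub>C b k) < \<epsilon>"
    proof (intro exI allI impI)
      fix m n assume "N \<le> m"
      have "(norm (\<Sum>k = m..<n. cinner (a k) x *\<^sub>C b k))\<^sup>2 < \<epsilon>\<^sup>2"
        using N[OF \<open>N \<le> m\<close>, of n] by (simp add: orthonormal_norm_sum[OF b] sum_nonneg)
      thus "norm (\<Sum>k = m..<n. cinner (a k) x *\<^sub>C b k) < \<epsilon>"
        using e by (simp add: power_less_imp_less_base)
    qed
  qed
qed

text \<open>The partial isometry sending \<open>a k\<close> to \<open>b k\<close> and vanishing on the complement of all \<open>a k\<close>.\<close>

definition transfer_op :: "(nat \<Rightarrow> 'a::chilbert_space) \<Rightarrow> (nat \<Rightarrow> 'a) \<Rightarrow> 'a op" where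
  "transfer_op a b = Blinfun (\<lambda>x. \<Sum>k. cinner (a k) x *\<^sub>C b k)"

context
  fixes a b :: "nat \<Rightarrow> 'a::chilbert_space"
  assumes a: "orthonormal a" and b: "orthonormal b"
begin

lemma transfer_op_apply: "transfer_op a b x = (\<Sum>k. cinner (a k) x *\<^sub>C b k)"
proof -
  note s = summable_orthonormal[OF a b]
  have "bounded_linear (\<lambda>x. \<Sum>k. cinner (a k) x *\<^sub>C b k)"
  proof (rule bounded_linear_intro[where K = 1])
    show "(\<Sum>k. cinner (a k) (x + y) *\<^sub>C b k) = (\<Sum>k. cinner (a k) x *\<^sub>C b k) + (\<Sum>k. cinner (a k) y *\<^sub>C b k)" for x y
      unfolding suminf_add[OF s s] by (simp add: cinner_add_right scaleC_add_left)
    show "(\<Sum>k. cinner (a k) (r *\<^sub>R x) *\<^sub>C b k) = r *\<^sub>R (\<Sum>k. cinner (a k) x *\<^sub>C b k)" for r x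
    proof -
      have "cinner (a k) (r *\<^sub>R x) *\<^sub>C b k = r *\<^sub>R (cinner (a k) x *\<^sub>C b k)" for k
        by (simp add: scaleR_scaleC cinner_scaleC_right scaleC_scaleC)
      thus ?thesis using suminf_scaleR_right[OF s, of r x] by simp
    qed
    show "norm (\<Sum>k. cinner (a k) x *\<^sub>C b k) \<le> norm x * 1" for x
    proof (rule Lim_norm_ubound[OF sequentially_bot summable_LIMSEQ[OF s]], rule always_eventually, rule allI)
      fix n
      have "(norm (\<Sum>k<n. cinner (a k) x *\<^sub>C b k))\<^sup>2 \<le> (norm x)\<^sup>2"
        unfolding orthonormal_norm_sum[OF b finite_lessThan] by (rule Bessel[OF a]) simp
      thus "norm (\<Sum>k<n. cinner (a k) x *\<^sub>C b k) \<le> norm x * 1"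
        using power2_le_imp_le[OF _ norm_ge_zero] by simp
    qed
  qed
  thus ?thesis by (simp add: transfer_op_def bounded_linear_Blinfun_apply)
qed

lemma transfer_op_sums: "(\<lambda>k. cinner (a k) x *\<^sub>C b k) sums transfer_op a b x"
  unfolding transfer_op_apply by (rule summable_sums[OF summable_orthonormal[OF a b]])

lemma transfer_op_bounded: "transfer_op a b \<in> bounded_ops"
proof -
  have "transfer_op a b (c *\<^sub>C x) = c *\<^sub>C transfer_op a b x" for c x
    using bounded_linear.sums[OF bounded_linear_scaleC[of c] transfer_op_sums[of x]]
      transfer_op_sums[of "c *\<^sub>C x"]
    by (simp add: cinner_scaleC_right scaleC_scaleC sums_unique2)
  thus ?thesis by (simp add: bounded_ops_def)
qed

lemma transfer_op_basis: "transfer_op a b (a k) = b k"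
proof -
  have "(\<lambda>j. cinner (a j) (a k) *\<^sub>C b j) = (\<lambda>j. if j = k then b j else 0)"
    using a by (auto simp: orthonormal_def fun_eq_iff scaleC_one)
  thus ?thesis using transfer_op_sums[of "a k"] sums_single[of k b] sums_unique2 by metis
qed

lemma transfer_op_orthogonal: "(\<And>k. cinner (a k) x = 0) \<Longrightarrow> transfer_op a b x = 0"
  by (simp add: transfer_op_apply)

end

lemma transfer_op_adj:
  assumes a: "orthonormal a" and b: "orthonormal b"
  shows "adj (transfer_op a b) (transfer_op b a)"
  unfolding adj_def
proof (intro conjI allI transfer_op_bounded a b)
  fix x y
  have "inner (cinner (a k) x *\<^sub>C b k) y = inner x (cinner (b k) y *\<^sub>C a k)" for k
  proof -
    have "cnj (cinner (a k) x) = cinner x (a k)" by (metis cinner_commute)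
    thus ?thesis by (simp add: inner_eq_Re_cinner cinner_scaleC_left cinner_scaleC_right mult.commute)
  qed
  thus "inner (transfer_op a b x) y = inner x (transfer_op b a y)"
    using bounded_linear.sums[OF bounded_linear_inner_left transfer_op_sums[OF a b, of x], of y]
      bounded_linear.sums[OF bounded_linear_inner_right transfer_op_sums[OF b a, of y], of x]
    by (simp add: sums_unique2)
qed

lemma transfer_op_compose:
  assumes a: "orthonormal a" and b: "orthonormal b" and c: "orthonormal c"
  shows "transfer_op b c \<odot> transfer_op a b = transfer_op a c"
proof (rule blinfun_eqI)
  fix x
  have "(\<lambda>k. transfer_op b c (cinner (a k) x *\<^sub>C b k)) sums transfer_op b c (transfer_op a b x)"
    by (rule bounded_linear.sums[OF blinfun.bounded_linear_right transfer_op_sums[OF a b]])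
  moreover have "(\<lambda>k. transfer_op b c (cinner (a k) x *\<^sub>C b k)) = (\<lambda>k. cinner (a k) x *\<^sub>C c k)"
    by (simp add: bounded_opsD[OF transfer_op_bounded[OF b c]] transfer_op_basis[OF b c])
  ultimately show "(transfer_op b c \<odot> transfer_op a b) x = transfer_op a c x"
    using transfer_op_sums[OF a c, of x] sums_unique2 by (metis blinfun_apply_blinfun_compose)
qed

lemma transfer_op_compose_zero:
  assumes a: "orthonormal a" and b: "orthonormal b" and b': "orthonormal b'" and c: "orthonormal c"
    and o: "\<And>j k. cinner (b' j) (b k) = 0"
  shows "transfer_op b' c \<odot> transfer_op a b = 0"
proof (rule blinfun_eqI)
  fix x
  have "(\<lambda>k. transfer_op b' c (cinner (a k) x *\<^sub>C b k)) sums transfer_op b' c (transfer_op a b x)"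
    by (rule bounded_linear.sums[OF blinfun.bounded_linear_right transfer_op_sums[OF a b]])
  moreover have "(\<lambda>k. transfer_op b' c (cinner (a k) x *\<^sub>C b k)) = (\<lambda>k. 0)"
    by (simp add: transfer_op_orthogonal[OF b' c] cinner_scaleC_right o)
  ultimately show "(transfer_op b' c \<odot> transfer_op a b) x = blinfun_apply 0 x"
    by (metis blinfun_apply_blinfun_compose sums_unique2 sums_zero zero_blinfun.rep_eq)
qed

lemma complex_subspace_fixed:
  assumes "T \<in> bounded_ops"
  shows "complex_vector.subspace {x. T x = x}"
  by (rule complex_vector.subspaceI) (simp_all add: blinfun.bilinear_simps bounded_opsD[OF assms])

lemma closed_fixed: "closed {x::'a::chilbert_space. blinfun_apply T x = x}"
  by (intro closed_Collect_eq continuous_intros)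

text \<open>The fixed vectors of a bounded complex-linear operator form a closed subspace, so it is
  enough to know that all \<open>e k\<close> are fixed.\<close>

lemma total_op_eq_one:
  fixes e :: "nat \<Rightarrow> 'a::chilbert_space"
  assumes T: "T \<in> bounded_ops" and t: "closure (complex_vector.span (range e)) = UNIV"
    and e: "\<And>k. blinfun_apply T (e k) = e k"
  shows "T = one_op"
proof (rule blinfun_eqI)
  fix x
  have "complex_vector.span (range e) \<subseteq> {x. T x = x}"
    using complex_subspace_fixed[OF T] by (intro complex_vector.span_minimal) (auto simp: e)
  hence "closure (complex_vector.span (range e)) \<subseteq> {x. T x = x}"
    using closed_fixed by (rule closure_minimal)
  thus "T x = one_op x" using t by auto
qed

lemma transfer_op_total:
  fixes e :: "nat \<Rightarrow> 'a::chilbert_space"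
  assumes e: "orthonormal e" and t: "closure (complex_vector.span (range e)) = UNIV"
  shows "transfer_op e e = one_op"
  by (rule total_op_eq_one[OF transfer_op_bounded[OF e e] t]) (rule transfer_op_basis[OF e e])

section \<open>Gram-Schmidt and a countable orthonormal basis\<close>

definition orthonormal_set :: "'a::complex_inner set \<Rightarrow> bool" where
  "orthonormal_set E \<longleftrightarrow> (\<forall>x\<in>E. \<forall>y\<in>E. cinner x y = (if x = y then 1 else 0))"

lemma cinner_proj:
  assumes E: "finite E" "orthonormal_set E" and y: "y \<in> E"
  shows "cinner y (\<Sum>e\<in>E. cinner e d *\<^sub>C e) = cinner y d"
proof -
  have "cinner y (\<Sum>e\<in>E. cinner e d *\<^sub>C e) = (\<Sum>e\<in>E. if y = e then cinner e d else 0)"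
    unfolding cinner_sum_right cinner_scaleC_right
    using E y by (intro sum.cong) (auto simp: orthonormal_set_def)
  thus ?thesis using E y by simp
qed

text \<open>When \<open>d\<close> already equals its projection, \<open>E\<close> itself is
  returned. A dense sequence can thus be processed in turn with its linearly dependent members left
  in.\<close>

lemma Gram_Schmidt_step:
  fixes E :: "'a::complex_inner set"
  assumes E: "finite E" "orthonormal_set E"
  shows "\<exists>E'. finite E' \<and> orthonormal_set E' \<and> E \<subseteq> E' \<and> d \<in> complex_vector.span E'"
proof -
  define p where "p = (\<Sum>e\<in>E. cinner e d *\<^sub>C e)"
  have p: "p \<in> complex_vector.span E" unfolding p_def
    by (intro complex_vector.span_sum complex_vector.span_scale complex_vector.span_base)
  show ?thesis
  proof (cases "d = p")
    case True thus ?thesis using E p by blast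
  next
    case False
    define r where "r = d - p"
    define u where "u = (1 / norm r) *\<^sub>R r"
    have n: "norm u = 1" using False by (simp add: u_def r_def)
    have o: "cinner y u = 0" if "y \<in> E" for y
      using cinner_proj[OF E that, of d]
      by (simp add: u_def r_def p_def scaleR_scaleC cinner_scaleC_right cinner_diff_right)
    have o': "cinner u y = 0" if "y \<in> E" for y using o[OF that] by (metis cinner_commute complex_cnj_zero)
    have "orthonormal_set (insert u E)"
      using E(2) o o' n cinner_self[of u] unfolding orthonormal_set_def by fastforce
    moreover have "d \<in> complex_vector.span (insert u E)"
    proof -
      have "d = complex_of_real (norm r) *\<^sub>C u + p"
        using False by (simp add: u_def r_def flip: scaleR_scaleC)
      moreover have "p \<in> complex_vector.span (insert u E)"
        using p complex_vector.span_mono[of E "insert u E"] by blast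
      ultimately show ?thesis
        by (metis complex_vector.span_add complex_vector.span_base complex_vector.span_scale insertI1)
    qed
    ultimately show ?thesis using E(1) by blast
  qed
qed

text \<open>The span is the fixed set of the continuous projection \<open>P\<close>. Together with
  density this shows that a finite orthonormal set cannot be total in an infinite-dimensional
  space.\<close>

lemma finite_orthonormal_span_closed:
  fixes E :: "'a::complex_inner set"
  assumes E: "finite E" "orthonormal_set E"
  shows "closure (complex_vector.span E) \<subseteq> complex_vector.span E"
proof -
  define P where "P x = (\<Sum>e\<in>E. cinner e x *\<^sub>C e)" for x
  have bl: "bounded_linear (\<lambda>x. cinner e x *\<^sub>C e)" for e :: 'a
  proof -
    have "cinner e x *\<^sub>C e = Re (cinner e x) *\<^sub>R e + Im (cinner e x) *\<^sub>R (\<i> *\<^sub>C e)" for x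
    proof -
      have "cinner e x = complex_of_real (Re (cinner e x)) + complex_of_real (Im (cinner e x)) * \<i>"
        by (simp add: complex_eq_iff)
      hence "cinner e x *\<^sub>C e = (complex_of_real (Re (cinner e x)) + complex_of_real (Im (cinner e x)) * \<i>) *\<^sub>C e"
        by simp
      thus ?thesis by (simp add: scaleC_add_left scaleR_scaleC scaleC_scaleC)
    qed
    moreover have "bounded_linear (\<lambda>x. Re (cinner e x) *\<^sub>R e + Im (cinner e x) *\<^sub>R (\<i> *\<^sub>C e))"
      by (intro bounded_linear_add bounded_linear_compose[OF bounded_linear_scaleR_left]
          bounded_linear_compose[OF bounded_linear_Re] bounded_linear_compose[OF bounded_linear_Im]
          bounded_linear_cinner)
    ultimately show ?thesis by presburger
  qed
  have cont: "continuous_on UNIV P" unfolding P_def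
    by (intro continuous_on_sum linear_continuous_on bl)
  have "complex_vector.subspace {x. P x = x}"
    by (rule complex_vector.subspaceI)
      (simp_all add: P_def cinner_add_right cinner_scaleC_right scaleC_add_left sum.distrib
        flip: scaleC_scaleC complex_vector.scale_sum_right)
  moreover have "E \<subseteq> {x. P x = x}"
  proof
    fix y assume y: "y \<in> E"
    have "P y = (\<Sum>e\<in>E. if e = y then e else 0)" unfolding P_def
      using E(2) y by (intro sum.cong) (auto simp: orthonormal_set_def scaleC_one)
    thus "y \<in> {x. P x = x}" using y E(1) by simp
  qed
  ultimately have "complex_vector.span E \<subseteq> {x. P x = x}" by (rule complex_vector.span_minimal[rotated])
  moreover have "closed {x. P x = x}" using cont by (intro closed_Collect_eq continuous_intros)
  ultimately have "closure (complex_vector.span E) \<subseteq> {x. P x = x}" by (rule closure_minimal)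
  moreover have "P x \<in> complex_vector.span E" for x unfolding P_def
    by (intro complex_vector.span_sum complex_vector.span_scale complex_vector.span_base)
  ultimately show ?thesis by (metis (mono_tags, lifting) mem_Collect_eq subsetD subsetI)
qed

lemma exists_orthonormal_basis:
  assumes sep: "separable_space (euclidean :: 'a::chilbert_space topology)"
    and inf: "\<not> (\<exists>S :: 'a set. finite S \<and> complex_vector.span S = UNIV)"
  obtains e :: "nat \<Rightarrow> 'a::chilbert_space" where "orthonormal e" "closure (complex_vector.span (range e)) = UNIV"
proof -
  obtain C :: "'a set" where C: "countable C" "closure C = UNIV"
    using sep by (auto simp: separable_space_def)
  hence "C \<noteq> {}" by auto
  define d where "d = from_nat_into C"
  have d: "range d = C" using C \<open>C \<noteq> {}\<close> by (simp add: d_def range_from_nat_into)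
  have "\<exists>E. \<forall>n. (finite (E n) \<and> orthonormal_set (E n)) \<and> (E n \<subseteq> E (Suc n) \<and> d n \<in> complex_vector.span (E (Suc n)))"
  proof (rule dependent_nat_choice)
    show "\<exists>E::'a set. finite E \<and> orthonormal_set E" by (rule exI[of _ "{}"]) (simp add: orthonormal_set_def)
  qed (use Gram_Schmidt_step in blast)
  then obtain E where E: "\<And>n. finite (E n)" "\<And>n. orthonormal_set (E n)" "\<And>n. E n \<subseteq> E (Suc n)"
    "\<And>n. d n \<in> complex_vector.span (E (Suc n))" by blast
  have mono: "E m \<subseteq> E n" if "m \<le> n" for m n using E(3) that by (rule lift_Suc_mono_le)
  define U where "U = (\<Union>n. E n)"
  have on: "orthonormal_set U" unfolding orthonormal_set_def
  proof (intro ballI)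
    fix x y assume "x \<in> U" "y \<in> U"
    then obtain m n where "x \<in> E m" "y \<in> E n" by (auto simp: U_def)
    hence "x \<in> E (max m n)" "y \<in> E (max m n)" using mono by (meson max.cobounded1 max.cobounded2 subsetD)+
    thus "cinner x y = (if x = y then 1 else 0)" using E(2) unfolding orthonormal_set_def by blast
  qed
  have "C \<subseteq> complex_vector.span U"
  proof
    fix x assume "x \<in> C"
    then obtain n where "x = d n" using d by auto
    thus "x \<in> complex_vector.span U" using E(4)[of n] complex_vector.span_mono[of "E (Suc n)" U]
      by (auto simp: U_def)
  qed
  hence dense: "closure (complex_vector.span U) = UNIV" using C(2) closure_mono by blast
  \<comment> \<open>Here infinite dimension enters: \<open>U\<close> must be infinite to be
    enumerated by all natural numbers without repetition.\<close>
  have "infinite U"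
  proof
    assume "finite U"
    hence "complex_vector.span U = UNIV" using finite_orthonormal_span_closed[OF _ on] dense by blast
    thus False using inf \<open>finite U\<close> by blast
  qed
  moreover have "countable U" unfolding U_def using E(1) by (auto intro: countable_finite)
  ultimately have bij: "bij_betw (from_nat_into U) UNIV U" by (rule bij_betw_from_nat_into[rotated])
  show ?thesis
  proof (rule that)
    show "orthonormal (from_nat_into U)"
      unfolding orthonormal_def
    proof (intro allI)
      fix m n
      have "from_nat_into U m \<in> U" "from_nat_into U n \<in> U" using bij by (auto simp: bij_betw_def)
      moreover have "from_nat_into U m = from_nat_into U n \<longleftrightarrow> m = n"
        using bij by (auto simp: bij_betw_def inj_eq)
      ultimately show "cinner (from_nat_into U m) (from_nat_into U n) = (if m = n then 1 else 0)"
        using on by (auto simp: orthonormal_set_def)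
    qed
    show "closure (complex_vector.span (range (from_nat_into U))) = UNIV"
      using dense bij by (simp add: bij_betw_def)
  qed
qed

text \<open>The relations of the Cuntz algebra with two generators. The map
  \<open>x \<mapsto> (W1 x, W2 x)\<close> identifies the space with two copies of itself, so
  two-by-two matrices of operators are again operators of the same type. The last assumption lets
  inequalities between multiples of the identity be read as inequalities between real
  numbers.\<close>

locale cuntz =
  fixes V1 V2 W1 W2 :: "'a::chilbert_space op"
  assumes adj1: "adj V1 W1" and adj2: "adj V2 W2"
    and iso1: "W1 \<odot> V1 = one_op" and iso2: "W2 \<odot> V2 = one_op"
    and orth12: "W1 \<odot> V2 = 0" and orth21: "W2 \<odot> V1 = 0"
    and total: "V1 \<odot> W1 + V2 \<odot> W2 = one_op"
    and nontrivial: "one_op \<noteq> (0 :: 'a op)"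

lemma exists_cuntz:
  assumes sep: "separable_space (euclidean :: 'a::chilbert_space topology)"
    and inf: "\<not> (\<exists>S :: 'a set. finite S \<and> complex_vector.span S = UNIV)"
  obtains V1 V2 W1 W2 :: "'a::chilbert_space op" where "cuntz V1 V2 W1 W2"
proof -
  obtain e :: "nat \<Rightarrow> 'a" where e: "orthonormal e" and t: "closure (complex_vector.span (range e)) = UNIV"
    using exists_orthonormal_basis[OF assms] .
  \<comment> \<open>The even-numbered and the odd-numbered basis vectors span the ranges of the two
    isometries.\<close>
  define a b where "a n = e (2 * n)" and "b n = e (2 * n + 1)" for n
  have a: "orthonormal a" and b: "orthonormal b" using e by (auto simp: orthonormal_def a_def b_def)
  have "one_op \<noteq> (0 :: 'a op)"
  proof
    assume *: "one_op = (0 :: 'a op)"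
    have "x = 0" for x :: 'a using arg_cong[OF *, of "\<lambda>T. blinfun_apply T x"] by simp
    hence "UNIV \<subseteq> complex_vector.span ({} :: 'a set)"
      by (metis complex_vector.span_zero subsetI)
    thus False using inf by blast
  qed
  have neq: "2 * j \<noteq> Suc (2 * k)" for j k :: nat by presburger
  have ab: "cinner (a j) (b k) = 0" "cinner (b j) (a k) = 0" for j k
    using e neq[of j k] neq[of k j] by (auto simp: orthonormal_def a_def b_def)
  show ?thesis
  proof (rule that[of "transfer_op e a" "transfer_op e b" "transfer_op a e" "transfer_op b e"], unfold_locales)
    show "one_op \<noteq> (0 :: 'a op)" by fact
    show "adj (transfer_op e a) (transfer_op a e)" "adj (transfer_op e b) (transfer_op b e)"
      by (simp_all add: transfer_op_adj e a b)
    show "transfer_op a e \<odot> transfer_op e a = one_op" "transfer_op b e \<odot> transfer_op e b = one_op"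
      by (simp_all add: transfer_op_compose e a b transfer_op_total t)
    show "transfer_op a e \<odot> transfer_op e b = 0" "transfer_op b e \<odot> transfer_op e a = 0"
      by (intro transfer_op_compose_zero e a b ab)+
    show "transfer_op e a \<odot> transfer_op a e + transfer_op e b \<odot> transfer_op b e = one_op"
    proof (rule total_op_eq_one[OF _ t])
      show "transfer_op e a \<odot> transfer_op a e + transfer_op e b \<odot> transfer_op b e \<in> bounded_ops"
        by (intro bounded_ops_add bounded_ops_compose transfer_op_bounded e a b)
      fix k
      have 1: "transfer_op a a (a n) = a n" "transfer_op b b (b n) = b n"
        "transfer_op a a (b n) = 0" "transfer_op b b (a n) = 0" for n
        by (simp_all add: transfer_op_basis transfer_op_orthogonal a b ab)
      have "e k = (if even k then a (k div 2) else b (k div 2))" by (simp add: a_def b_def)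
      thus "(transfer_op e a \<odot> transfer_op a e + transfer_op e b \<odot> transfer_op b e) (e k) = e k"
        unfolding transfer_op_compose[OF a e a] transfer_op_compose[OF b e b]
        by (cases "even k") (simp_all add: blinfun.bilinear_simps 1)
    qed
  qed
qed

section \<open>Block operators and concavity of operator monotone functions\<close>

lemma op_le_tendsto:
  assumes X: "(X \<longlongrightarrow> A) F" and Y: "(Y \<longlongrightarrow> B) F" and F: "F \<noteq> bot"
    and le: "eventually (\<lambda>n. X n \<preceq> Y n) F"
  shows "A \<preceq> B"
proof -
  have t: "((\<lambda>n. Y n - X n) \<longlongrightarrow> B - A) F" by (intro tendsto_diff X Y)
  have "sa (B - A)"
    by (rule adj_lim[OF t t F]) (use le in eventually_elim, simp add: op_le_def pos_ops_sa)
  moreover have "0 \<le> inner x ((B - A) x)" for x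
  proof (rule tendsto_lowerbound[OF _ _ F])
    show "((\<lambda>n. inner x (blinfun_apply (Y n - X n) x)) \<longlongrightarrow> inner x ((B - A) x)) F"
      by (intro tendsto_inner tendsto_const tendsto_blinfun_apply t)
    show "\<forall>\<^sub>F n in F. 0 \<le> inner x (blinfun_apply (Y n - X n) x)"
      using le by eventually_elim (simp add: op_le_def pos_ops_inner)
  qed
  ultimately show ?thesis by (simp add: op_le_def pos_ops_iff)
qed

lemma op_le_trans: "A \<preceq> B \<Longrightarrow> B \<preceq> C \<Longrightarrow> A \<preceq> C"
proof -
  assume "A \<preceq> B" "B \<preceq> C"
  moreover have "C - A = (C - B) + (B - A)" by simp
  ultimately show ?thesis unfolding op_le_def pos_ops_iff
    by (metis add_nonneg_nonneg adj_add blinfun.add_left inner_add_right)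
qed

lemma op_le_compose: "A \<preceq> B \<Longrightarrow> adj C D \<Longrightarrow> D \<odot> A \<odot> C \<preceq> D \<odot> B \<odot> C"
  using pos_compose[of "B - A" C D] by (simp add: op_le_def comp_op_simps)

lemma op_le_add: "A \<preceq> B \<Longrightarrow> C \<preceq> D \<Longrightarrow> A + C \<preceq> B + D"
  by (simp add: op_le_def pos_ops_iff add_diff_add adj_add blinfun.add_left inner_add_right)

lemma op_le_scaleR: "A \<preceq> B \<Longrightarrow> 0 \<le> r \<Longrightarrow> r *\<^sub>R A \<preceq> r *\<^sub>R B"
  by (simp add: op_le_def pos_ops_iff adj_scaleR blinfun.scaleR_left flip: scaleR_diff_right)

lemma op_le_refl: "A \<preceq> A"
  by (simp add: op_le_def pos_ops_iff)

lemma pos_inv_add: "A \<in> pos_inv_ops \<Longrightarrow> B \<in> pos_ops \<Longrightarrow> A + B \<in> pos_inv_ops"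
proof -
  assume A: "A \<in> pos_inv_ops" and B: "B \<in> pos_ops"
  obtain c where c: "c > 0" "\<And>x. c * (norm x)\<^sup>2 \<le> inner x (A x)" using A by (rule pos_inv_opsE) blast
  show ?thesis
  proof (rule pos_inv_opsI[OF _ c(1)])
    show "sa (A + B)" by (intro adj_add pos_inv_opsD(3)[OF A] pos_ops_sa[OF B])
    show "c * (norm x)\<^sup>2 \<le> inner x ((A + B) x)" for x
      using c(2)[of x] pos_ops_inner[OF B, of x] by (simp add: blinfun.add_left inner_add_right)
  qed
qed

lemma pos_inv_scaleR: "A \<in> pos_inv_ops \<Longrightarrow> r > 0 \<Longrightarrow> r *\<^sub>R A \<in> pos_inv_ops"
proof -
  assume A: "A \<in> pos_inv_ops" and r: "r > 0"
  obtain c where c: "c > 0" "\<And>x. c * (norm x)\<^sup>2 \<le> inner x (A x)" using A by (rule pos_inv_opsE) blast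
  show ?thesis
  proof (rule pos_inv_opsI)
    show "sa (r *\<^sub>R A)" by (intro adj_scaleR pos_inv_opsD(3)[OF A])
    show "r * c > 0" using r c by simp
    show "r * c * (norm x)\<^sup>2 \<le> inner x ((r *\<^sub>R A) x)" for x
      using c(2)[of x] r by (simp add: blinfun.scaleR_left mult.assoc)
  qed
qed

lemma pos_inv_one: "one_op \<in> pos_inv_ops"
  by (rule pos_inv_opsI[of _ 1]) (auto simp: power2_norm_eq_inner)

lemma pos_inv_scalar: "r > 0 \<Longrightarrow> r *\<^sub>R one_op \<in> pos_inv_ops"
  by (simp add: pos_inv_scaleR pos_inv_one)

lemma pos_ops_scalar: "r \<ge> 0 \<Longrightarrow> r *\<^sub>R one_op \<in> pos_ops"
  by (auto simp: pos_ops_iff adj_scaleR blinfun.scaleR_left)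

lemma pos_ops_add: "A \<in> pos_ops \<Longrightarrow> B \<in> pos_ops \<Longrightarrow> A + B \<in> pos_ops"
  by (simp add: pos_ops_iff adj_add blinfun.add_left inner_add_right)

lemma op_monotone_onD:
  "operator_monotone_on D f \<Longrightarrow> A \<in> D \<Longrightarrow> B \<in> D \<Longrightarrow> B \<preceq> A \<Longrightarrow> fun_calc f B \<preceq> fun_calc f A"
  by (simp add: operator_monotone_on_def)

text \<open>The diagonal matrix with entries \<open>a\<close> and \<open>b\<close> in the frame
  \<open>V1\<close>, \<open>V2\<close>. The frame is an argument, so that the same definition also
  serves rotated frames.\<close>

definition blk :: "'a::chilbert_space op \<Rightarrow> 'a op \<Rightarrow> 'a op \<Rightarrow> 'a op \<Rightarrow> 'a op \<Rightarrow> 'a op \<Rightarrow> 'a op" where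
  "blk V1 V2 W1 W2 a b = V1 \<odot> a \<odot> W1 + V2 \<odot> b \<odot> W2"

context cuntz
begin

abbreviation dg :: "'a op \<Rightarrow> 'a op \<Rightarrow> 'a op" where "dg \<equiv> blk V1 V2 W1 W2"

lemma cuntz_apply [simp]:
  "W1 (V1 x) = x" "W2 (V2 x) = x" "W1 (V2 x) = 0" "W2 (V1 x) = 0" "V1 (W1 x) + V2 (W2 x) = x"
  using arg_cong[OF iso1, of "\<lambda>T. T x"] arg_cong[OF iso2, of "\<lambda>T. T x"] arg_cong[OF total, of "\<lambda>T. T x"]
    arg_cong[OF orth12, of "\<lambda>T. T x"] arg_cong[OF orth21, of "\<lambda>T. T x"]
  by (simp_all add: blinfun.add_left)

lemma blk_apply: "dg a b x = V1 (a (W1 x)) + V2 (b (W2 x))"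
  by (simp add: blk_def blinfun.add_left)

lemma norm_split: "(norm x)\<^sup>2 = (norm (W1 x))\<^sup>2 + (norm (W2 x))\<^sup>2"
proof -
  have "inner x x = inner x (V1 (W1 x)) + inner x (V2 (W2 x))"
    using cuntz_apply(5)[of x] by (metis inner_add_right)
  thus ?thesis by (simp add: power2_norm_eq_inner adj_inner'[OF adj1, symmetric] adj_inner'[OF adj2, symmetric])
qed

lemma norm_V: "norm (V1 x) = norm x" "norm (V2 x) = norm x"
  using norm_split[of "V1 x"] norm_split[of "V2 x"] by (simp_all add: power2_eq_iff_nonneg)

lemma blk_inner: "inner x (dg a b x) = inner (W1 x) (a (W1 x)) + inner (W2 x) (b (W2 x))"
  by (simp add: blk_apply inner_add_right adj_inner'[OF adj1] adj_inner'[OF adj2])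

lemma blk_sa: "sa a \<Longrightarrow> sa b \<Longrightarrow> sa (dg a b)"
  using adj_add[OF adj_compose[OF adj_compose[OF adj1, of a a] adj_sym[OF adj1]]
      adj_compose[OF adj_compose[OF adj2, of b b] adj_sym[OF adj2]]]
  by (simp add: blk_def comp_op_assoc)

lemma blk_pos_inv:
  assumes "a \<in> pos_inv_ops" "b \<in> pos_inv_ops" shows "dg a b \<in> pos_inv_ops"
proof -
  obtain c where c: "c > 0" "\<And>x. c * (norm x)\<^sup>2 \<le> inner x (a x)" using assms(1) by (rule pos_inv_opsE) blast
  obtain d where d: "d > 0" "\<And>x. d * (norm x)\<^sup>2 \<le> inner x (b x)" using assms(2) by (rule pos_inv_opsE) blast
  show ?thesis
  proof (rule pos_inv_opsI)
    show "sa (dg a b)" using assms by (intro blk_sa pos_inv_opsD)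
    show "min c d > 0" using c d by simp
    fix x
    have "min c d * (norm (W1 x))\<^sup>2 \<le> c * (norm (W1 x))\<^sup>2" "min c d * (norm (W2 x))\<^sup>2 \<le> d * (norm (W2 x))\<^sup>2"
      by (intro mult_right_mono; simp)+
    thus "min c d * (norm x)\<^sup>2 \<le> inner x (dg a b x)"
      using c(2)[of "W1 x"] d(2)[of "W2 x"] by (simp add: norm_split[of x] blk_inner distrib_left)
  qed
qed

text \<open>Each isometry intertwines the block operator with one of its entries, hence also the
  functions of them. The relation \<open>total\<close> reassembles the two corners.\<close>

lemma fun_calc_blk:
  assumes a: "a \<in> pos_inv_ops" and b: "b \<in> pos_inv_ops" and f: "continuous_on {0<..} f"
  shows "fun_calc f (dg a b) = dg (fun_calc f a) (fun_calc f b)"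
proof -
  let ?X = "dg a b"
  have X: "?X \<in> pos_inv_ops" by (rule blk_pos_inv[OF a b])
  have "?X \<odot> V1 = V1 \<odot> a" "?X \<odot> V2 = V2 \<odot> b"
    by (auto intro!: blinfun_eqI simp: blk_apply blinfun.bilinear_simps)
  hence 1: "fun_calc f ?X \<odot> V1 = V1 \<odot> fun_calc f a" and 2: "fun_calc f ?X \<odot> V2 = V2 \<odot> fun_calc f b"
    using X a b by (auto intro!: fun_calc_intertwine pos_inv_opsD pos_inv_continuous f)
  have "fun_calc f ?X = fun_calc f ?X \<odot> (V1 \<odot> W1 + V2 \<odot> W2)" by (simp only: total comp_op_simps(9))
  also have "\<dots> = (fun_calc f ?X \<odot> V1) \<odot> W1 + (fun_calc f ?X \<odot> V2) \<odot> W2" by (simp add: comp_op_simps)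
  also have "\<dots> = dg (fun_calc f a) (fun_calc f b)" unfolding 1 2 by (simp only: blk_def)
  finally show ?thesis .
qed

text \<open>A rotated frame satisfies the same relations, so every result on diagonal matrices in
  this locale holds for rotated ones through the locale's exported theorems.\<close>

lemma rotate:
  assumes "c\<^sup>2 + s\<^sup>2 = 1"
  shows "cuntz (c *\<^sub>R V1 + s *\<^sub>R V2) (c *\<^sub>R V2 - s *\<^sub>R V1) (c *\<^sub>R W1 + s *\<^sub>R W2) (c *\<^sub>R W2 - s *\<^sub>R W1)"
proof
  have cs: "c * c + s * s = 1" using assms by (simp add: power2_eq_square)
  show "adj (c *\<^sub>R V1 + s *\<^sub>R V2) (c *\<^sub>R W1 + s *\<^sub>R W2)" "adj (c *\<^sub>R V2 - s *\<^sub>R V1) (c *\<^sub>R W2 - s *\<^sub>R W1)"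
    by (intro adj_add adj_diff adj_scaleR adj1 adj2)+
  have [simp]: "(c * c) *\<^sub>R x + (s * s) *\<^sub>R x = x" for x :: 'a by (metis cs scaleR_add_left scaleR_one)
  have [simp]: "c * (c * r) + s * (s * r) = r" for r by (metis cs distrib_right mult.assoc mult_1)
  show "(c *\<^sub>R W1 + s *\<^sub>R W2) \<odot> (c *\<^sub>R V1 + s *\<^sub>R V2) = one_op"
    "(c *\<^sub>R W2 - s *\<^sub>R W1) \<odot> (c *\<^sub>R V2 - s *\<^sub>R V1) = one_op"
    "(c *\<^sub>R W1 + s *\<^sub>R W2) \<odot> (c *\<^sub>R V2 - s *\<^sub>R V1) = 0"
    "(c *\<^sub>R W2 - s *\<^sub>R W1) \<odot> (c *\<^sub>R V1 + s *\<^sub>R V2) = 0"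
    by (rule blinfun_eqI, simp add: blinfun.bilinear_simps mult.commute)+
  show "(c *\<^sub>R V1 + s *\<^sub>R V2) \<odot> (c *\<^sub>R W1 + s *\<^sub>R W2) + (c *\<^sub>R V2 - s *\<^sub>R V1) \<odot> (c *\<^sub>R W2 - s *\<^sub>R W1) = one_op"
  proof -
    have "(c *\<^sub>R V1 + s *\<^sub>R V2) \<odot> (c *\<^sub>R W1 + s *\<^sub>R W2) + (c *\<^sub>R V2 - s *\<^sub>R V1) \<odot> (c *\<^sub>R W2 - s *\<^sub>R W1)
      = (c * c + s * s) *\<^sub>R (V1 \<odot> W1 + V2 \<odot> W2)"
      by (simp add: comp_op_simps algebra_simps)
    thus ?thesis by (simp add: cs total)
  qed
  show "one_op \<noteq> (0 :: 'a op)" by (rule nontrivial)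
qed

text \<open>With the rotation matrix \<open>U\<close> this is \<open>U diag(a,b) U^T\<close> in the
  original frame: diagonal entries \<open>c^2 a + s^2 b\<close> and \<open>s^2 a + c^2 b\<close>,
  off-diagonal entries \<open>c s (a - b)\<close>. Its functional calculus is explicit although its
  corners mix \<open>a\<close> and \<open>b\<close>.\<close>

definition Br :: "real \<Rightarrow> real \<Rightarrow> 'a op \<Rightarrow> 'a op \<Rightarrow> 'a op" where
  "Br c s = blk (c *\<^sub>R V1 + s *\<^sub>R V2) (c *\<^sub>R V2 - s *\<^sub>R V1) (c *\<^sub>R W1 + s *\<^sub>R W2) (c *\<^sub>R W2 - s *\<^sub>R W1)"

lemma Br_pos_inv: "c\<^sup>2 + s\<^sup>2 = 1 \<Longrightarrow> a \<in> pos_inv_ops \<Longrightarrow> b \<in> pos_inv_ops \<Longrightarrow> Br c s a b \<in> pos_inv_ops"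
  unfolding Br_def using cuntz.blk_pos_inv[OF rotate] .

lemma fun_calc_Br:
  "c\<^sup>2 + s\<^sup>2 = 1 \<Longrightarrow> a \<in> pos_inv_ops \<Longrightarrow> b \<in> pos_inv_ops \<Longrightarrow> continuous_on {0<..} f \<Longrightarrow>
    fun_calc f (Br c s a b) = Br c s (fun_calc f a) (fun_calc f b)"
  unfolding Br_def using cuntz.fun_calc_blk[OF rotate] .

lemma Br_compress:
  "W1 \<odot> Br c s a b \<odot> V1 = c\<^sup>2 *\<^sub>R a + s\<^sup>2 *\<^sub>R b" "W2 \<odot> Br c s a b \<odot> V2 = s\<^sup>2 *\<^sub>R a + c\<^sup>2 *\<^sub>R b"
  by (auto intro!: blinfun_eqI simp: Br_def blk_def blinfun.bilinear_simps power2_eq_square)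

lemma dg_compress: "W1 \<odot> dg a b \<odot> V1 = a" "W2 \<odot> dg a b \<odot> V2 = b"
  by (auto intro!: blinfun_eqI simp: blk_apply blinfun.bilinear_simps)

text \<open>The off-diagonal entries are odd in \<open>s\<close> and cancel. This produces pairs of
  operators whose functions and whose midpoint are all explicit.\<close>

lemma Br_avg: "Br c s a b + Br c (- s) a b = 2 *\<^sub>R dg (c\<^sup>2 *\<^sub>R a + s\<^sup>2 *\<^sub>R b) (s\<^sup>2 *\<^sub>R a + c\<^sup>2 *\<^sub>R b)"
  by (simp add: Br_def blk_def comp_op_simps power2_eq_square algebra_simps)
    (simp add: mult_ac flip: scaleR_2 add.assoc)

text \<open>The off-diagonal part is absorbed by positivity of \<open>X\<close> at
  \<open>d *\<^sub>R p - q\<close>, where \<open>p\<close> and \<open>q\<close> are the components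
  of the vector. The weight given to one corner is taken reciprocally from the other.\<close>

lemma pos_le_blk:
  assumes X: "X \<in> pos_ops" and d: "d > 0"
  shows "X \<preceq> dg ((1 + d) *\<^sub>R (W1 \<odot> X \<odot> V1)) ((1 + 1 / d) *\<^sub>R (W2 \<odot> X \<odot> V2))"
proof (rule op_leI)
  note sX = pos_ops_sa[OF X]
  show "sa X" by fact
  show "sa (dg ((1 + d) *\<^sub>R (W1 \<odot> X \<odot> V1)) ((1 + 1 / d) *\<^sub>R (W2 \<odot> X \<odot> V2)))"
    by (intro blk_sa adj_scaleR pos_ops_sa[OF pos_compose[OF X adj1]] pos_ops_sa[OF pos_compose[OF X adj2]])
  fix z
  define p q where "p = V1 (W1 z)" and "q = V2 (W2 z)"
  have z: "z = p + q" by (simp add: p_def q_def)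
  have "0 \<le> inner (d *\<^sub>R p - q) (X (d *\<^sub>R p - q))" using X by (rule pos_ops_inner)
  also have "\<dots> = d\<^sup>2 * inner p (X p) - 2 * d * inner p (X q) + inner q (X q)"
    using adj_inner[OF sX, of p q]
    by (simp add: blinfun.bilinear_simps inner_diff inner_commute power2_eq_square algebra_simps)
  finally have *: "2 * inner p (X q) \<le> d * inner p (X p) + inner q (X q) / d"
    using d by (simp add: field_simps power2_eq_square)
  have "inner z (X z) = inner p (X p) + 2 * inner p (X q) + inner q (X q)"
    using adj_inner[OF sX, of p q] unfolding z
    by (simp add: blinfun.bilinear_simps inner_add inner_commute)
  also have "\<dots> \<le> (1 + d) * inner p (X p) + (1 + 1 / d) * inner q (X q)"
    using * by (simp add: algebra_simps)
  also have "\<dots> = inner z (dg ((1 + d) *\<^sub>R (W1 \<odot> X \<odot> V1)) ((1 + 1 / d) *\<^sub>R (W2 \<odot> X \<odot> V2)) z)"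
    by (simp add: blk_inner p_def q_def blinfun.bilinear_simps adj_inner[OF adj1] adj_inner[OF adj2])
  finally show "inner z (X z) \<le> inner z (dg ((1 + d) *\<^sub>R (W1 \<odot> X \<odot> V1)) ((1 + 1 / d) *\<^sub>R (W2 \<odot> X \<odot> V2)) z)" .
qed

text \<open>The first corner of the rotated matrix \<open>X\<close> is the convex combination of
  \<open>a\<close> and \<open>b\<close>, and the first corner of \<open>f(X)\<close> is that of
  \<open>f(a)\<close> and \<open>f(b)\<close>. Bounding \<open>X\<close> by a diagonal operator and
  compressing compares the two up to the factor \<open>1 + d\<close>, which then tends to 1.\<close>

lemma op_monotone_imp_concave:
  fixes a b :: "'a op"
  assumes f: "continuous_on {0<..} f" and m: "operator_monotone_on (pos_inv_ops :: 'a op set) f"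
    and a: "a \<in> pos_inv_ops" and b: "b \<in> pos_inv_ops" and cs: "c\<^sup>2 + s\<^sup>2 = 1"
  shows "c\<^sup>2 *\<^sub>R fun_calc f a + s\<^sup>2 *\<^sub>R fun_calc f b \<preceq> fun_calc f (c\<^sup>2 *\<^sub>R a + s\<^sup>2 *\<^sub>R b)"
proof -
  define X where "X = Br c s a b"
  have X: "X \<in> pos_inv_ops" unfolding X_def by (rule Br_pos_inv[OF cs a b])
  define N where "N = W1 \<odot> X \<odot> V1"
  have N_eq: "N = c\<^sup>2 *\<^sub>R a + s\<^sup>2 *\<^sub>R b" by (simp add: N_def X_def Br_compress)
  have form: "W \<odot> X \<odot> V \<in> pos_inv_ops" if "adj V W" "\<And>x. norm (V x) = norm x" for V W
  proof -
    obtain e where e: "e > 0" "\<And>x. e * (norm x)\<^sup>2 \<le> inner x (X x)" using X by (rule pos_inv_opsE) blast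
    show ?thesis
      using e(2)[of "blinfun_apply V _"] pos_ops_sa[OF pos_compose[OF pos_inv_opsD(1)[OF X] that(1)]]
      by (intro pos_inv_opsI[OF _ e(1)]) (simp_all add: adj_inner'[OF that(1)] adj_inner[OF that(1), symmetric] that(2))
  qed
  have N: "N \<in> pos_inv_ops" unfolding N_def by (rule form[OF adj1 norm_V(1)])
  have step: "c\<^sup>2 *\<^sub>R fun_calc f a + s\<^sup>2 *\<^sub>R fun_calc f b \<preceq> fun_calc f ((1 + d) *\<^sub>R N)" if d: "d > 0" for d
  proof -
    define N' where "N' = (1 + 1 / d) *\<^sub>R (W2 \<odot> X \<odot> V2)"
    have N': "N' \<in> pos_inv_ops" and dN: "(1 + d) *\<^sub>R N \<in> pos_inv_ops"
      unfolding N'_def using d by (auto intro!: pos_inv_scaleR form[OF adj2 norm_V(2)] N add_pos_pos)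
    \<comment> \<open>The second block \<open>N'\<close> grows without control as \<open>d\<close>
      tends to 0, but compression to the first corner removes it.\<close>
    have "X \<preceq> dg ((1 + d) *\<^sub>R N) N'"
      unfolding N_def N'_def by (rule pos_le_blk[OF pos_inv_opsD(1)[OF X] d])
    hence "fun_calc f X \<preceq> fun_calc f (dg ((1 + d) *\<^sub>R N) N')"
      by (intro op_monotone_onD[OF m] blk_pos_inv dN N' X)
    from op_le_compose[OF this adj1] show ?thesis
      by (simp add: X_def fun_calc_Br[OF cs a b f] fun_calc_blk[OF dN N' f] Br_compress dg_compress)
  qed
  obtain l u where lu: "0 < l" "l \<le> u" "real_spectrum N \<subseteq> {l..u}" using N by (rule pos_inv_spectrum)
  \<comment> \<open>The interval \<open>{l..2*u}\<close> contains the spectra of all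
    \<open>(1 + d) N\<close> with \<open>0 < d < 1\<close>.\<close>
  have lim: "((\<lambda>d. fun_calc f ((1 + d) *\<^sub>R N)) \<longlongrightarrow> fun_calc f N) (at_right 0)"
  proof (rule fun_calc_tendsto[where K = "{l..2*u}"])
    have "((\<lambda>d. (1 + d) *\<^sub>R N) \<longlongrightarrow> (1 + 0) *\<^sub>R N) (at_right (0::real))"
      by (intro tendsto_intros)
    thus "((\<lambda>d. (1 + d) *\<^sub>R N) \<longlongrightarrow> N) (at_right (0::real))" by simp
    show "continuous_on {l..2*u} f" using lu(1) by (intro continuous_on_subset[OF f]) auto
    show "real_spectrum N \<subseteq> {l..2*u}" using lu by auto
    show "\<forall>\<^sub>F d in at_right 0. sa ((1 + d) *\<^sub>R N) \<and> real_spectrum ((1 + d) *\<^sub>R N) \<subseteq> {l..2*u}"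
    proof -
      have "\<forall>\<^sub>F d in at_right (0::real). 0 < d \<and> d < 1"
        using eventually_at_right_real[of 0 "1::real"] by simp
      thus ?thesis
      proof eventually_elim
        case (elim d)
        have g: "(1 + d) *\<^sub>R N = fun_calc (\<lambda>t. (1 + d) * t) N"
          using fun_calc_scaleR[of N "\<lambda>t. t" "1 + d"] pos_inv_opsD(3)[OF N] by (simp add: fun_calc_id)
        have "(1 + d) * t \<in> {l..2*u}" if "t \<in> real_spectrum N" for t
        proof -
          have "l \<le> t" "t \<le> u" using lu that by auto
          moreover have "1 * t \<le> (1 + d) * t" "(1 + d) * t \<le> 2 * u"
            using elim \<open>l \<le> t\<close> \<open>t \<le> u\<close> lu(1) by (intro mult_right_mono mult_mono; simp)+
          ultimately show ?thesis by simp
        qed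
        thus ?case unfolding g
          by (intro conjI fun_calc_sa fun_calc_spectrum pos_inv_opsD(3)[OF N]) (auto intro!: continuous_intros)
      qed
    qed
  qed (use pos_inv_opsD(3)[OF N] in auto)
  show ?thesis unfolding N_eq[symmetric]
  proof (rule op_le_tendsto[OF tendsto_const lim])
    show "\<forall>\<^sub>F d in at_right 0. c\<^sup>2 *\<^sub>R fun_calc f a + s\<^sup>2 *\<^sub>R fun_calc f b \<preceq> fun_calc f ((1 + d) *\<^sub>R N)"
      using eventually_at_right_less[of "0::real"] by eventually_elim (rule step)
  qed simp
qed

lemma scalar_le_iff: "a *\<^sub>R one_op \<preceq> b *\<^sub>R (one_op :: 'a op) \<longleftrightarrow> a \<le> b"
proof
  have "\<exists>x::'a. x \<noteq> 0"
  proof (rule ccontr)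
    assume "\<not> ?thesis"
    hence "one_op = (0 :: 'a op)" by (intro blinfun_eqI) simp
    thus False using nontrivial by blast
  qed
  then obtain x :: 'a where x: "x \<noteq> 0" by blast
  assume "a *\<^sub>R one_op \<preceq> b *\<^sub>R (one_op :: 'a op)"
  from op_leD[OF this, of x] show "a \<le> b" using x by (simp add: blinfun.scaleR_left)
next
  assume "a \<le> b"
  thus "a *\<^sub>R one_op \<preceq> b *\<^sub>R (one_op :: 'a op)"
    by (intro op_leI adj_scaleR adj_one) (simp add: blinfun.scaleR_left mult_right_mono)
qed

lemma op_monotone_imp_mono:
  assumes "operator_monotone_on (pos_inv_ops :: 'a op set) f" "0 < x" "x \<le> y"
  shows "f x \<le> f y"
  using op_monotone_onD[OF assms(1) pos_inv_scalar[of y] pos_inv_scalar[of x]] assms(2,3)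
  by (simp add: fun_calc_scalar scalar_le_iff)

lemma op_monotone_imp_concave_real:
  assumes f: "continuous_on {0<..} f" and m: "operator_monotone_on (pos_inv_ops :: 'a op set) f"
    and xy: "0 < x" "0 < y" and l: "0 \<le> l" "l \<le> 1"
  shows "l * f x + (1 - l) * f y \<le> f (l * x + (1 - l) * y)"
proof -
  have cs: "(sqrt l)\<^sup>2 + (sqrt (1 - l))\<^sup>2 = 1" using l by simp
  have "l *\<^sub>R fun_calc f (x *\<^sub>R one_op) + (1 - l) *\<^sub>R fun_calc f (y *\<^sub>R one_op)
     \<preceq> fun_calc f (l *\<^sub>R (x *\<^sub>R one_op) + (1 - l) *\<^sub>R (y *\<^sub>R (one_op :: 'a op)))"
    using op_monotone_imp_concave[OF f m pos_inv_scalar[OF xy(1)] pos_inv_scalar[OF xy(2)] cs] l by simp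
  thus ?thesis
    by (simp add: fun_calc_scalar scalar_le_iff flip: scaleR_add_left)
qed

end

section \<open>Operator means\<close>

text \<open>The weights make the convex combination of \<open>1 / x\<close> and \<open>x\<close>
  equal to 1, and the symmetry makes both summands equal to \<open>h x / (1 + x)\<close>.\<close>

lemma symmetric_concave_le:
  fixes h :: "real \<Rightarrow> real"
  assumes conc: "\<And>x y l. 0 < x \<Longrightarrow> 0 < y \<Longrightarrow> 0 \<le> l \<Longrightarrow> l \<le> 1 \<Longrightarrow> l * h x + (1 - l) * h y \<le> h (l * x + (1 - l) * y)"
    and sym: "\<And>x. 0 < x \<Longrightarrow> x * h (1 / x) = h x" and h1: "h 1 = 1" and x: "0 < x"
  shows "h x \<le> (1 + x) / 2"
proof -
  define l where "l = x / (1 + x)"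
  have l: "0 \<le> l" "l \<le> 1" "1 - l = 1 / (1 + x)" using x by (simp_all add: l_def field_simps)
  have "l * h (1 / x) + (1 - l) * h x \<le> h (l * (1 / x) + (1 - l) * x)"
    using x l by (intro conc) auto
  moreover have "l * (1 / x) + (1 - l) * x = 1" unfolding l(3) using x by (simp add: l_def field_simps)
  moreover have "l * h (1 / x) = h x / (1 + x)" using sym[OF x] by (simp add: l_def)
  ultimately have "(h x + h x) / (1 + x) \<le> 1" by (simp add: l(3) h1 add_divide_distrib)
  thus ?thesis using x by (simp add: divide_le_eq)
qed

text \<open>A concave function that is below the line \<open>(1 + y)/2\<close> at one point
  \<open>z < 1\<close> stays, for arguments smaller than \<open>z\<close>, below the line through
  that point and \<open>(1, 1)\<close>, whose value at 0 is less than 1/2. Symmetry carries this to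
  infinity. The term with \<open>K\<close> is bounded at both ends and only has to cover a compact
  interval.\<close>

lemma symmetric_concave_strict:
  fixes u :: "real \<Rightarrow> real"
  assumes conc: "\<And>x y l. 0 < x \<Longrightarrow> 0 < y \<Longrightarrow> 0 \<le> l \<Longrightarrow> l \<le> 1 \<Longrightarrow> l * u x + (1 - l) * u y \<le> u (l * x + (1 - l) * y)"
    and sym: "\<And>x. 0 < x \<Longrightarrow> x * u (1 / x) = u x" and u1: "u 1 = 1"
    and pos: "\<And>x. 0 < x \<Longrightarrow> 0 < u x"
    and y0: "0 < y0" "u y0 \<noteq> (1 + y0) / 2"
  shows "\<exists>c K. c < 1 / 2 \<and> 0 \<le> c \<and> 0 \<le> K \<and> (\<forall>y>0. u y \<le> c * (1 + y) + K * (y / (1 + y)))"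
proof -
  have le: "u x \<le> (1 + x) / 2" if "0 < x" for x by (rule symmetric_concave_le[OF conc sym u1 that])
  have "\<exists>y>0. y < 1 \<and> u y < (1 + y) / 2"
  proof -
    have lt: "u y0 < (1 + y0) / 2" using le[OF y0(1)] y0 by auto
    have "y0 \<noteq> 1" using y0 u1 by auto
    show ?thesis
    proof (cases "y0 < 1")
      case True thus ?thesis using y0 lt by blast
    next
      case False
      \<comment> \<open>Symmetry reflects a strict point above 1 to one below 1.\<close>
      have "u (1 / y0) = u y0 / y0" using sym[OF y0(1)] y0(1) by (simp add: field_simps)
      hence "u (1 / y0) < (1 + 1 / y0) / 2" using lt y0(1) by (simp add: field_simps)
      moreover have "1 / y0 < 1" "1 / y0 > 0" using False \<open>y0 \<noteq> 1\<close> y0(1) by auto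
      ultimately show ?thesis by blast
    qed
  qed
  then obtain z where z: "0 < z" "z < 1" "u z < (1 + z) / 2" by blast
  \<comment> \<open>The slope of the line through \<open>(z, u z)\<close> and \<open>(1, 1)\<close>.
    It exceeds 1/2 because \<open>(z, u z)\<close> is strictly below
    \<open>(1 + y)/2\<close>.\<close>
  define d where "d = (1 - u z) / (1 - z)"
  have d: "d > 1 / 2" using z by (simp add: d_def field_simps)
  have bound: "u y \<le> 1 - d + d * y" if y: "0 < y" "y < z" for y
  proof -
    define l where "l = (1 - z) / (1 - y)"
    have l: "0 < l" "l \<le> 1" using y z by (simp_all add: l_def)
    have "l * (1 - y) = 1 - z" using y z by (simp add: l_def)
    hence eq: "l * y + (1 - l) * 1 = z" by (simp add: algebra_simps)
    have "l * u y + (1 - l) * u 1 \<le> u z"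
      using conc[of y 1 l] y l unfolding eq by auto
    hence "l * u y \<le> u z - 1 + l" by (simp add: u1)
    hence "u y \<le> (u z - 1 + l) / l" using l by (simp add: field_simps)
    also have "\<dots> = 1 + (u z - 1) * ((1 - y) / (1 - z))"
      using l(1) by (simp add: add_divide_distrib) (simp add: l_def)
    also have "\<dots> = 1 - d * (1 - y)" by (simp add: d_def diff_divide_distrib algebra_simps)
    also have "\<dots> = 1 - d + d * y" by (simp add: algebra_simps)
    finally show ?thesis .
  qed
  \<comment> \<open>\<open>c\<close> is halfway between \<open>1 - d\<close>, the value of that line
    at 0, and 1/2; up to \<open>y1\<close> the line has not yet risen above
    \<open>c\<close>.\<close>
  define c where "c = (1 - d + 1 / 2) / 2"
  define y1 where "y1 = min (z / 2) ((c - (1 - d)) / d)"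
  have cd: "c < 1 / 2" "c - (1 - d) > 0" using d by (simp_all add: c_def field_simps)
  have y1: "0 < y1" "y1 < z" "d * y1 \<le> c - (1 - d)"
  proof -
    show "0 < y1" using z d cd by (simp add: y1_def)
    show "y1 < z" using z by (simp add: y1_def)
    have "y1 \<le> (c - (1 - d)) / d" by (simp add: y1_def)
    thus "d * y1 \<le> c - (1 - d)" using d by (simp add: field_simps)
  qed
  have small: "u y \<le> c" if y: "0 < y" "y \<le> y1" for y
  proof -
    have "d * y \<le> d * y1" using y d by simp
    thus ?thesis using bound[of y] y y1 by simp
  qed
  have c0: "c > 0" using small[of y1] pos[of y1] y1 by simp
  \<comment> \<open>An upper bound of \<open>(1 + y)\<^sup>2 / (2 * y)\<close> for \<open>y\<close>
    between \<open>y1\<close> and \<open>1 / y1\<close>: there the term with \<open>K\<close> alone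
    dominates \<open>(1 + y) / 2\<close>.\<close>
  define K where "K = (1 + 1 / y1)\<^sup>2 / (2 * y1)"
  have K: "K \<ge> 0" using y1 by (simp add: K_def)
  have "u y \<le> c * (1 + y) + K * (y / (1 + y))" if y: "y > 0" for y
  proof -
    have nn: "K * (y / (1 + y)) \<ge> 0" using K y by simp
    consider "y \<le> y1" | "1 / y1 \<le> y" | "y1 \<le> y" "y \<le> 1 / y1" by linarith
    thus ?thesis
    proof cases
      case 1
      have "u y \<le> c" by (rule small[OF y 1])
      also have "c \<le> c * (1 + y)" using c0 y by simp
      finally show ?thesis using nn by linarith
    next
      case 2
      hence "1 / y \<le> y1" using y y1 by (simp add: field_simps)
      hence "u (1 / y) \<le> c" using y by (intro small) auto
      hence "y * u (1 / y) \<le> y * c" using y by simp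
      hence "u y \<le> c * y" using sym[OF y] by (simp add: mult.commute)
      also have "\<dots> \<le> c * (1 + y)" using c0 by simp
      finally show ?thesis using nn by linarith
    next
      case 3
      have "(1 + y)\<^sup>2 / (2 * y) \<le> K" unfolding K_def
        using 3 y1 y by (intro frac_le power_mono) auto
      hence "(1 + y)\<^sup>2 / (2 * y) * (y / (1 + y)) \<le> K * (y / (1 + y))"
        using y by (intro mult_right_mono) auto
      moreover have "(1 + y)\<^sup>2 / (2 * y) * (y / (1 + y)) = (1 + y) / 2"
      proof -
        have "w\<^sup>2 / (2 * y) * (y / w) = w / 2" if "w \<noteq> 0" for w :: real
          using y that by (simp add: power2_eq_square)
        from this[of "1 + y"] show ?thesis using y by linarith
      qed
      ultimately have "u y \<le> K * (y / (1 + y))" using le[OF y] by linarith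
      thus ?thesis using c0 y by (smt (verit) mult_pos_pos)
    qed
  qed
  thus ?thesis using cd(1) c0 K by (intro exI[of _ c] exI[of _ K]) auto
qed

lemma pos_inv_op_inv_comp:
  assumes A: "A \<in> pos_inv_ops" and h: "continuous_on {0<..} h"
  shows "fun_calc h (op_inv A) = fun_calc (\<lambda>t. h (1 / t)) A"
proof -
  obtain a b where ab: "0 < a" "a \<le> b" "real_spectrum A \<subseteq> {a..b}" using A by (rule pos_inv_spectrum)
  have "fun_calc h (fun_calc (\<lambda>t. 1 / t) A) = fun_calc (\<lambda>t. h (1 / t)) A"
  proof (rule fun_calc_comp)
    show "sa A" using A by (rule pos_inv_opsD)
    show "continuous_on (real_spectrum A) (\<lambda>t. 1 / t)"
      using pos_inv_spectrum_pos[OF A] by (intro continuous_intros) auto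
    show "continuous_on {1 / b..1 / a} h" using ab by (intro continuous_on_subset[OF h]) (auto intro: less_le_trans[of 0 "1 / b"])
    show "1 / t \<in> {1 / b..1 / a}" if "t \<in> real_spectrum A" for t
      using that ab by (auto intro!: divide_left_mono mult_pos_pos)
  qed
  thus ?thesis by (simp add: op_inv_eq_fun_calc[OF A])
qed

text \<open>Two inversions, each reversing the order, surround \<open>h\<close>. The function
  represents the adjoint mean, that is, the inverse of the mean of the inverses, and its concavity
  is the source of all upper bounds on \<open>1/h\<close>.\<close>

lemma adjoint_op_monotone:
  assumes h: "continuous_on {0<..} h" and pos: "\<And>x. 0 < x \<Longrightarrow> 0 < h x"
    and m: "operator_monotone_on (pos_inv_ops :: 'a::chilbert_space op set) h"
  shows "operator_monotone_on (pos_inv_ops :: 'a op set) (\<lambda>t. 1 / h (1 / t))"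
  unfolding operator_monotone_on_def
proof (intro ballI impI)
  fix A B :: "'a op" assume A: "A \<in> pos_inv_ops" and B: "B \<in> pos_inv_ops" and le: "B \<preceq> A"
  have pi: "fun_calc h X \<in> pos_inv_ops" if "X \<in> pos_inv_ops" for X :: "'a op"
    using pos_inv_spectrum_pos[OF that] that pos by (intro fun_calc_pos_inv pos_inv_opsD pos_inv_continuous h) auto
  have hc: "continuous_on {0<..} (\<lambda>t. h (1 / t))"
    by (rule continuous_on_compose2[OF h]) (auto intro!: continuous_intros)
  have eq: "fun_calc (\<lambda>t. 1 / h (1 / t)) X = op_inv (fun_calc h (op_inv X))" if "X \<in> pos_inv_ops" for X :: "'a op"
    unfolding pos_inv_op_inv_comp[OF that h]
    using that pos_inv_spectrum_pos[OF that] pos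
    by (subst op_inv_fun_calc[OF pos_inv_opsD(3)[OF that] pos_inv_continuous[OF that hc]])
      (auto simp: less_imp_neq[symmetric])
  have "fun_calc h (op_inv A) \<preceq> fun_calc h (op_inv B)"
    by (intro op_monotone_onD[OF m] op_inv_pos_inv A B op_inv_antimono le)
  thus "fun_calc (\<lambda>t. 1 / h (1 / t)) B \<preceq> fun_calc (\<lambda>t. 1 / h (1 / t)) A"
    unfolding eq[OF A] eq[OF B] by (intro op_inv_antimono pi op_inv_pos_inv A B)
qed

section \<open>The closed formula for means with an invertible first argument\<close>

lemma op_inv_scalar: "a \<noteq> 0 \<Longrightarrow> op_inv (a *\<^sub>R one_op) = (1 / a) *\<^sub>R one_op"
  by (rule op_inv_eqI) (auto simp: comp_op_simps bounded_ops_scaleR bounded_ops_one)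

lemma pos_inv_congr:
  assumes X: "X \<in> pos_inv_ops" and C: "adj C D" "op_invertible C"
  shows "D \<odot> X \<odot> C \<in> pos_inv_ops"
proof -
  obtain c where c: "c > 0" "\<And>x. c * (norm x)\<^sup>2 \<le> inner x (X x)" using X by (rule pos_inv_opsE) blast
  obtain d where d: "d > 0" "\<And>x. d * norm x \<le> norm (C x)" using op_invertible_imp_below[OF C(2)] by blast
  show ?thesis
  proof (rule pos_inv_opsI)
    show "sa (D \<odot> X \<odot> C)" by (intro pos_ops_sa pos_compose pos_inv_opsD X C)
    show "c * d\<^sup>2 > 0" using c d by simp
    fix x
    have "(d * norm x)\<^sup>2 \<le> (norm (C x))\<^sup>2" using d by (intro power_mono) auto
    hence "c * (d * norm x)\<^sup>2 \<le> c * (norm (C x))\<^sup>2" using c by simp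
    also have "\<dots> \<le> inner (C x) (X (C x))" by (rule c)
    finally show "c * d\<^sup>2 * (norm x)\<^sup>2 \<le> inner x ((D \<odot> X \<odot> C) x)"
      using adj_inner[OF C(1)] by (simp add: power_mult_distrib mult.assoc)
  qed
qed

lemma op_inv_congr:
  fixes R S Y :: "'a::chilbert_space op"
  assumes RS: "R \<odot> S = one_op" "S \<odot> R = one_op" and R: "R \<in> bounded_ops" and Y: "op_invertible Y"
  shows "op_inv (S \<odot> Y \<odot> S) = R \<odot> op_inv Y \<odot> R"
proof (rule op_inv_eqI)
  have 1: "R \<odot> (S \<odot> Z) = Z" "S \<odot> (R \<odot> Z) = Z" "Y \<odot> (op_inv Y \<odot> Z) = Z" "op_inv Y \<odot> (Y \<odot> Z) = Z" for Z :: "'a op"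
    by (simp_all only: comp_op_assoc[symmetric] RS op_inv[OF Y] comp_op_simps(8))
  show "R \<odot> op_inv Y \<odot> R \<in> bounded_ops" by (intro bounded_ops_compose R op_inv Y)
  show "S \<odot> Y \<odot> S \<odot> (R \<odot> op_inv Y \<odot> R) = one_op" "R \<odot> op_inv Y \<odot> R \<odot> (S \<odot> Y \<odot> S) = one_op"
    by (simp_all only: comp_op_assoc 1 RS)
qed

text \<open>Kept apart from the limit in \<open>mean_of\<close> because the formula is also used
  with \<open>B\<close> merely positive, where it agrees with the extension as long as
  \<open>A\<close> is invertible.\<close>

definition imean :: "(real \<Rightarrow> real) \<Rightarrow> 'a::chilbert_space op \<Rightarrow> 'a op \<Rightarrow> 'a op" where
  "imean h A B = fun_calc sqrt A \<odot> fun_calc h (op_inv (fun_calc sqrt A) \<odot> B \<odot> op_inv (fun_calc sqrt A)) \<odot> fun_calc sqrt A"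

lemma mean_of_eq: "mean_of h = extend_mean (imean h)"
  unfolding mean_of_def imean_def Let_def ..

lemma mean_of_pos_inv: "A \<in> pos_inv_ops \<Longrightarrow> B \<in> pos_inv_ops \<Longrightarrow> mean_of h A B = imean h A B"
  by (simp add: mean_of_eq extend_mean_def)

lemma arith_mean_pos_inv: "A \<in> pos_inv_ops \<Longrightarrow> B \<in> pos_inv_ops \<Longrightarrow> A \<nabla> B = (1/2) *\<^sub>R (A + B)"
  by (simp add: arith_mean_def extend_mean_def)

text \<open>Inside the limit both arguments are shifted by a positive multiple of the identity, so
  the values on invertible operators determine the extension.\<close>

lemma extend_mean_cong:
  assumes m: "\<And>A B. A \<in> pos_inv_ops \<Longrightarrow> B \<in> pos_inv_ops \<Longrightarrow> m A B = m' A B"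
    and A: "A \<in> pos_ops" and B: "B \<in> pos_ops"
  shows "extend_mean m A B = extend_mean m' A B"
proof -
  have "m (A + \<epsilon> *\<^sub>R one_op) (B + \<epsilon> *\<^sub>R one_op) = m' (A + \<epsilon> *\<^sub>R one_op) (B + \<epsilon> *\<^sub>R one_op)" if "\<epsilon> > 0" for \<epsilon>
    using pos_inv_add[OF pos_inv_scalar[OF that] A] pos_inv_add[OF pos_inv_scalar[OF that] B]
    by (intro m) (simp_all add: add.commute)
  hence "((\<lambda>\<epsilon>. blinfun_apply (m (A + \<epsilon> *\<^sub>R one_op) (B + \<epsilon> *\<^sub>R one_op)) x) \<longlongrightarrow> blinfun_apply T x) (at_right 0) \<longleftrightarrow>
      ((\<lambda>\<epsilon>. blinfun_apply (m' (A + \<epsilon> *\<^sub>R one_op) (B + \<epsilon> *\<^sub>R one_op)) x) \<longlongrightarrow> blinfun_apply T x) (at_right 0)" for T x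
    by (intro filterlim_cong refl eventually_mono[OF eventually_at_right_less[of "0::real"]]) simp
  thus ?thesis unfolding extend_mean_def using m by simp
qed

context
  fixes A :: "'a::chilbert_space op"
  assumes A: "A \<in> pos_inv_ops"
begin

private abbreviation "R \<equiv> fun_calc sqrt A"
private abbreviation "S \<equiv> op_inv (fun_calc sqrt A)"

lemma sqrt_op_inverse:
  "R \<in> pos_inv_ops" "S \<in> pos_inv_ops" "sa R" "sa S" "R \<odot> S = one_op" "S \<odot> R = one_op" "R \<odot> R = A" "S \<odot> S = op_inv A"
proof -
  show R: "R \<in> pos_inv_ops" by (rule sqrt_op_pos_inv[OF A])
  show S: "S \<in> pos_inv_ops" by (rule op_inv_pos_inv[OF R])
  show "sa R" "sa S" using R S pos_inv_opsD by blast+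
  note i = op_inv[OF pos_inv_opsD(2)[OF R]]
  show "R \<odot> S = one_op" "S \<odot> R = one_op" by (rule i)+
  show RR: "R \<odot> R = A" by (rule sqrt_op_square[OF pos_inv_opsD(1)[OF A]])
  have 1: "R \<odot> (S \<odot> Z) = Z" "S \<odot> (R \<odot> Z) = Z" for Z :: "'a op"
    by (simp_all only: comp_op_assoc[symmetric] i comp_op_simps(8))
  show "S \<odot> S = op_inv A"
  proof (rule op_inv_eqI[symmetric])
    show "S \<odot> S \<in> bounded_ops" by (intro bounded_ops_compose i)
    have "R \<odot> R \<odot> (S \<odot> S) = one_op" "S \<odot> S \<odot> (R \<odot> R) = one_op"
      by (simp_all only: comp_op_assoc i 1)
    thus "A \<odot> (S \<odot> S) = one_op" "S \<odot> S \<odot> A = one_op" unfolding RR .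
  qed
qed

lemma sqrt_op_cancel: "R \<odot> (S \<odot> Z) = Z" "S \<odot> (R \<odot> Z) = Z" for Z :: "'a op"
  by (simp_all only: comp_op_assoc[symmetric] sqrt_op_inverse comp_op_simps(8))

lemma imean_sandwich: "R \<odot> (S \<odot> Z \<odot> S) \<odot> R = Z" for Z :: "'a op"
  by (simp only: comp_op_assoc sqrt_op_inverse sqrt_op_cancel comp_op_simps(9))

lemma normalized_pos_inv: "B \<in> pos_inv_ops \<Longrightarrow> S \<odot> B \<odot> S \<in> pos_inv_ops"
  by (intro pos_inv_congr sqrt_op_inverse pos_inv_opsD(2))

lemma normalized_pos: "B \<in> pos_ops \<Longrightarrow> S \<odot> B \<odot> S \<in> pos_ops"
  by (intro pos_compose sqrt_op_inverse)

lemma imean_le: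
  assumes B: "B \<in> pos_inv_ops" and f: "continuous_on {0<..} f" and g: "continuous_on {0<..} g"
    and le: "\<And>t. 0 < t \<Longrightarrow> f t \<le> g t"
  shows "imean f A B \<preceq> imean g A B"
proof -
  have X: "S \<odot> B \<odot> S \<in> pos_inv_ops" by (rule normalized_pos_inv[OF B])
  show ?thesis unfolding imean_def
    using pos_inv_spectrum_pos[OF X] by (intro op_le_compose sqrt_op_inverse fun_calc_mono pos_inv_opsD(3) X pos_inv_continuous f g le) auto
qed

lemma imean_mono:
  assumes B: "B \<in> pos_ops" and C: "C \<in> pos_ops" and le: "B \<preceq> C"
    and m: "operator_monotone_on (pos_ops :: 'a op set) h"
  shows "imean h A B \<preceq> imean h A C"
  unfolding imean_def
  by (intro op_le_compose sqrt_op_inverse op_monotone_onD[OF m] normalized_pos B C le)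

lemma imean_affine:
  assumes B: "B \<in> pos_inv_ops"
  shows "imean (\<lambda>t. a + b * t) A B = a *\<^sub>R A + b *\<^sub>R B"
proof -
  let ?X = "S \<odot> B \<odot> S"
  have X: "sa ?X" using normalized_pos_inv[OF B] by (rule pos_inv_opsD)
  have "fun_calc (\<lambda>t. a + b * t) ?X = a *\<^sub>R one_op + b *\<^sub>R ?X"
    using fun_calc_add[OF X, of "\<lambda>t. a" "\<lambda>t. b * t"] fun_calc_scaleR[OF X, of "\<lambda>t. t" b]
    by (simp add: fun_calc_const fun_calc_id X continuous_intros)
  hence "imean (\<lambda>t. a + b * t) A B = a *\<^sub>R (R \<odot> R) + b *\<^sub>R (R \<odot> ?X \<odot> R)"
    unfolding imean_def by (simp add: comp_op_simps)
  thus ?thesis unfolding sqrt_op_inverse imean_sandwich .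
qed

lemma imean_pos_inv:
  assumes B: "B \<in> pos_inv_ops" and h: "continuous_on {0<..} h" and pos: "\<And>t. 0 < t \<Longrightarrow> 0 < h t"
  shows "imean h A B \<in> pos_inv_ops"
proof -
  have X: "S \<odot> B \<odot> S \<in> pos_inv_ops" by (rule normalized_pos_inv[OF B])
  show ?thesis unfolding imean_def
    using pos_inv_spectrum_pos[OF X]
    by (intro pos_inv_congr sqrt_op_inverse pos_inv_opsD(2)[OF sqrt_op_inverse(1)] fun_calc_pos_inv pos_inv_opsD(3) X pos_inv_continuous h pos) auto
qed

lemma op_inv_normalized:
  assumes B: "B \<in> pos_inv_ops"
  shows "op_inv (S \<odot> B \<odot> S) = R \<odot> op_inv B \<odot> R"
  by (intro op_inv_congr sqrt_op_inverse adj_bounded(1)[OF sqrt_op_inverse(3)] pos_inv_opsD(2) B)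

text \<open>Inverting the formula replaces \<open>h\<close> by \<open>1/h\<close> and the outer
  factors \<open>R\<close> by \<open>S\<close>. The congruence by \<open>S\<close> then takes the
  inverses of \<open>1\<close>, \<open>S \<odot> B \<odot> S\<close> and their sum to the inverses
  of \<open>A\<close>, \<open>B\<close> and \<open>A + B\<close>.\<close>

lemma op_inv_imean_le:
  assumes B: "B \<in> pos_inv_ops" and h: "continuous_on {0<..} h" and pos: "\<And>t. 0 < t \<Longrightarrow> 0 < h t"
    and le: "\<And>t. 0 < t \<Longrightarrow> 1 / h t \<le> c * (1 + 1 / t) + K * (1 / (1 + t))"
  shows "op_inv (imean h A B) \<preceq> c *\<^sub>R (op_inv A + op_inv B) + K *\<^sub>R op_inv (A + B)"
proof -
  let ?X = "S \<odot> B \<odot> S"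
  have X: "?X \<in> pos_inv_ops" by (rule normalized_pos_inv[OF B])
  note sX = pos_inv_opsD(3)[OF X] and px = pos_inv_spectrum_pos[OF X]
  have hX: "fun_calc h ?X \<in> pos_inv_ops"
    using px by (intro fun_calc_pos_inv sX pos_inv_continuous[OF X h] pos) auto
  have s1: "op_inv (imean h A B) = S \<odot> op_inv (fun_calc h ?X) \<odot> S"
    unfolding imean_def by (intro op_inv_congr sqrt_op_inverse adj_bounded(1)[OF sqrt_op_inverse(4)] pos_inv_opsD(2) hX)
  have s2: "op_inv (fun_calc h ?X) = fun_calc (\<lambda>t. 1 / h t) ?X"
    using px pos by (intro op_inv_fun_calc sX pos_inv_continuous[OF X h]) (auto simp: less_imp_neq[symmetric])
  have s3: "S \<odot> fun_calc (\<lambda>t. 1 / h t) ?X \<odot> S \<preceq> S \<odot> fun_calc (\<lambda>t. c * (1 + 1 / t) + K * (1 / (1 + t))) ?X \<odot> S"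
  proof (intro op_le_compose sqrt_op_inverse fun_calc_mono sX pos_inv_continuous[OF X])
    show "continuous_on {0<..} (\<lambda>t. 1 / h t)" using pos h by (intro continuous_intros) (auto simp: less_imp_neq[symmetric])
    show "continuous_on {0<..} (\<lambda>t::real. c * (1 + 1 / t) + K * (1 / (1 + t)))" by (intro continuous_intros) auto
    show "1 / h t \<le> c * (1 + 1 / t) + K * (1 / (1 + t))" if "t \<in> real_spectrum ?X" for t
      by (rule le) (use px that in auto)
  qed
  have s4: "fun_calc (\<lambda>t. c * (1 + 1 / t) + K * (1 / (1 + t))) ?X
      = c *\<^sub>R (one_op + op_inv ?X) + K *\<^sub>R op_inv (one_op + ?X)"
  proof -
    have c1: "continuous_on (real_spectrum ?X) (\<lambda>t. 1 / t)" "continuous_on (real_spectrum ?X) (\<lambda>t. 1 / (1 + t))"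
      by (auto intro!: pos_inv_continuous[OF X] continuous_intros)
    have c2: "continuous_on (real_spectrum ?X) (\<lambda>t. 1 + 1 / t)" using continuous_on_add[OF continuous_on_const c1(1)] .
    have e1: "fun_calc (\<lambda>t. 1 + 1 / t) ?X = one_op + op_inv ?X"
      using fun_calc_add[OF sX continuous_on_const c1(1), of 1]
      by (simp add: fun_calc_const[OF sX] op_inv_eq_fun_calc[OF X])
    have "fun_calc (\<lambda>t. 1 + t) ?X = one_op + ?X"
      using fun_calc_add[OF sX continuous_on_const continuous_on_id, of 1]
      by (simp add: fun_calc_const[OF sX] fun_calc_id[OF sX])
    hence e2: "fun_calc (\<lambda>t. 1 / (1 + t)) ?X = op_inv (one_op + ?X)"
      using op_inv_fun_calc[OF sX, of "\<lambda>t. 1 + t"] px by (force intro: continuous_intros)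
    show ?thesis
      using fun_calc_add[OF sX continuous_on_mult[OF continuous_on_const c2]
          continuous_on_mult[OF continuous_on_const c1(2)], of c K]
      unfolding fun_calc_scaleR[OF sX c2] fun_calc_scaleR[OF sX c1(2)] e1 e2 .
  qed
  have s5: "S \<odot> (c *\<^sub>R (one_op + op_inv ?X) + K *\<^sub>R op_inv (one_op + ?X)) \<odot> S
      = c *\<^sub>R (S \<odot> S + S \<odot> op_inv ?X \<odot> S) + K *\<^sub>R (S \<odot> op_inv (one_op + ?X) \<odot> S)"
    by (simp add: comp_op_simps)
  have s6: "S \<odot> op_inv ?X \<odot> S = op_inv B"
    unfolding op_inv_normalized[OF B] by (simp only: comp_op_assoc sqrt_op_inverse sqrt_op_cancel comp_op_simps(9))
  have s7: "S \<odot> op_inv (one_op + ?X) \<odot> S = op_inv (R \<odot> (one_op + ?X) \<odot> R)"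
    by (intro op_inv_congr[symmetric] sqrt_op_inverse adj_bounded(1)[OF sqrt_op_inverse(4)] pos_inv_opsD(2) pos_inv_add pos_inv_one pos_inv_opsD(1)[OF X])
  have s8: "R \<odot> (one_op + ?X) \<odot> R = R \<odot> R + R \<odot> ?X \<odot> R"
    by (simp only: comp_op_simps(2,3,8,9))
  show ?thesis using s3 unfolding s1 s2 s4 s5 s6 s7 s8 sqrt_op_inverse imean_sandwich .
qed

lemma imean_harmonic:
  assumes B: "B \<in> pos_inv_ops" and h: "\<And>t. 0 < t \<Longrightarrow> h t = 2 * t / (1 + t)"
  shows "imean h A B = op_inv ((1/2) *\<^sub>R (op_inv A + op_inv B))"
proof -
  let ?X = "S \<odot> B \<odot> S"
  have X: "?X \<in> pos_inv_ops" by (rule normalized_pos_inv[OF B])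
  note sX = pos_inv_opsD(3)[OF X] and px = pos_inv_spectrum_pos[OF X]
  define Y where "Y = (1/2) *\<^sub>R (one_op + op_inv ?X)"
  have Y: "Y \<in> pos_inv_ops" unfolding Y_def
    by (intro pos_inv_scaleR pos_inv_add pos_inv_one pos_inv_opsD(1) op_inv_pos_inv X) simp
  have c1: "continuous_on (real_spectrum ?X) (\<lambda>t. 1 / t)"
    by (auto intro!: pos_inv_continuous[OF X] continuous_intros)
  have "fun_calc (\<lambda>t. 1 + 1 / t) ?X = one_op + op_inv ?X"
    using fun_calc_add[OF sX continuous_on_const c1, of 1]
    by (simp add: fun_calc_const[OF sX] op_inv_eq_fun_calc[OF X])
  hence eY: "fun_calc (\<lambda>t. (1/2) * (1 + 1 / t)) ?X = Y"
    using fun_calc_scaleR[OF sX, of "\<lambda>t. 1 + 1 / t" "1/2"] c1 by (simp add: Y_def continuous_intros)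
  have "fun_calc h ?X = fun_calc (\<lambda>t. 1 / ((1/2) * (1 + 1 / t))) ?X"
  proof (rule fun_calc_cong)
    fix t assume "t \<in> real_spectrum ?X"
    hence "t > 0" using px by auto
    thus "h t = 1 / ((1/2) * (1 + 1 / t))" by (simp add: h field_simps)
  qed
  also have "\<dots> = op_inv Y" unfolding eY[symmetric]
    using c1 px by (intro op_inv_fun_calc[symmetric] sX) (force simp: field_simps intro!: continuous_intros)+
  finally have "imean h A B = R \<odot> op_inv Y \<odot> R" by (simp add: imean_def)
  also have "\<dots> = op_inv (S \<odot> Y \<odot> S)"
    by (intro op_inv_congr[symmetric] sqrt_op_inverse adj_bounded(1)[OF sqrt_op_inverse(3)] pos_inv_opsD(2) Y)
  finally have s1: "imean h A B = op_inv (S \<odot> Y \<odot> S)" .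
  have s2: "S \<odot> Y \<odot> S = (1/2) *\<^sub>R (S \<odot> S + S \<odot> op_inv ?X \<odot> S)" by (simp add: Y_def comp_op_simps)
  have s3: "S \<odot> op_inv ?X \<odot> S = op_inv B"
    unfolding op_inv_normalized[OF B] by (simp only: comp_op_assoc sqrt_op_inverse sqrt_op_cancel comp_op_simps(9))
  show ?thesis unfolding s1 s2 s3 sqrt_op_inverse ..
qed

text \<open>The Riccati equation characterises the geometric mean: conjugated by \<open>S\<close> it
  says that \<open>S \<odot> G \<odot> S\<close> is the positive root of
  \<open>S \<odot> B \<odot> S\<close>.\<close>

lemma imean_sqrt_unique:
  assumes G: "G \<in> pos_ops" and eq: "G \<odot> op_inv A \<odot> G = B"
  shows "imean sqrt A B = G"
proof -
  have "S \<odot> B \<odot> S = (S \<odot> G \<odot> S) \<odot> (S \<odot> G \<odot> S)"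
    unfolding eq[symmetric] sqrt_op_inverse(8)[symmetric] by (simp only: comp_op_assoc)
  hence "fun_calc sqrt (S \<odot> B \<odot> S) = S \<odot> G \<odot> S" using sqrt_op_unique[OF normalized_pos[OF G]] by simp
  thus ?thesis by (simp only: imean_def imean_sandwich)
qed

lemma imean_sqrt_eq:
  assumes B: "B \<in> pos_ops"
  shows "imean sqrt A B \<odot> op_inv A \<odot> imean sqrt A B = B"
proof -
  let ?X = "S \<odot> B \<odot> S"
  have "imean sqrt A B \<odot> op_inv A \<odot> imean sqrt A B = R \<odot> (fun_calc sqrt ?X \<odot> fun_calc sqrt ?X) \<odot> R"
    unfolding imean_def sqrt_op_inverse(8)[symmetric] by (simp only: comp_op_assoc sqrt_op_cancel)
  thus ?thesis unfolding sqrt_op_square[OF normalized_pos[OF B]] imean_sandwich .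
qed

end

text \<open>Inverting and rearranging the Riccati equation for \<open>(A, B)\<close> gives the one
  for \<open>(B, A)\<close> with the same \<open>G\<close>.\<close>

lemma imean_sqrt_commute:
  fixes A B :: "'a::chilbert_space op"
  assumes A: "A \<in> pos_inv_ops" and B: "B \<in> pos_inv_ops"
  shows "imean sqrt A B = imean sqrt B A"
proof -
  define G where "G = imean sqrt A B"
  have G: "G \<in> pos_inv_ops" unfolding G_def by (rule imean_pos_inv[OF A B]) (auto intro!: continuous_intros)
  have eq: "G \<odot> op_inv A \<odot> G = B" unfolding G_def by (rule imean_sqrt_eq[OF A pos_inv_opsD(1)[OF B]])
  note Gi = op_inv[OF pos_inv_opsD(2)[OF G]]
  have GG: "G \<odot> (op_inv G \<odot> Z) = Z" "op_inv G \<odot> (G \<odot> Z) = Z" for Z :: "'a op"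
    by (simp_all only: comp_op_assoc[symmetric] Gi comp_op_simps(8))
  have "op_inv B = op_inv G \<odot> op_inv (op_inv A) \<odot> op_inv G"
    unfolding eq[symmetric]
    by (intro op_inv_congr Gi pos_inv_opsD(2) op_inv_pos_inv A)
  also have "op_inv (op_inv A) = A" by (intro op_inv_inv pos_inv_opsD(2) adj_bounded(1)[OF pos_inv_opsD(3)] A)
  finally have "G \<odot> op_inv B \<odot> G = A" by (simp only: comp_op_assoc GG Gi comp_op_simps(9))
  from imean_sqrt_unique[OF B pos_inv_opsD(1)[OF G] this] show ?thesis unfolding G_def ..
qed

lemma imean_scalar_left:
  assumes a: "a > 0"
  shows "imean h (a *\<^sub>R one_op) B = a *\<^sub>R fun_calc h ((1 / a) *\<^sub>R B)"
proof -
  have "fun_calc sqrt (a *\<^sub>R one_op :: 'a op) = sqrt a *\<^sub>R one_op" by (rule fun_calc_scalar)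
  thus ?thesis using a unfolding imean_def by (simp add: op_inv_scalar comp_op_simps real_sqrt_mult_self)
qed

text \<open>If \<open>\<surd>B \<le> \<surd>A\<close> failed, an approximate eigenvector of \<open>\<surd>B - \<surd>A\<close> for the top of its
  spectrum would satisfy \<open>\<parallel>\<surd>B x\<parallel> > \<parallel>\<surd>A x\<parallel>\<close>.\<close>

lemma operator_monotone_sqrt: "operator_monotone_on (pos_ops :: 'a::chilbert_space op set) sqrt"
  unfolding operator_monotone_on_def
proof (intro ballI impI)
  fix A B :: "'a op" assume A: "A \<in> pos_ops" and B: "B \<in> pos_ops" and le: "B \<preceq> A"
  define S T where "S = fun_calc sqrt A" and "T = fun_calc sqrt B"
  have S: "S \<in> pos_ops" "sa S" "S \<odot> S = A" and T: "T \<in> pos_ops" "sa T" "T \<odot> T = B"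
    using A B by (simp_all add: S_def T_def sqrt_op_pos pos_ops_sa sqrt_op_square)
  have nrm: "(norm (T x))\<^sup>2 \<le> (norm (S x))\<^sup>2" for x
  proof -
    have "inner (T x) (T x) = inner x (B x)" "inner (S x) (S x) = inner x (A x)"
      using adj_inner[OF S(2), of x "S x"] adj_inner[OF T(2), of x "T x"] S(3) T(3)
      by (metis blinfun_apply_blinfun_compose)+
    thus ?thesis using op_leD[OF le, of x] by (simp add: power2_norm_eq_inner)
  qed
  define D where "D = T - S"
  have D: "sa D" unfolding D_def by (intro adj_diff S T)
  have "inner x (D x) \<le> 0" for x
  proof (rule ccontr)
    assume "\<not> inner x (D x) \<le> 0"
    then obtain l where l: "l > 0" "l \<in> real_spectrum D" using spectrum_top[OF D, of x] by auto
    \<comment> \<open>Both error terms together are at most \<open>(2 * norm S + 2 * l) * c\<close>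
      times the squared norm of \<open>y\<close>. This choice makes them half of the main
      term.\<close>
    define c where "c = l\<^sup>2 / (2 * (2 * norm S + 2 * l))"
    have c: "c > 0" using l by (simp add: c_def add_nonneg_pos)
    then obtain y where y: "norm (D y - l *\<^sub>R y) < c * norm y"
      using l(2) in_spectrum_iff[OF D, of l] by (metis not_less)
    define w where "w = D y - l *\<^sub>R y"
    have "norm y > 0" using y c by (metis mult_zero_right norm_ge_zero not_less order_le_less zero_less_norm_iff)
    have "T y = S y + (l *\<^sub>R y + w)" by (simp add: D_def w_def blinfun.diff_left)
    hence "(norm (T y))\<^sup>2 = (norm (S y))\<^sup>2 + 2 * l * inner y (S y) + 2 * inner (S y) w
        + l\<^sup>2 * (norm y)\<^sup>2 + 2 * l * inner y w + (norm w)\<^sup>2"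
      by (simp add: power2_norm_eq_inner inner_add inner_commute) (simp add: power2_eq_square algebra_simps)
    hence "l\<^sup>2 * (norm y)\<^sup>2 + 2 * l * inner y (S y) + (norm w)\<^sup>2 \<le> - 2 * inner (S y) w - 2 * l * inner y w"
      using nrm[of y] by linarith
    moreover have "2 * l * inner y (S y) \<ge> 0" using l pos_ops_inner[OF S(1)] by simp
    moreover have "(norm w)\<^sup>2 \<ge> 0" by simp
    moreover have "- inner (S y) w \<le> norm S * norm y * (c * norm y)"
    proof -
      have "- inner (S y) w \<le> norm (S y) * norm w" using Cauchy_Schwarz_ineq2[of "S y" w] by linarith
      also have "\<dots> \<le> (norm S * norm y) * (c * norm y)"
        using y by (intro mult_mono norm_blinfun) (auto simp: w_def)
      finally show ?thesis .
    qed
    moreover have "- (l * inner y w) \<le> l * (norm y * (c * norm y))"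
    proof -
      have "- inner y w \<le> norm y * norm w" using Cauchy_Schwarz_ineq2[of y w] by linarith
      also have "\<dots> \<le> norm y * (c * norm y)" using y by (intro mult_left_mono) (auto simp: w_def)
      finally show ?thesis using l mult_left_mono[of "- inner y w" "norm y * (c * norm y)" l] by simp
    qed
    ultimately have "l\<^sup>2 * (norm y)\<^sup>2 \<le> 2 * (norm S * norm y * (c * norm y)) + 2 * (l * (norm y * (c * norm y)))"
      by linarith
    also have "\<dots> = (2 * norm S + 2 * l) * c * (norm y)\<^sup>2" by (simp add: power2_eq_square algebra_simps)
    also have "(2 * norm S + 2 * l) * c = l\<^sup>2 / 2"
    proof -
      have "x * (l\<^sup>2 / (2 * x)) = l\<^sup>2 / 2" if "x > 0" for x :: real using that by simp
      from this[of "2 * norm S + 2 * l"] show ?thesis using l by (simp add: c_def add_nonneg_pos)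
    qed
    finally show False using \<open>norm y > 0\<close> l by (simp add: field_simps)
  qed
  hence "T \<preceq> S" using S(2) T(2) by (intro op_leI) (simp_all add: D_def blinfun.diff_left inner_diff_right)
  thus "fun_calc sqrt B \<preceq> fun_calc sqrt A" by (simp add: S_def T_def)
qed

text \<open>Convergence itself bounds the norms eventually by \<open>norm A + 1\<close>, so only a
  common lower bound is missing for a compact interval containing all spectra.\<close>

lemma fun_calc_tendsto_bounded_below:
  fixes A :: "'a::chilbert_space op"
  assumes X: "(X \<longlongrightarrow> A) F" and A: "sa A" "\<And>x. l * (norm x)\<^sup>2 \<le> inner x (A x)"
    and f: "continuous_on {l..} f"
    and ev: "eventually (\<lambda>n. sa (X n) \<and> (\<forall>x. l * (norm x)\<^sup>2 \<le> inner x (blinfun_apply (X n) x))) F"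
  shows "((\<lambda>n. fun_calc f (X n)) \<longlongrightarrow> fun_calc f A) F"
proof (rule fun_calc_tendsto[where K = "{l..norm A + 1}", OF X A(1)])
  have sp: "real_spectrum Y \<subseteq> {l..norm A + 1}"
    if "sa Y" "\<And>x. l * (norm x)\<^sup>2 \<le> inner x (Y x)" "norm Y \<le> norm A + 1" for Y :: "'a op"
  proof (rule real_spectrum_subset_form[OF that(1,2)])
    fix x
    have "inner x (Y x) \<le> norm Y * (norm x)\<^sup>2" using inner_op_le_norm[of x Y] by linarith
    also have "\<dots> \<le> (norm A + 1) * (norm x)\<^sup>2" using that(3) by (intro mult_right_mono) auto
    finally show "inner x (Y x) \<le> (norm A + 1) * (norm x)\<^sup>2" .
  qed
  show "real_spectrum A \<subseteq> {l..norm A + 1}" by (rule sp[OF A]) simp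
  show "continuous_on {l..norm A + 1} f" by (rule continuous_on_subset[OF f]) auto
  have "\<forall>\<^sub>F n in F. norm (X n) < norm A + 1"
    by (rule order_tendstoD(2)[OF tendsto_norm[OF X]]) simp
  with ev show "\<forall>\<^sub>F n in F. sa (X n) \<and> real_spectrum (X n) \<subseteq> {l..norm A + 1}"
    by eventually_elim (use sp in auto)
qed auto

section \<open>Means of operators that need not be invertible\<close>

lemma tendsto_add_scalar: "((\<lambda>\<epsilon>. A + \<epsilon> *\<^sub>R one_op) \<longlongrightarrow> A) (at_right 0)"
  for A :: "'a::chilbert_space op"
proof -
  have "((\<lambda>\<epsilon>::real. A + \<epsilon> *\<^sub>R one_op) \<longlongrightarrow> A + 0 *\<^sub>R one_op) (at_right 0)" by (intro tendsto_intros)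
  thus ?thesis by simp
qed

lemma form_add_scalar:
  fixes A :: "'a::chilbert_space op"
  assumes "\<epsilon> > 0" "l * (norm x)\<^sup>2 \<le> inner x (A x)"
  shows "l * (norm x)\<^sup>2 \<le> inner x ((A + \<epsilon> *\<^sub>R one_op) x)"
  using assms by (simp add: blinfun.bilinear_simps inner_add_right add_increasing2)

text \<open>Invertibility of \<open>A\<close> keeps its inverse square root continuous, and
  continuity of \<open>h\<close> at 0 takes care of a singular \<open>B\<close>; the limit therefore
  exists even in norm. Writing the inverse root as the function \<open>1 / sqrt t\<close> makes it
  accessible to the continuity of the functional calculus.\<close>

lemma imean_tendsto:
  fixes A B :: "'a::chilbert_space op"
  assumes A: "A \<in> pos_inv_ops" and B: "B \<in> pos_ops" and h: "continuous_on {0..} h"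
  shows "((\<lambda>\<epsilon>. imean h (A + \<epsilon> *\<^sub>R one_op) (B + \<epsilon> *\<^sub>R one_op)) \<longlongrightarrow> imean h A B) (at_right 0)"
proof -
  obtain l where l: "l > 0" "\<And>x. l * (norm x)\<^sup>2 \<le> inner x (A x)" using A by (rule pos_inv_opsE) blast
  have sA: "sa A" using A by (rule pos_inv_opsD)
  have sq: "continuous_on {l..} sqrt" "continuous_on {l..} (\<lambda>t. 1 / sqrt t)"
    using l by (auto intro!: continuous_intros)
  have ev: "\<forall>\<^sub>F \<epsilon> in at_right 0. sa (A + \<epsilon> *\<^sub>R one_op) \<and> (\<forall>x. l * (norm x)\<^sup>2 \<le> inner x ((A + \<epsilon> *\<^sub>R one_op) x))"
    using eventually_at_right_less[of "0::real"]
    by eventually_elim (use l(2) sA in \<open>blast intro: adj_add adj_scaleR adj_one form_add_scalar\<close>)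
  have inv_sqrt: "op_inv (fun_calc sqrt Y) = fun_calc (\<lambda>t. 1 / sqrt t) Y" if "Y \<in> pos_inv_ops" for Y :: "'a op"
    using pos_inv_spectrum_pos[OF that]
    by (intro op_inv_fun_calc pos_inv_opsD that) (auto intro!: continuous_intros)
  have piA: "A + \<epsilon> *\<^sub>R one_op \<in> pos_inv_ops" if "\<epsilon> > 0" for \<epsilon>
    by (rule pos_inv_add[OF A]) (use that in \<open>simp add: pos_ops_scalar\<close>)
  define T where "T Y = fun_calc (\<lambda>t. 1 / sqrt t) Y" for Y :: "'a op"
  have R: "((\<lambda>\<epsilon>. fun_calc sqrt (A + \<epsilon> *\<^sub>R one_op)) \<longlongrightarrow> fun_calc sqrt A) (at_right 0)"
    by (rule fun_calc_tendsto_bounded_below[OF tendsto_add_scalar sA l(2) sq(1) ev])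
  have S: "((\<lambda>\<epsilon>. T (A + \<epsilon> *\<^sub>R one_op)) \<longlongrightarrow> T A) (at_right 0)"
    unfolding T_def by (rule fun_calc_tendsto_bounded_below[OF tendsto_add_scalar sA l(2) sq(2) ev])
  define X where "X \<epsilon> = T (A + \<epsilon> *\<^sub>R one_op) \<odot> (B + \<epsilon> *\<^sub>R one_op) \<odot> T (A + \<epsilon> *\<^sub>R one_op)" for \<epsilon> :: real
  have X: "(X \<longlongrightarrow> T A \<odot> B \<odot> T A) (at_right 0)"
    unfolding X_def by (intro tendsto_comp_op S tendsto_add_scalar)
  have TA: "T A = op_inv (fun_calc sqrt A)" by (simp add: T_def inv_sqrt[OF A])
  have pX: "T A \<odot> B \<odot> T A \<in> pos_ops" unfolding TA by (rule normalized_pos[OF A B])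
  have pX': "X \<epsilon> \<in> pos_ops" if "\<epsilon> > 0" for \<epsilon>
    using normalized_pos[OF piA[OF that] pos_ops_add[OF B pos_ops_scalar]] that
    by (simp add: X_def T_def inv_sqrt[OF piA[OF that]])
  have hX: "((\<lambda>\<epsilon>. fun_calc h (X \<epsilon>)) \<longlongrightarrow> fun_calc h (T A \<odot> B \<odot> T A)) (at_right 0)"
  proof (rule fun_calc_tendsto_bounded_below[OF X pos_ops_sa[OF pX] _ h])
    show "0 * (norm x)\<^sup>2 \<le> inner x ((T A \<odot> B \<odot> T A) x)" for x using pos_ops_inner[OF pX, of x] by simp
    show "\<forall>\<^sub>F \<epsilon> in at_right 0. sa (X \<epsilon>) \<and> (\<forall>x. 0 * (norm x)\<^sup>2 \<le> inner x (blinfun_apply (X \<epsilon>) x))"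
      using eventually_at_right_less[of "0::real"]
      by eventually_elim (use pX' in \<open>simp add: pos_ops_iff\<close>)
  qed
  have "((\<lambda>\<epsilon>. fun_calc sqrt (A + \<epsilon> *\<^sub>R one_op) \<odot> fun_calc h (X \<epsilon>) \<odot> fun_calc sqrt (A + \<epsilon> *\<^sub>R one_op))
      \<longlongrightarrow> imean h A B) (at_right 0)"
    unfolding imean_def TA[symmetric] by (intro tendsto_comp_op R hX)
  moreover have "\<forall>\<^sub>F \<epsilon> in at_right 0. fun_calc sqrt (A + \<epsilon> *\<^sub>R one_op) \<odot> fun_calc h (X \<epsilon>) \<odot> fun_calc sqrt (A + \<epsilon> *\<^sub>R one_op)
      = imean h (A + \<epsilon> *\<^sub>R one_op) (B + \<epsilon> *\<^sub>R one_op)"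
    using eventually_at_right_less[of "0::real"]
    by eventually_elim (simp add: imean_def X_def T_def inv_sqrt[OF piA])
  ultimately show ?thesis by (rule Lim_transform_eventually)
qed

lemma extend_mean_limit:
  fixes A B :: "'a::chilbert_space op"
  assumes "\<not> (A \<in> pos_inv_ops \<and> B \<in> pos_inv_ops)"
    and lim: "((\<lambda>\<epsilon>. m (A + \<epsilon> *\<^sub>R one_op) (B + \<epsilon> *\<^sub>R one_op)) \<longlongrightarrow> T) (at_right (0::real))"
  shows "extend_mean m A B = T"
proof -
  have l: "((\<lambda>\<epsilon>. blinfun_apply (m (A + \<epsilon> *\<^sub>R one_op) (B + \<epsilon> *\<^sub>R one_op)) x) \<longlongrightarrow> T x) (at_right (0::real))" for x
    by (rule tendsto_blinfun_apply[OF lim])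
  have "extend_mean m A B = (THE T. \<forall>x. ((\<lambda>\<epsilon>::real. blinfun_apply
              (m (A + \<epsilon> *\<^sub>R one_op) (B + \<epsilon> *\<^sub>R one_op)) x) \<longlongrightarrow> blinfun_apply T x) (at_right 0))"
    unfolding extend_mean_def using assms(1) by (rule if_not_P)
  also have "\<dots> = T"
  proof (rule the_equality)
    fix T' assume *: "\<forall>x. ((\<lambda>\<epsilon>::real. blinfun_apply (m (A + \<epsilon> *\<^sub>R one_op) (B + \<epsilon> *\<^sub>R one_op)) x)
        \<longlongrightarrow> blinfun_apply T' x) (at_right 0)"
    show "T' = T"
    proof (rule blinfun_eqI)
      show "T' x = T x" for x using tendsto_unique[OF _ *[rule_format, of x] l[of x]] by simp
    qed
  qed (use l in blast)
  finally show ?thesis .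
qed

locale symmetric_mean_fun = cuntz V1 V2 W1 W2 for V1 V2 W1 W2 :: "'a::chilbert_space op" +
  fixes h :: "real \<Rightarrow> real"
  assumes h_cont: "continuous_on {0..} h" and h_nonneg: "\<And>t. 0 \<le> t \<Longrightarrow> 0 \<le> h t" and h_1: "h 1 = 1"
    and h_mono: "operator_monotone_on (pos_ops :: 'a op set) h"
    and h_commute: "\<And>A B :: 'a op. A \<in> pos_inv_ops \<Longrightarrow> B \<in> pos_inv_ops \<Longrightarrow> imean h A B = imean h B A"
begin

section \<open>Scalar properties of the representing function\<close>

lemma h_cont': "continuous_on {0<..} h"
  by (rule continuous_on_subset[OF h_cont]) auto

lemma h_mono': "operator_monotone_on (pos_inv_ops :: 'a op set) h"
  using h_mono by (auto simp: operator_monotone_on_def pos_inv_ops_def)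

lemma h_concave:
  "0 < x \<Longrightarrow> 0 < y \<Longrightarrow> 0 \<le> l \<Longrightarrow> l \<le> 1 \<Longrightarrow> l * h x + (1 - l) * h y \<le> h (l * x + (1 - l) * y)"
  by (rule op_monotone_imp_concave_real[OF h_cont' h_mono'])

lemma h_sym: assumes x: "0 < x" shows "x * h (1 / x) = h x"
proof -
  have "imean h (x *\<^sub>R one_op) (1 *\<^sub>R one_op) = imean h (1 *\<^sub>R one_op) (x *\<^sub>R (one_op :: 'a op))"
    using x by (intro h_commute pos_inv_scalar) auto
  thus ?thesis using x by (simp only: imean_scalar_left) (simp add: fun_calc_scalar nontrivial)
qed

lemma h_pos: assumes x: "0 < x" shows "0 < h x"
proof -
  have 1: "0 < h x" if x: "0 < x" "x \<le> 1" for x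
  proof -
    \<comment> \<open>Concavity is available for positive arguments only, so \<open>x\<close> is
      written as a combination of 1 and \<open>x / 2\<close> instead of 1 and 0.\<close>
    define y where "y = x / 2"
    define l where "l = y / (1 - y)"
    have y: "0 < y" "y \<le> 1 / 2" "x = 2 * y" using x by (simp_all add: y_def)
    have l: "0 < l" "l \<le> 1" using y by (simp_all add: l_def)
    have "l * (1 - y) = y" using y by (simp add: l_def)
    hence e: "l * 1 + (1 - l) * y = x" unfolding y(3) by (simp add: algebra_simps)
    have "l * h 1 + (1 - l) * h y \<le> h x" using h_concave[of 1 y l] l y(1) unfolding e by simp
    moreover have "(1 - l) * h y \<ge> 0" using l y h_nonneg[of y] by simp
    ultimately show ?thesis using l by (simp add: h_1)
  qed
  show ?thesis
  proof (cases "x \<le> 1")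
    case False
    hence "0 < x * h (1 / x)" using 1[of "1 / x"] by simp
    thus ?thesis using h_sym[OF x] by simp
  qed (use 1 x in blast)
qed

lemma h_le: "0 < x \<Longrightarrow> h x \<le> (1 + x) / 2"
  by (rule symmetric_concave_le[OF h_concave h_sym h_1])

abbreviation u where "u \<equiv> \<lambda>t. 1 / h (1 / t)"

lemma u_cont: "continuous_on {0<..} u"
proof (intro continuous_on_divide continuous_on_const)
  show "continuous_on {0<..} (\<lambda>t. h (1 / t))"
    by (rule continuous_on_compose2[OF h_cont']) (auto intro!: continuous_intros)
  show "\<forall>x\<in>{0<..}. h (1 / x) \<noteq> 0"
  proof
    fix x :: real assume "x \<in> {0<..}"
    thus "h (1 / x) \<noteq> 0" using h_pos[of "1 / x"] by simp
  qed
qed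

lemma u_concave:
  "0 < x \<Longrightarrow> 0 < y \<Longrightarrow> 0 \<le> l \<Longrightarrow> l \<le> 1 \<Longrightarrow> l * u x + (1 - l) * u y \<le> u (l * x + (1 - l) * y)"
  by (rule op_monotone_imp_concave_real[OF u_cont adjoint_op_monotone[OF h_cont' h_pos h_mono']])

lemma u_sym: assumes x: "0 < x" shows "x * u (1 / x) = u x"
  using h_sym[OF x] h_pos[OF x] h_pos[of "1 / x"] x by (simp add: field_simps)

lemma u_pos: "0 < x \<Longrightarrow> 0 < u x"
  using h_pos[of "1 / x"] by simp

lemma u_1: "u 1 = 1"
  by (simp add: h_1)

text \<open>The upper bound by the arithmetic mean, applied to the adjoint function \<open>u\<close>
  at \<open>1 / x\<close>: every symmetric mean lies above the harmonic one.\<close>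

lemma inverse_h_le: assumes x: "0 < x" shows "1 / h x \<le> (1 + 1 / x) / 2"
  using symmetric_concave_le[OF u_concave u_sym u_1, of "1 / x"] x by simp

text \<open>On this interval the harmonic function \<open>2 t / (1 + t)\<close>, a lower bound for
  \<open>h\<close> at positive arguments, is at least \<open>t\<close>.\<close>

lemma h_ge_id: assumes t: "0 \<le> t" "t \<le> 1" shows "t \<le> h t"
proof (cases "t = 0")
  case False
  hence t0: "t > 0" using t by simp
  have "1 \<le> 1 / t" using t t0 by simp
  moreover have "a \<le> b" if "1 \<le> b" "a \<le> (1 + b) / 2" for a b :: real using that by simp
  ultimately have "1 / h t \<le> 1 / t" using inverse_h_le[OF t0] by blast
  thus ?thesis using h_pos[OF t0] t0 by (simp add: field_simps)
qed (use h_nonneg t in simp)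

text \<open>The bound for the adjoint function \<open>u\<close> read at \<open>1 / x\<close>; there
  \<open>y / (1 + y)\<close> becomes \<open>1 / (1 + x)\<close>, and later the inverse of a
  sum.\<close>

lemma inverse_h_strict:
  assumes x0: "0 < x0" "h x0 \<noteq> 2 * x0 / (1 + x0)"
  shows "\<exists>c K. c < 1 / 2 \<and> 0 \<le> c \<and> 0 \<le> K \<and> (\<forall>x>0. 1 / h x \<le> c * (1 + 1 / x) + K * (1 / (1 + x)))"
proof -
  have "u (1 / x0) \<noteq> (1 + 1 / x0) / 2"
  proof
    assume "u (1 / x0) = (1 + 1 / x0) / 2"
    hence "h x0 = 2 / (1 + 1 / x0)" using h_pos[OF x0(1)] x0(1) by (simp add: field_simps)
    also have "\<dots> = 2 * x0 / (1 + x0)" using x0(1) by (simp add: field_simps)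
    finally show False using x0(2) by simp
  qed
  moreover have "0 < 1 / x0" using x0 by simp
  ultimately obtain c K where cK: "c < 1 / 2" "0 \<le> c" "0 \<le> K" "\<And>y. y > 0 \<Longrightarrow> u y \<le> c * (1 + y) + K * (y / (1 + y))"
    using symmetric_concave_strict[OF u_concave u_sym u_1 u_pos] by blast
  have "1 / h x \<le> c * (1 + 1 / x) + K * (1 / (1 + x))" if x: "x > 0" for x
  proof -
    have "1 / x / (1 + 1 / x) = 1 / (1 + x)" using x by (simp add: field_simps)
    thus ?thesis using cK(4)[of "1 / x"] x by simp
  qed
  thus ?thesis using cK by blast
qed

lemma imean_le_arith:
  assumes A: "A \<in> pos_inv_ops" and B: "(B :: 'a op) \<in> pos_inv_ops"
  shows "imean h A B \<preceq> (1/2) *\<^sub>R (A + B)"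
proof -
  have "imean h A B \<preceq> imean (\<lambda>t. 1/2 + (1/2) * t) A B"
  proof (rule imean_le[OF A B h_cont'])
    show "h t \<le> 1/2 + (1/2) * t" if "0 < t" for t using h_le[OF that] by simp
  qed (intro continuous_intros)
  thus ?thesis unfolding imean_affine[OF A B] by (simp add: scaleR_add_right)
qed

text \<open>Replace \<open>A\<close> by \<open>d\<close> times the identity and \<open>F\<close> by
  \<open>d *\<^sub>R Q\<close>: the mean becomes \<open>d *\<^sub>R fun_calc h Q\<close>, which is
  at least \<open>d *\<^sub>R Q\<close> because the spectrum of \<open>Q\<close> lies in
  \<open>{0..1}\<close>. Monotonicity is at hand in the second argument; commutativity supplies it
  in the first.\<close>

lemma imean_ge:
  assumes A: "(A :: 'a op) \<in> pos_inv_ops" and F: "F \<in> pos_inv_ops" and Q: "Q \<in> pos_ops" "Q \<preceq> one_op"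
    and d: "0 < d" "d *\<^sub>R one_op \<preceq> A" "d *\<^sub>R Q \<preceq> F"
  shows "d *\<^sub>R Q \<preceq> imean h A F"
proof -
  have dI: "d *\<^sub>R one_op \<in> (pos_inv_ops :: 'a op set)" using d by (intro pos_inv_scalar)
  have dQ: "d *\<^sub>R Q \<in> pos_ops" using Q(1) d(1) by (simp add: pos_ops_iff adj_scaleR blinfun.scaleR_left)
  have sQ: "real_spectrum Q \<subseteq> {0..1}"
    using pos_ops_inner[OF Q(1)] op_leD[OF Q(2)]
    by (intro real_spectrum_subset_form pos_ops_sa Q) (auto simp: power2_norm_eq_inner)
  have "fun_calc (\<lambda>t. t) Q \<preceq> fun_calc h Q"
    using sQ h_ge_id by (intro fun_calc_mono pos_ops_sa Q pos_continuous h_cont) (auto intro!: continuous_intros)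
  hence "Q \<preceq> fun_calc h Q" by (simp add: fun_calc_id pos_ops_sa Q)
  hence "d *\<^sub>R Q \<preceq> d *\<^sub>R fun_calc h Q" using d(1) by (intro op_le_scaleR) auto
  also have "d *\<^sub>R fun_calc h Q = imean h (d *\<^sub>R one_op) (d *\<^sub>R Q)"
    using d(1) by (simp add: imean_scalar_left)
  finally have "d *\<^sub>R Q \<preceq> imean h (d *\<^sub>R one_op) (d *\<^sub>R Q)" .
  moreover have "imean h (d *\<^sub>R one_op) (d *\<^sub>R Q) \<preceq> imean h (d *\<^sub>R one_op) F"
    by (rule imean_mono[OF dI dQ pos_inv_opsD(1)[OF F] d(3) h_mono])
  moreover have "imean h (d *\<^sub>R one_op) F = imean h F (d *\<^sub>R one_op)" by (rule h_commute[OF dI F])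
  moreover have "imean h F (d *\<^sub>R one_op) \<preceq> imean h F A"
    by (rule imean_mono[OF F pos_inv_opsD(1)[OF dI] pos_inv_opsD(1)[OF A] d(2) h_mono])
  moreover have "imean h F A = imean h A F" by (rule h_commute[OF F A])
  ultimately show ?thesis by (metis op_le_trans)
qed

text \<open>\<open>F\<close> may be singular: it will be a function \<open>f\<close> of an operator
  one of whose eigenvalues is far from where \<open>f\<close> is known to be positive.\<close>

lemma mean_of_ge:
  assumes A: "(A :: 'a op) \<in> pos_inv_ops" and F: "F \<in> pos_ops" and Q: "Q \<in> pos_ops" "Q \<preceq> one_op"
    and d: "0 < d" "d *\<^sub>R one_op \<preceq> A" "d *\<^sub>R Q \<preceq> F"
  shows "d *\<^sub>R Q \<preceq> mean_of h A F"
proof (cases "F \<in> pos_inv_ops")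
  case True thus ?thesis using imean_ge[OF A True Q d] by (simp add: mean_of_pos_inv A)
next
  case False
  have lim: "((\<lambda>\<epsilon>. imean h (A + \<epsilon> *\<^sub>R one_op) (F + \<epsilon> *\<^sub>R one_op)) \<longlongrightarrow> imean h A F) (at_right 0)"
    by (rule imean_tendsto[OF A F h_cont])
  have eq: "mean_of h A F = imean h A F"
    unfolding mean_of_eq by (rule extend_mean_limit[where m = "imean h", OF _ lim]) (use False in blast)
  show ?thesis unfolding eq
  proof (rule op_le_tendsto[OF tendsto_const lim])
    have grow: "X \<preceq> Y + \<epsilon> *\<^sub>R one_op" if "X \<preceq> Y" "\<epsilon> > 0" for X Y :: "'a op" and \<epsilon>
    proof -
      have "0 \<preceq> \<epsilon> *\<^sub>R (one_op :: 'a op)" using that(2) by (simp add: op_le_def pos_ops_scalar)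
      from op_le_add[OF that(1) this] show ?thesis by simp
    qed
    show "\<forall>\<^sub>F \<epsilon> in at_right 0. d *\<^sub>R Q \<preceq> imean h (A + \<epsilon> *\<^sub>R one_op) (F + \<epsilon> *\<^sub>R one_op)"
      using eventually_at_right_less[of "0::real"]
    proof eventually_elim
      case (elim \<epsilon>)
      have "F + \<epsilon> *\<^sub>R one_op \<in> pos_inv_ops"
        using pos_inv_add[OF pos_inv_scalar[OF elim] F] by (simp add: add.commute)
      moreover have "A + \<epsilon> *\<^sub>R one_op \<in> pos_inv_ops"
        using elim by (intro pos_inv_add A pos_ops_scalar) auto
      ultimately show ?case using d elim by (intro imean_ge Q grow) auto
    qed
  qed simp
qed

end

text \<open>Subtracting the fixed point \<open>C / (1 - q)\<close> of
  \<open>s \<mapsto> q s + C\<close> leaves \<open>H(\<sigma> t) \<le> q H(t)\<close>. Iterating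
  outward gains \<open>q^n\<close>, while quadratic growth costs at most
  \<open>\<sigma>^(-2n)\<close>, so the bound tends to 0.\<close>

lemma scaling_growth_bound:
  fixes G :: "real \<Rightarrow> real"
  assumes sg: "0 < \<sigma>" "\<sigma> < 1" and q: "0 \<le> q" "q < \<sigma>\<^sup>2" and C: "0 \<le> C" and M: "0 \<le> M"
    and le: "\<And>t. 0 \<le> t \<Longrightarrow> G (\<sigma> * t) \<le> q * G t + C"
    and gr: "\<And>t. 0 \<le> t \<Longrightarrow> G t \<le> M * (1 + t)\<^sup>2"
    and t: "0 \<le> t"
  shows "G t \<le> C / (1 - q)"
proof -
  have "\<sigma>\<^sup>2 < 1" using sg by (simp add: power_less_one_iff)
  hence q1: "q < 1" using q by simp
  define H where "H t = G t - C / (1 - q)" for t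
  have HC: "C / (1 - q) = q * (C / (1 - q)) + C" using q1 by (simp add: field_simps)
  have step: "H (\<sigma> * t) \<le> q * H t" if "0 \<le> t" for t
    using le[OF that] HC unfolding H_def right_diff_distrib by linarith
  have iter: "H t \<le> q ^ n * H (t / \<sigma> ^ n)" for n
  proof (induction n)
    case (Suc n)
    have e: "\<sigma> * (t / \<sigma> ^ Suc n) = t / \<sigma> ^ n" using sg by simp
    have "H (t / \<sigma> ^ n) \<le> q * H (t / \<sigma> ^ Suc n)"
      using step[of "t / \<sigma> ^ Suc n"] t sg unfolding e by simp
    hence "q ^ n * H (t / \<sigma> ^ n) \<le> q ^ n * (q * H (t / \<sigma> ^ Suc n))" using q by (intro mult_left_mono) auto
    thus ?case using Suc by (simp add: mult_ac)
  qed simp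
  have "H t \<le> (q / \<sigma>\<^sup>2) ^ n * (M * (1 + t)\<^sup>2)" for n
  proof -
    have s1: "1 \<le> 1 / \<sigma> ^ n" using sg by (simp add: power_le_one)
    have "H (t / \<sigma> ^ n) \<le> G (t / \<sigma> ^ n)" using C q1 by (simp add: H_def)
    also have "\<dots> \<le> M * (1 + t / \<sigma> ^ n)\<^sup>2" using t sg by (intro gr) simp
    also have "\<dots> \<le> M * ((1 / \<sigma> ^ n) * (1 + t))\<^sup>2"
      using M s1 t sg by (intro mult_left_mono power_mono) (auto simp: distrib_left)
    finally have "q ^ n * H (t / \<sigma> ^ n) \<le> q ^ n * (M * ((1 / \<sigma> ^ n) * (1 + t))\<^sup>2)"
      using q by (intro mult_left_mono) auto
    also have "\<dots> = (q / \<sigma>\<^sup>2) ^ n * (M * (1 + t)\<^sup>2)"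
      by (simp add: power_divide power_mult_distrib flip: power_mult) (simp add: mult.commute)
    finally show ?thesis using iter[of n] by linarith
  qed
  moreover have "(\<lambda>n. (q / \<sigma>\<^sup>2) ^ n * (M * (1 + t)\<^sup>2)) \<longlonglongrightarrow> 0 * (M * (1 + t)\<^sup>2)"
    using q sg by (intro tendsto_mult LIMSEQ_realpow_zero tendsto_const) auto
  ultimately have "H t \<le> 0" by (intro LIMSEQ_le_const[where X = "\<lambda>n. (q / \<sigma>\<^sup>2) ^ n * (M * (1 + t)\<^sup>2)"]) auto
  thus ?thesis by (simp add: H_def)
qed

section \<open>Functions that are concave with respect to a symmetric mean\<close>

context cuntz
begin

section \<open>Two-by-two matrices with scalar entries\<close>

lemma dg_diff: "dg a b - dg a' b' = dg (a - a') (b - b')"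
  by (simp add: blk_def comp_op_simps)

lemma dg_pos: "a \<in> pos_ops \<Longrightarrow> b \<in> pos_ops \<Longrightarrow> dg a b \<in> pos_ops"
  by (simp add: pos_ops_iff blk_sa blk_inner)

lemma dg_mono: "a \<preceq> a' \<Longrightarrow> b \<preceq> b' \<Longrightarrow> dg a b \<preceq> dg a' b'"
  by (simp add: op_le_def dg_diff dg_pos)

lemma dg_scalar: "dg (r *\<^sub>R one_op) (r *\<^sub>R one_op) = r *\<^sub>R one_op"
proof -
  have "dg (r *\<^sub>R one_op) (r *\<^sub>R one_op) = r *\<^sub>R (V1 \<odot> W1 + V2 \<odot> W2)"
    by (simp add: blk_def comp_op_simps scaleR_add_right)
  thus ?thesis by (simp only: total)
qed

lemma op_inv_dg_scalar:
  assumes "a \<noteq> 0" "b \<noteq> 0"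
  shows "op_inv (dg (a *\<^sub>R one_op) (b *\<^sub>R one_op)) = dg ((1 / a) *\<^sub>R one_op) ((1 / b) *\<^sub>R one_op)"
proof (rule op_inv_eqI)
  show "dg ((1 / a) *\<^sub>R one_op) ((1 / b) *\<^sub>R one_op) \<in> bounded_ops"
    by (intro adj_bounded(1)[of _ "dg ((1 / a) *\<^sub>R one_op) ((1 / b) *\<^sub>R one_op)"] blk_sa adj_scaleR adj_one)
qed (use assms in \<open>auto intro!: blinfun_eqI simp: blk_apply blinfun.bilinear_simps\<close>)

lemma op_inv_Br_scalar:
  "c\<^sup>2 + s\<^sup>2 = 1 \<Longrightarrow> a \<noteq> 0 \<Longrightarrow> b \<noteq> 0 \<Longrightarrow>
    op_inv (Br c s (a *\<^sub>R one_op) (b *\<^sub>R one_op)) = Br c s ((1 / a) *\<^sub>R one_op) ((1 / b) *\<^sub>R one_op)"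
  unfolding Br_def using cuntz.op_inv_dg_scalar[OF rotate] .

lemma Br_ge_scalar:
  assumes cs: "c\<^sup>2 + s\<^sup>2 = 1" and r: "r \<le> a" "r \<le> b"
  shows "r *\<^sub>R one_op \<preceq> Br c s (a *\<^sub>R one_op) (b *\<^sub>R one_op)"
  using cuntz.dg_mono[OF rotate[OF cs], of "r *\<^sub>R one_op" "a *\<^sub>R one_op" "r *\<^sub>R one_op" "b *\<^sub>R one_op"] r
  by (simp add: cuntz.dg_scalar[OF rotate[OF cs]] scalar_le_iff Br_def)

lemma Br_expand:
  "Br c s (a *\<^sub>R one_op) (b *\<^sub>R one_op) = (c\<^sup>2 * a + s\<^sup>2 * b) *\<^sub>R (V1 \<odot> W1)
     + (c * s * (a - b)) *\<^sub>R (V1 \<odot> W2 + V2 \<odot> W1) + (s\<^sup>2 * a + c\<^sup>2 * b) *\<^sub>R (V2 \<odot> W2)"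
  by (rule blinfun_eqI)
    (simp add: Br_def blk_def blinfun.bilinear_simps power2_eq_square algebra_simps)

lemma dg_expand: "dg (a *\<^sub>R one_op) (b *\<^sub>R one_op) = a *\<^sub>R (V1 \<odot> W1) + b *\<^sub>R (V2 \<odot> W2)"
  by (simp add: blk_def comp_op_simps)

end

text \<open>The hypothesis is stated with the extended mean, because \<open>f\<close> may still
  vanish and the operators \<open>fun_calc f A\<close> may be singular.\<close>

locale mean_concave_fun = symmetric_mean_fun V1 V2 W1 W2 h
  for V1 V2 W1 W2 :: "'a::chilbert_space op" and h +
  fixes f :: "real \<Rightarrow> real"
  assumes f_cont: "continuous_on {0<..} f" and f_nonneg: "\<And>t. 0 < t \<Longrightarrow> 0 \<le> f t"
    and f_mean: "\<And>A B :: 'a op. A \<in> pos_inv_ops \<Longrightarrow> B \<in> pos_inv_ops \<Longrightarrow>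
      mean_of h (fun_calc f A) (fun_calc f B) \<preceq> fun_calc f ((1/2) *\<^sub>R (A + B))"
begin

text \<open>Take \<open>Z\<close> with eigenvalues \<open>z\<close> and \<open>t\<close> in a slightly rotated frame and write it as the
  midpoint of \<open>A\<close> and \<open>B\<close>, where \<open>B\<close> is diagonal and \<open>A\<close> has spectrum close to \<open>z\<close>: then
  \<open>f(A) \<ge> \<delta>\<close> and \<open>f(B) \<ge> \<delta> Q\<close> for a projection \<open>Q\<close> that is not orthogonal to the
  eigenspace of \<open>Z\<close> for \<open>t\<close>.\<close>

lemma f_ge:
  assumes \<eta>: "0 < \<eta>" "\<eta> \<le> z / 4" and \<delta>: "0 < \<delta>"
    and f\<delta>: "\<And>x. z - 3 * \<eta> \<le> x \<Longrightarrow> x \<le> z + 3 * \<eta> \<Longrightarrow> \<delta> \<le> f x" and t: "3 * z / 4 \<le> t"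
  shows "\<delta> * (\<eta> / max t z)\<^sup>2 \<le> f t"
proof -
  have z: "0 < z" using \<eta> by simp
  define M where "M = max t z"
  \<comment> \<open>The sine of the angle. It makes \<open>s\<close> times the distance of
    \<open>t\<close> and \<open>z\<close> at most \<open>\<eta>\<close>, which bounds both the
    off-diagonal entry \<open>p\<close> and the shift of the corner \<open>z11\<close> from
    \<open>z\<close>. It is also where the decay of order \<open>1/t^2\<close> comes from.\<close>
  define s where "s = \<eta> / M"
  define c where "c = sqrt (1 - s\<^sup>2)"
  have M: "M \<ge> z" "M \<ge> t" "M > 0" using z by (auto simp: M_def)
  have s0: "0 < s" using \<eta> M by (simp add: s_def)
  have sM: "s * M = \<eta>" using M by (simp add: s_def)
  have "\<eta> \<le> M / 4" using \<eta> M by linarith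
  hence s4: "s \<le> 1 / 4" using M(3) by (simp add: s_def divide_le_eq)
  have s2: "s\<^sup>2 \<le> 1 / 16" using power_mono[OF s4, of 2] s0 by (simp add: power2_eq_square)
  have c2: "c\<^sup>2 = 1 - s\<^sup>2" using s2 by (simp add: c_def)
  hence cs: "c\<^sup>2 + s\<^sup>2 = 1" by simp
  have c01: "0 \<le> c" "c \<le> 1" using s2 by (simp_all add: c_def)
  define d where "d = t - z"
  have absd: "s * \<bar>d\<bar> \<le> \<eta>"
  proof -
    have "\<bar>d\<bar> \<le> M" using z t by (auto simp: d_def M_def)
    thus ?thesis using mult_left_mono[of "\<bar>d\<bar>" M s] s0 sM by simp
  qed
  define z11 z22 p where "z11 = c\<^sup>2 * z + s\<^sup>2 * t" and "z22 = s\<^sup>2 * z + c\<^sup>2 * t" and "p = c * s * (z - t)"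
  have z11: "z11 = z + s\<^sup>2 * d" and z22: "z22 = z + (1 - s\<^sup>2) * d"
    by (simp_all add: z11_def z22_def c2 d_def algebra_simps)
  have p: "\<bar>p\<bar> \<le> \<eta>"
  proof -
    have "\<bar>p\<bar> = c * (s * \<bar>d\<bar>)" using c01 s0 by (simp add: p_def d_def abs_mult abs_minus_commute)
    also have "\<dots> \<le> 1 * (s * \<bar>d\<bar>)" using c01 s0 by (intro mult_right_mono) auto
    finally show ?thesis using absd by simp
  qed
  have q: "\<bar>s\<^sup>2 * d\<bar> \<le> \<eta>"
  proof -
    have "\<bar>s\<^sup>2 * d\<bar> = s * (s * \<bar>d\<bar>)" using s0 by (simp add: abs_mult power2_eq_square)
    also have "\<dots> \<le> 1 * (s * \<bar>d\<bar>)" using s4 s0 by (intro mult_right_mono) auto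
    finally show ?thesis using absd by simp
  qed
  \<comment> \<open>\<open>A\<close> will have diagonal entries \<open>z11\<close> and off-diagonal
    entries \<open>2 p\<close>: its eigenvalues are \<open>z11 + 2 p\<close> and
    \<open>z11 - 2 p\<close>, in the frame turned by 45 degrees. The entry \<open>m\<close> of the
    diagonal matrix \<open>D\<close> is what \<open>A + D = 2 Z\<close> leaves.\<close>
  define \<alpha> \<beta> m where "\<alpha> = z11 + 2 * p" and "\<beta> = z11 - 2 * p" and "m = 2 * z22 - z11"
  have range: "z - 3 * \<eta> \<le> \<alpha>" "\<alpha> \<le> z + 3 * \<eta>" "z - 3 * \<eta> \<le> \<beta>" "\<beta> \<le> z + 3 * \<eta>"
    "z - 3 * \<eta> \<le> z11" "z11 \<le> z + 3 * \<eta>"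
    using p q \<eta>(1) unfolding \<alpha>_def \<beta>_def z11 by linarith+
  have ppos: "0 < \<alpha>" "0 < \<beta>" "0 < z11" "0 < t" using range \<eta> z t by linarith+
  \<comment> \<open>The only use of the lower bound on \<open>t\<close>: for \<open>t < z\<close> it
    keeps \<open>m\<close> at least \<open>z / 2\<close>.\<close>
  have mpos: "0 < m"
  proof -
    have m: "m = z + (2 - 3 * s\<^sup>2) * d" by (simp add: m_def z11 z22 algebra_simps)
    have "(2 - 3 * s\<^sup>2) * d \<ge> - (z / 2)"
    proof (cases "d \<ge> 0")
      case True
      hence "(2 - 3 * s\<^sup>2) * d \<ge> 0" using s2 by simp
      thus ?thesis using z by linarith
    next
      case False
      have "(2 - 3 * s\<^sup>2) * (- d) \<le> 2 * (- d)" using False by (intro mult_right_mono) auto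
      moreover have "- d \<le> z / 4" using t by (simp add: d_def)
      ultimately show ?thesis by simp
    qed
    thus ?thesis using z unfolding m by linarith
  qed
  define r :: real where "r = sqrt (1 / 2)"
  have r2: "r\<^sup>2 = 1 / 2" by (simp add: r_def)
  hence rr: "r\<^sup>2 + r\<^sup>2 = 1" "r * r = 1 / 2" by (simp_all add: power2_eq_square)
  define A where "A = Br r r (\<alpha> *\<^sub>R one_op) (\<beta> *\<^sub>R one_op)"
  define D where "D = dg (z11 *\<^sub>R one_op) (m *\<^sub>R one_op)"
  define Z where "Z = Br c s (z *\<^sub>R one_op) (t *\<^sub>R one_op)"
  have "A = z11 *\<^sub>R (V1 \<odot> W1) + (2 * p) *\<^sub>R (V1 \<odot> W2 + V2 \<odot> W1) + z11 *\<^sub>R (V2 \<odot> W2)"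
    unfolding A_def Br_expand r2 rr(2) by (simp add: \<alpha>_def \<beta>_def field_simps)
  moreover have "D = z11 *\<^sub>R (V1 \<odot> W1) + m *\<^sub>R (V2 \<odot> W2)" by (simp add: D_def dg_expand)
  moreover have "Z = z11 *\<^sub>R (V1 \<odot> W1) + p *\<^sub>R (V1 \<odot> W2 + V2 \<odot> W1) + z22 *\<^sub>R (V2 \<odot> W2)"
    by (simp add: Z_def Br_expand z11_def z22_def p_def)
  ultimately have "A + D = 2 *\<^sub>R Z"
    by (simp only: m_def mult_2 scaleR_2 scaleR_left_distrib scaleR_left_diff_distrib) simp
  hence AD: "(1/2) *\<^sub>R (A + D) = Z" by simp
  have Ap: "A \<in> pos_inv_ops" unfolding A_def by (intro Br_pos_inv rr pos_inv_scalar ppos)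
  have Dp: "D \<in> pos_inv_ops" unfolding D_def by (intro blk_pos_inv pos_inv_scalar ppos mpos)
  have fA: "fun_calc f A = Br r r (f \<alpha> *\<^sub>R one_op) (f \<beta> *\<^sub>R one_op)"
    unfolding A_def by (subst fun_calc_Br[OF rr(1)]) (auto intro!: pos_inv_scalar ppos f_cont simp: fun_calc_scalar)
  have fD: "fun_calc f D = dg (f z11 *\<^sub>R one_op) (f m *\<^sub>R one_op)"
    unfolding D_def by (subst fun_calc_blk) (auto intro!: pos_inv_scalar ppos mpos f_cont simp: fun_calc_scalar)
  have fZ: "fun_calc f Z = Br c s (f z *\<^sub>R one_op) (f t *\<^sub>R one_op)"
    unfolding Z_def by (subst fun_calc_Br[OF cs]) (auto intro!: pos_inv_scalar ppos z f_cont simp: fun_calc_scalar)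
  \<comment> \<open>The projection onto the first copy. Only this entry of \<open>D\<close> is close
    to \<open>z\<close>; at \<open>m\<close> nothing but nonnegativity of \<open>f\<close> is
    known.\<close>
  define Q where "Q = dg one_op 0"
  have Q: "Q \<in> pos_ops" "Q \<preceq> one_op"
  proof -
    show "Q \<in> pos_ops" unfolding Q_def
      using dg_pos[of one_op 0] pos_ops_scalar[of 1] pos_ops_scalar[of 0] by simp
    show "Q \<preceq> one_op" unfolding Q_def
      using dg_mono[OF op_le_refl[of one_op], of 0 one_op] dg_scalar[of 1] scalar_le_iff[of 0 1] by simp
  qed
  have fAd: "\<delta> *\<^sub>R one_op \<preceq> fun_calc f A" unfolding fA
    by (intro Br_ge_scalar rr f\<delta> range)
  have fAp: "fun_calc f A \<in> pos_inv_ops"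
  proof (rule pos_inv_opsI[OF _ \<delta>])
    show "sa (fun_calc f A)" by (intro fun_calc_sa pos_inv_opsD Ap pos_inv_continuous f_cont)
    show "\<delta> * (norm x)\<^sup>2 \<le> inner x (fun_calc f A x)" for x
      using op_leD[OF fAd, of x] by (simp add: blinfun.scaleR_left power2_norm_eq_inner)
  qed
  have fDp: "fun_calc f D \<in> pos_ops" unfolding fD
    by (intro dg_pos pos_ops_scalar f_nonneg ppos mpos)
  have "\<delta> *\<^sub>R Q = dg (\<delta> *\<^sub>R one_op) (0 *\<^sub>R one_op)" by (simp add: Q_def blk_def comp_op_simps)
  also have "\<dots> \<preceq> fun_calc f D" unfolding fD
    by (intro dg_mono; unfold scalar_le_iff) (intro f\<delta> range f_nonneg mpos)+
  finally have fDd: "\<delta> *\<^sub>R Q \<preceq> fun_calc f D" .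
  have "\<delta> *\<^sub>R Q \<preceq> mean_of h (fun_calc f A) (fun_calc f D)"
    by (rule mean_of_ge[OF fAp fDp Q \<delta> fAd fDd])
  moreover have "mean_of h (fun_calc f A) (fun_calc f D) \<preceq> fun_calc f Z"
    using f_mean[OF Ap Dp] by (simp add: AD)
  ultimately have le: "\<delta> *\<^sub>R Q \<preceq> fun_calc f Z" by (rule op_le_trans)
  \<comment> \<open>The range of \<open>V\<close> is the eigenspace of \<open>Z\<close> for
    \<open>t\<close>. Compressed to it, \<open>fun_calc f Z\<close> becomes \<open>f t\<close> and
    \<open>Q\<close> becomes the squared sine.\<close>
  define V where "V = c *\<^sub>R V2 - s *\<^sub>R V1"
  define W where "W = c *\<^sub>R W2 - s *\<^sub>R W1"
  have VW: "adj V W" unfolding V_def W_def by (rule cuntz.adj2[OF rotate[OF cs]])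
  have "W \<odot> fun_calc f Z \<odot> V = f t *\<^sub>R one_op"
    unfolding fZ Br_def V_def W_def by (rule cuntz.dg_compress(2)[OF rotate[OF cs]])
  moreover have "W \<odot> (\<delta> *\<^sub>R Q) \<odot> V = (\<delta> * s\<^sup>2) *\<^sub>R one_op"
    by (rule blinfun_eqI) (simp add: V_def W_def Q_def blk_def blinfun.bilinear_simps power2_eq_square)
  ultimately have "(\<delta> * s\<^sup>2) *\<^sub>R one_op \<preceq> f t *\<^sub>R (one_op :: 'a op)"
    using op_le_compose[OF le VW] by simp
  thus ?thesis by (simp add: scalar_le_iff s_def M_def)
qed

lemma f_growth:
  assumes z: "0 < z" and fz: "0 < f z"
  shows "\<exists>k>0. \<forall>t\<ge>3 * z / 4. k / (max t z)\<^sup>2 \<le> f t"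
proof -
  have "isCont f z" using f_cont z by (simp add: continuous_on_eq_continuous_at)
  then obtain e where e: "e > 0" "\<And>x. \<bar>x - z\<bar> < e \<Longrightarrow> \<bar>f x - f z\<bar> < f z / 2"
    using fz unfolding continuous_at_eps_delta dist_real_def by (metis half_gt_zero)
  define \<eta> where "\<eta> = min (z / 4) (e / 4)"
  have \<eta>: "0 < \<eta>" "\<eta> \<le> z / 4" "4 * \<eta> \<le> e" using z e by (auto simp: \<eta>_def)
  have fd: "f z / 2 \<le> f x" if "z - 3 * \<eta> \<le> x" "x \<le> z + 3 * \<eta>" for x
  proof -
    have "\<bar>x - z\<bar> < e" using that \<eta> by linarith
    from e(2)[OF this] show ?thesis by linarith
  qed
  have "f z / 2 * \<eta>\<^sup>2 / (max t z)\<^sup>2 \<le> f t" if "3 * z / 4 \<le> t" for t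
    using f_ge[OF \<eta>(1,2), of "f z / 2" t] fz fd that by (simp add: power_divide)
  thus ?thesis using fz \<eta> by (intro exI[of _ "f z / 2 * \<eta>\<^sup>2"]) auto
qed

text \<open>Positivity at a point reaches everything to its right and also three quarters of the
  point; iterating the factor 3/4 goes below any positive number.\<close>

lemma f_pos_spread:
  assumes z: "0 < z" and fz: "0 < f z" and t: "0 < t"
  shows "0 < f t"
proof -
  have step: "0 < f y" if x: "0 < x" "0 < f x" and y: "3 * x / 4 \<le> y" for x y
  proof -
    obtain k where k: "k > 0" "k / (max y x)\<^sup>2 \<le> f y" using f_growth[OF x] y by blast
    have "0 < k / (max y x)\<^sup>2" using k x by (intro divide_pos_pos zero_less_power) auto
    thus ?thesis using k by linarith
  qed
  have iter: "0 < f ((3 / 4) ^ n * z)" for n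
  proof (induction n)
    case (Suc n) thus ?case using step[of "(3 / 4) ^ n * z" "(3 / 4) ^ Suc n * z"] z by simp
  qed (use fz in simp)
  have "t / z > 0" using z t by simp
  then obtain n where "(3 / 4) ^ n < t / z" using real_arch_pow_inv[of "t / z" "3 / 4"] by auto
  hence "(3 / 4) ^ n * z \<le> t" using z by (simp add: field_simps)
  moreover have "0 < (3 / 4) ^ n * z" using z by simp
  ultimately show ?thesis using step[OF _ iter[of n], of t] by linarith
qed

end

locale pos_mean_concave_fun = mean_concave_fun V1 V2 W1 W2 h f
  for V1 V2 W1 W2 :: "'a::chilbert_space op" and h f +
  assumes f_pos: "\<And>t. 0 < t \<Longrightarrow> 0 < f t"
begin

section \<open>The reciprocal of a positive mean-concave function\<close>

lemma f_pos_inv: "(A :: 'a op) \<in> pos_inv_ops \<Longrightarrow> fun_calc f A \<in> pos_inv_ops"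
  using pos_inv_spectrum_pos[of A] by (intro fun_calc_pos_inv pos_inv_opsD pos_inv_continuous f_cont f_pos) auto

text \<open>Inversion reverses the mean inequality for \<open>f\<close>, and the scalar bound on
  \<open>1/h\<close> estimates the inverse of the mean. All operators involved are now invertible,
  so the closed formula applies.\<close>

lemma inverse_f_le:
  fixes A B :: "'a op"
  assumes A: "A \<in> pos_inv_ops" and B: "B \<in> pos_inv_ops"
    and le: "\<And>x. 0 < x \<Longrightarrow> 1 / h x \<le> c * (1 + 1 / x) + K * (1 / (1 + x))"
  shows "op_inv (fun_calc f ((1/2) *\<^sub>R (A + B))) \<preceq>
    c *\<^sub>R (op_inv (fun_calc f A) + op_inv (fun_calc f B)) + K *\<^sub>R op_inv (fun_calc f A + fun_calc f B)"
proof -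
  note fA = f_pos_inv[OF A] and fB = f_pos_inv[OF B]
  have "imean h (fun_calc f A) (fun_calc f B) \<preceq> fun_calc f ((1/2) *\<^sub>R (A + B))"
    using f_mean[OF A B] by (simp add: mean_of_pos_inv fA fB)
  hence "op_inv (fun_calc f ((1/2) *\<^sub>R (A + B))) \<preceq> op_inv (imean h (fun_calc f A) (fun_calc f B))"
    by (intro op_inv_antimono imean_pos_inv fA fB h_cont' h_pos f_pos_inv pos_inv_scaleR pos_inv_add A pos_inv_opsD B) auto
  thus ?thesis using op_inv_imean_le[OF fA fB h_cont' h_pos le] by (rule op_le_trans)
qed

text \<open>\<open>X\<close> and \<open>Y\<close> have the eigenvalues \<open>t\<close> and
  \<open>e\<close> in frames turned by opposite angles. Their midpoint is diagonal with first entry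
  \<open>\<sigma> t + (1 - \<sigma>) e\<close>, and the first corner of the operator inequality is
  the claim. The additive constant depends on \<open>e\<close> and not on \<open>t\<close>, which
  makes iteration possible when \<open>2 c < 1\<close>.\<close>

lemma inverse_f_le_real:
  assumes c: "0 \<le> c" and K: "0 \<le> K" and le: "\<And>x. 0 < x \<Longrightarrow> 1 / h x \<le> c * (1 + 1 / x) + K * (1 / (1 + x))"
    and \<sigma>: "0 < \<sigma>" "\<sigma> < 1" and t: "0 < t" and e: "0 < e"
  shows "1 / f (\<sigma> * t + (1 - \<sigma>) * e) \<le> 2 * c * (1 / f t) + (2 * c / f e + K / (2 * (1 - \<sigma>) * f e))"
proof -
  define p s where "p = sqrt \<sigma>" and "s = sqrt (1 - \<sigma>)"
  have p2: "p\<^sup>2 = \<sigma>" and s2: "s\<^sup>2 = 1 - \<sigma>" using \<sigma> by (simp_all add: p_def s_def)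
  hence ps: "p\<^sup>2 + s\<^sup>2 = 1" "p\<^sup>2 + (- s)\<^sup>2 = 1" by simp_all
  define X Y where "X = Br p s (t *\<^sub>R one_op) (e *\<^sub>R one_op)" and "Y = Br p (- s) (t *\<^sub>R one_op) (e *\<^sub>R one_op)"
  define sc :: "real \<Rightarrow> 'a op" where "sc r = r *\<^sub>R one_op" for r
  have X: "X \<in> pos_inv_ops" and Y: "Y \<in> pos_inv_ops"
    unfolding X_def Y_def by (intro Br_pos_inv ps pos_inv_scalar t e)+
  have fX: "fun_calc f X = Br p s (f t *\<^sub>R one_op) (f e *\<^sub>R one_op)"
    unfolding X_def by (subst fun_calc_Br[OF ps(1)]) (auto intro!: pos_inv_scalar t e f_cont simp: fun_calc_scalar)
  have fY: "fun_calc f Y = Br p (- s) (f t *\<^sub>R one_op) (f e *\<^sub>R one_op)"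
    unfolding Y_def by (subst fun_calc_Br[OF ps(2)]) (auto intro!: pos_inv_scalar t e f_cont simp: fun_calc_scalar)
  have avg: "Br p s (sc x) (sc y) + Br p (- s) (sc x) (sc y) = dg (sc (2 * (\<sigma> * x + (1 - \<sigma>) * y))) (sc (2 * ((1 - \<sigma>) * x + \<sigma> * y)))" for x y
    unfolding Br_avg p2 s2 by (simp add: blk_def comp_op_simps sc_def scaleR_add_left scaleR_add_right distrib_left)
  have pos2: "0 < \<sigma> * x + (1 - \<sigma>) * y" "0 < (1 - \<sigma>) * x + \<sigma> * y" if "0 < x" "0 < y" for x y :: real
    using that \<sigma> by (auto intro!: add_pos_pos)
  have "(1/2) *\<^sub>R (X + Y) = dg (sc (\<sigma> * t + (1 - \<sigma>) * e)) (sc ((1 - \<sigma>) * t + \<sigma> * e))"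
    unfolding X_def Y_def sc_def[symmetric] avg
    by (simp add: blk_def comp_op_simps sc_def scaleR_add_right del: distrib_left_numeral)
  hence "fun_calc f ((1/2) *\<^sub>R (X + Y)) = dg (sc (f (\<sigma> * t + (1 - \<sigma>) * e))) (sc (f ((1 - \<sigma>) * t + \<sigma> * e)))"
    using pos2[OF t e] by (simp add: sc_def fun_calc_blk pos_inv_scalar f_cont fun_calc_scalar)
  hence 1: "op_inv (fun_calc f ((1/2) *\<^sub>R (X + Y))) =
      dg (sc (1 / f (\<sigma> * t + (1 - \<sigma>) * e))) (sc (1 / f ((1 - \<sigma>) * t + \<sigma> * e)))"
    using pos2[OF t e, THEN f_pos] by (simp add: sc_def op_inv_dg_scalar)
  note ft = f_pos[OF t] and fe = f_pos[OF e]
  have "op_inv (fun_calc f X) = Br p s (sc (1 / f t)) (sc (1 / f e))"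
    "op_inv (fun_calc f Y) = Br p (- s) (sc (1 / f t)) (sc (1 / f e))"
    unfolding fX fY sc_def using ft fe by (auto intro!: op_inv_Br_scalar ps)
  hence 2: "op_inv (fun_calc f X) + op_inv (fun_calc f Y) =
      dg (sc (2 * (\<sigma> * (1 / f t) + (1 - \<sigma>) * (1 / f e)))) (sc (2 * ((1 - \<sigma>) * (1 / f t) + \<sigma> * (1 / f e))))"
    by (simp only: avg)
  have "fun_calc f X + fun_calc f Y = dg (sc (2 * (\<sigma> * f t + (1 - \<sigma>) * f e))) (sc (2 * ((1 - \<sigma>) * f t + \<sigma> * f e)))"
    unfolding fX fY sc_def[symmetric] by (rule avg)
  hence 3: "op_inv (fun_calc f X + fun_calc f Y) =
      dg (sc (1 / (2 * (\<sigma> * f t + (1 - \<sigma>) * f e)))) (sc (1 / (2 * ((1 - \<sigma>) * f t + \<sigma> * f e))))"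
    using pos2[OF ft fe] unfolding sc_def by (subst op_inv_dg_scalar[symmetric]) auto
  have comp: "W1 \<odot> (c *\<^sub>R dg a b + K *\<^sub>R dg a' b') \<odot> V1 = c *\<^sub>R a + K *\<^sub>R a'" for a b a' b'
    by (rule blinfun_eqI) (simp add: blk_apply blinfun.bilinear_simps)
  have "1 / f (\<sigma> * t + (1 - \<sigma>) * e) \<le> c * (2 * (\<sigma> * (1 / f t) + (1 - \<sigma>) * (1 / f e))) + K * (1 / (2 * (\<sigma> * f t + (1 - \<sigma>) * f e)))"
    using op_le_compose[OF inverse_f_le[OF X Y le] adj1] unfolding 1 2 3 comp dg_compress
    unfolding sc_def scaleR_scaleR scaleR_add_left[symmetric] scalar_le_iff .
  moreover have "c * (2 * (\<sigma> * (1 / f t) + (1 - \<sigma>) * (1 / f e))) \<le> c * (2 * (1 * (1 / f t) + 1 * (1 / f e)))"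
    using c \<sigma> ft fe by (intro mult_left_mono add_mono mult_right_mono) auto
  \<comment> \<open>Dropping the contribution of \<open>f t\<close> makes this term independent of
    \<open>t\<close>.\<close>
  moreover have "K * (1 / (2 * (\<sigma> * f t + (1 - \<sigma>) * f e))) \<le> K * (1 / (2 * (1 - \<sigma>) * f e))"
  proof (intro mult_left_mono divide_left_mono mult_pos_pos)
    show "2 * (1 - \<sigma>) * f e \<le> 2 * (\<sigma> * f t + (1 - \<sigma>) * f e)" 
    proof -
      have "0 \<le> \<sigma> * f t" using \<sigma> ft by simp
      thus ?thesis by (simp add: algebra_simps)
    qed
  qed (use K \<sigma> ft fe in \<open>auto intro!: add_pos_pos\<close>)
  ultimately show ?thesis by (simp add: algebra_simps)
qed

end

context pos_mean_concave_fun
begin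

lemma inverse_f_bounded:
  assumes strict: "0 < x0" "h x0 \<noteq> 2 * x0 / (1 + x0)" and e: "0 < e"
  shows "\<exists>L. \<forall>t\<ge>e. 1 / f t \<le> L"
proof -
  obtain c K where c: "c < 1 / 2" "0 \<le> c" and K: "0 \<le> K"
    and le: "\<And>x. x > 0 \<Longrightarrow> 1 / h x \<le> c * (1 + 1 / x) + K * (1 / (1 + x))"
    using inverse_h_strict[OF strict] by blast
  \<comment> \<open>The square of \<open>\<sigma>\<close> is halfway between the contraction factor
    \<open>q\<close> and 1, hence strictly larger than \<open>q\<close>.\<close>
  define q \<sigma> where "q = 2 * c" and "\<sigma> = sqrt ((1 + q) / 2)"
  have q: "0 \<le> q" "q < 1" using c by (simp_all add: q_def)
  have \<sigma>2: "\<sigma>\<^sup>2 = (1 + q) / 2" using q by (simp add: \<sigma>_def)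
  have \<sigma>: "0 < \<sigma>" "\<sigma> < 1" "q < \<sigma>\<^sup>2"
    unfolding \<sigma>2 using q by (simp_all add: \<sigma>_def field_simps)
  define C where "C = 2 * c / f e + K / (2 * (1 - \<sigma>) * f e)"
  have C: "0 \<le> C" using c K \<sigma> f_pos[OF e] by (simp add: C_def)
  obtain k where k: "k > 0" "\<And>t. t \<ge> 3 * e / 4 \<Longrightarrow> k / (max t e)\<^sup>2 \<le> f t"
    using f_growth[OF e f_pos[OF e]] by blast
  define m where "m = max 1 e"
  \<comment> \<open>Shifting the variable by \<open>e\<close>, the fixed point of
    \<open>t \<mapsto> \<sigma> t + (1 - \<sigma>) e\<close>, turns this map into multiplication by
    \<open>\<sigma>\<close>. The factor \<open>m = max 1 e\<close> gives
    \<open>e + t \<le> m (1 + t)\<close>, so the lower bound on \<open>f\<close> becomes the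
    required quadratic growth.\<close>
  have bound: "1 / f (e + t) \<le> C / (1 - q)" if t: "0 \<le> t" for t
  proof (rule scaling_growth_bound[where G = "\<lambda>t. 1 / f (e + t)", OF \<sigma>(1,2) q(1) \<sigma>(3) C])
    show "0 \<le> m\<^sup>2 / k" using k by simp
    show "1 / f (e + \<sigma> * t) \<le> q * (1 / f (e + t)) + C" if "0 \<le> t" for t
    proof -
      have "\<sigma> * (e + t) + (1 - \<sigma>) * e = e + \<sigma> * t" by (simp add: algebra_simps)
      thus ?thesis using inverse_f_le_real[OF c(2) K le \<sigma>(1,2), of "e + t" e] e that
        by (simp add: C_def q_def)
    qed
    show "1 / f (e + t) \<le> m\<^sup>2 / k * (1 + t)\<^sup>2" if t: "0 \<le> t" for t
    proof -
      have p: "0 < e + t" using e t by simp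
      have "k / (e + t)\<^sup>2 \<le> f (e + t)" using k(2)[of "e + t"] e t by (simp add: max_absorb1)
      hence "1 / f (e + t) \<le> 1 / (k / (e + t)\<^sup>2)" using k p f_pos[OF p] by (intro divide_left_mono) auto
      also have "\<dots> = (e + t)\<^sup>2 / k" by simp
      also have "\<dots> \<le> (m * (1 + t))\<^sup>2 / k"
      proof -
        have "1 * t \<le> m * t" "e \<le> m" using t mult_right_mono[of 1 m t] by (simp_all add: m_def)
        hence "e + t \<le> m * (1 + t)" by (simp add: distrib_left)
        thus ?thesis using p k by (intro divide_right_mono power_mono) auto
      qed
      finally show ?thesis by (simp add: power_mult_distrib)
    qed
  qed (rule t)
  show ?thesis
  proof (intro exI allI impI)
    fix t assume "e \<le> t"
    thus "1 / f t \<le> C / (1 - q)" using bound[of "t - e"] by simp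
  qed
qed

abbreviation g :: "'a op \<Rightarrow> 'a op" where "g A \<equiv> op_inv (fun_calc f A)"

lemma g_eq: "A \<in> pos_inv_ops \<Longrightarrow> g A = fun_calc (\<lambda>t. 1 / f t) A"
  using f_pos pos_inv_spectrum_pos[of A]
  by (intro op_inv_fun_calc pos_inv_opsD pos_inv_continuous f_cont) (auto simp: less_imp_neq[symmetric])

lemma inverse_f_cont: "continuous_on {0<..} (\<lambda>t. 1 / f t)"
  using f_pos f_cont by (intro continuous_intros) (auto simp: less_imp_neq[symmetric])

text \<open>The case \<open>c = 1/2\<close>, \<open>K = 0\<close>, which holds for every symmetric
  mean.\<close>

lemma g_convex:
  assumes A: "A \<in> pos_inv_ops" and B: "B \<in> pos_inv_ops"
  shows "g ((1/2) *\<^sub>R (A + B)) \<preceq> (1/2) *\<^sub>R (g A + g B)"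
proof -
  have "1 / h x \<le> (1/2) * (1 + 1 / x) + 0 * (1 / (1 + x))" if "0 < x" for x
    using inverse_h_le[OF that] by simp
  from inverse_f_le[OF A B this] show ?thesis by simp
qed

text \<open>Each further midpoint with \<open>A\<close> halves the weight of \<open>D\<close>. These
  weights tend to 0, which is all that the limit below asks for.\<close>

lemma g_convex_dyadic:
  assumes A: "A \<in> pos_inv_ops" and D: "D \<in> pos_inv_ops"
  shows "(1 - 1 / 2 ^ n) *\<^sub>R A + (1 / 2 ^ n) *\<^sub>R D \<in> pos_inv_ops \<and>
    g ((1 - 1 / 2 ^ n) *\<^sub>R A + (1 / 2 ^ n) *\<^sub>R D) \<preceq> (1 - 1 / 2 ^ n) *\<^sub>R g A + (1 / 2 ^ n) *\<^sub>R g D"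
proof (induction n)
  case 0 thus ?case using D by (simp add: op_le_refl)
next
  case (Suc n)
  define w :: real where "w = 1 / 2 ^ n"
  define C where "C = (1 - w) *\<^sub>R A + w *\<^sub>R D"
  have half: "(1/2) *\<^sub>R (X + ((1 - w) *\<^sub>R X + w *\<^sub>R Y)) = (1 - w / 2) *\<^sub>R X + (w / 2) *\<^sub>R Y" for X Y :: "'a op"
  proof -
    have "(1 - w / 2) *\<^sub>R X = (1/2) *\<^sub>R ((2 - w) *\<^sub>R X)" by (simp add: diff_divide_distrib)
    moreover have "(2 - w) *\<^sub>R X = X + (1 - w) *\<^sub>R X" by (simp add: scaleR_left_diff_distrib scaleR_2)
    ultimately show ?thesis by (simp add: scaleR_add_right)
  qed
  have w: "1 / 2 ^ Suc n = w / 2" by (simp add: w_def)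
  have C: "C \<in> pos_inv_ops" "g C \<preceq> (1 - w) *\<^sub>R g A + w *\<^sub>R g D"
    using Suc unfolding C_def w_def by blast+
  have "(1/2) *\<^sub>R (A + C) \<in> pos_inv_ops"
    using A C by (intro pos_inv_scaleR pos_inv_add pos_inv_opsD) auto
  moreover have "g ((1/2) *\<^sub>R (A + C)) \<preceq> (1/2) *\<^sub>R (g A + ((1 - w) *\<^sub>R g A + w *\<^sub>R g D))"
    by (rule op_le_trans[OF g_convex[OF A C(1)]]) (intro op_le_scaleR op_le_add op_le_refl C; simp)
  ultimately show ?case unfolding w half C_def by simp
qed

lemma tendsto_power_half: "(\<lambda>n. 1 / 2 ^ n :: real) \<longlonglongrightarrow> 0"
  using LIMSEQ_realpow_zero[of "1 / 2"] by (simp add: power_one_over)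

text \<open>\<open>(1 - w) B = (1 - w) A + w D\<close> with \<open>D = ((1 - w)/w) (B - A)\<close>, and \<open>w g(D) \<rightarrow> 0\<close> as
  \<open>w \<rightarrow> 0\<close> because \<open>1/f\<close> is bounded at infinity.\<close>

lemma g_decreasing_strict:
  assumes strict: "0 < x0" "h x0 \<noteq> 2 * x0 / (1 + x0)"
    and A: "A \<in> pos_inv_ops" and B: "B \<in> pos_inv_ops" and d: "0 < d" "\<And>x. d * (norm x)\<^sup>2 \<le> inner x ((B - A) x)"
  shows "g B \<preceq> g A"
proof -
  obtain L where L: "\<And>t. t \<ge> d \<Longrightarrow> 1 / f t \<le> L" using inverse_f_bounded[OF strict d(1)] by blast
  obtain l where l: "l > 0" "\<And>x. l * (norm x)\<^sup>2 \<le> inner x (B x)" using B by (rule pos_inv_opsE) blast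
  have sBA: "sa (B - A)" using A B by (intro adj_diff pos_inv_opsD)
  define w :: "nat \<Rightarrow> real" where "w n = 1 / 2 ^ n" for n
  have w0: "0 < w n" for n by (simp add: w_def)
  have wh: "w n \<le> 1 / 2" if "n \<ge> 1" for n
    using power_increasing[of 1 n "2::real"] that by (simp add: w_def field_simps)
  have w_lim: "w \<longlonglongrightarrow> 0" unfolding w_def by (rule tendsto_power_half)
  have step: "fun_calc (\<lambda>t. 1 / f t) ((1 - w n) *\<^sub>R B) \<preceq> (1 - w n) *\<^sub>R g A + (w n * L) *\<^sub>R one_op" if n: "n \<ge> 1" for n
  proof -
    define D where "D = ((1 - w n) / w n) *\<^sub>R (B - A)"
    \<comment> \<open>Since the weight is at most 1/2, \<open>D\<close> dominates
      \<open>B - A\<close>; its spectrum thus stays above \<open>d\<close> for every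
      \<open>n\<close>, and one bound \<open>L\<close> serves all of them.\<close>
    have r: "1 \<le> (1 - w n) / w n" using w0[of n] wh[OF n] by (simp add: field_simps)
    have Df: "d * (norm x)\<^sup>2 \<le> inner x (D x)" for x
    proof -
      have "1 * (d * (norm x)\<^sup>2) \<le> (1 - w n) / w n * inner x ((B - A) x)"
        using r d by (intro mult_mono) auto
      thus ?thesis by (simp add: D_def blinfun.scaleR_left)
    qed
    have sD: "sa D" unfolding D_def by (intro adj_scaleR sBA)
    have D: "D \<in> pos_inv_ops" by (rule pos_inv_opsI[OF sD d(1) Df])
    have Dsp: "t \<ge> d" if "t \<in> real_spectrum D" for t
      using real_spectrum_subset_form[OF sD Df, of "norm D"] inner_op_le_norm[of _ D] that
      by (fastforce simp: abs_le_iff)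
    have gD: "g D \<preceq> L *\<^sub>R one_op"
    proof (rule op_leI)
      show "sa (g D)" using op_inv_pos_inv[OF f_pos_inv[OF D]] by (rule pos_inv_opsD)
      show "sa (L *\<^sub>R one_op)" by (intro adj_scaleR adj_one)
      show "inner x (g D x) \<le> inner x ((L *\<^sub>R one_op) x)" for x
        unfolding g_eq[OF D]
        using fun_calc_form_le[OF sD pos_inv_continuous[OF D inverse_f_cont], of L x] L[OF Dsp]
        by (simp add: blinfun.scaleR_left power2_norm_eq_inner)
    qed
    have "(1 - w n) *\<^sub>R A + w n *\<^sub>R D = (1 - w n) *\<^sub>R B"
      using w0[of n] by (simp add: D_def scaleR_diff_right)
    hence s1: "g ((1 - w n) *\<^sub>R B) \<preceq> (1 - w n) *\<^sub>R g A + w n *\<^sub>R g D"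
      using g_convex_dyadic[OF A D, of n] by (simp add: w_def)
    have s2: "(1 - w n) *\<^sub>R g A + w n *\<^sub>R g D \<preceq> (1 - w n) *\<^sub>R g A + w n *\<^sub>R (L *\<^sub>R one_op)"
      using w0[of n] by (intro op_le_add op_le_refl op_le_scaleR gD) simp
    have s3: "g ((1 - w n) *\<^sub>R B) = fun_calc (\<lambda>t. 1 / f t) ((1 - w n) *\<^sub>R B)"
      using wh[OF n] by (intro g_eq pos_inv_scaleR B) simp
    show ?thesis using op_le_trans[OF s1 s2] unfolding s3 by simp
  qed
  \<comment> \<open>The factor \<open>1 - w n\<close> is at least 1/2, whence the common lower bound
    \<open>l / 2\<close>.\<close>
  have 1: "(\<lambda>n. fun_calc (\<lambda>t. 1 / f t) ((1 - w n) *\<^sub>R B)) \<longlonglongrightarrow> fun_calc (\<lambda>t. 1 / f t) B"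
  proof (rule fun_calc_tendsto_bounded_below[where l = "l / 2"])
    have "(\<lambda>n. (1 - w n) *\<^sub>R B) \<longlonglongrightarrow> (1 - 0) *\<^sub>R B" by (intro tendsto_intros w_lim)
    thus "(\<lambda>n. (1 - w n) *\<^sub>R B) \<longlonglongrightarrow> B" by simp
    show "sa B" using B by (rule pos_inv_opsD)
    show "l / 2 * (norm x)\<^sup>2 \<le> inner x (B x)" for x
      using mult_right_mono[of "l / 2" l "(norm x)\<^sup>2"] l(1) by (intro order_trans[OF _ l(2)]) auto
    show "continuous_on {l / 2..} (\<lambda>t. 1 / f t)" using l(1) by (intro continuous_on_subset[OF inverse_f_cont]) auto
    show "\<forall>\<^sub>F n in sequentially. sa ((1 - w n) *\<^sub>R B) \<and> (\<forall>x. l / 2 * (norm x)\<^sup>2 \<le> inner x (((1 - w n) *\<^sub>R B) x))"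
      using eventually_ge_at_top[of "1::nat"]
    proof eventually_elim
      case (elim n)
      have "1 / 2 * (l * (norm x)\<^sup>2) \<le> (1 - w n) * inner x (B x)" for x
        using l wh[OF elim] by (intro mult_mono) auto
      thus ?case using pos_inv_opsD(3)[OF B] by (simp add: adj_scaleR blinfun.scaleR_left)
    qed
  qed
  have "(\<lambda>n. (1 - w n) *\<^sub>R g A + (w n * L) *\<^sub>R one_op) \<longlonglongrightarrow> (1 - 0) *\<^sub>R g A + (0 * L) *\<^sub>R one_op"
    by (intro tendsto_intros w_lim)
  hence 2: "(\<lambda>n. (1 - w n) *\<^sub>R g A + (w n * L) *\<^sub>R one_op) \<longlonglongrightarrow> g A" by simp
  have "fun_calc (\<lambda>t. 1 / f t) B \<preceq> g A"
  proof (rule op_le_tendsto[OF 1 2])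
    show "\<forall>\<^sub>F n in sequentially. fun_calc (\<lambda>t. 1 / f t) ((1 - w n) *\<^sub>R B) \<preceq> (1 - w n) *\<^sub>R g A + (w n * L) *\<^sub>R one_op"
      using eventually_ge_at_top[of "1::nat"] by eventually_elim (rule step)
  qed simp
  thus ?thesis by (simp only: g_eq[OF B])
qed

text \<open>Adding a small multiple of the identity to \<open>B\<close> creates the strict gap
  needed for comparing reciprocals; continuity removes it, and a last inversion returns to
  \<open>f\<close>.\<close>

lemma f_operator_monotone:
  assumes strict: "0 < x0" "h x0 \<noteq> 2 * x0 / (1 + x0)"
  shows "operator_monotone_on (pos_inv_ops :: 'a op set) f"
  unfolding operator_monotone_on_def
proof (intro ballI impI)
  fix B A :: "'a op" assume B: "B \<in> pos_inv_ops" and A: "A \<in> pos_inv_ops" and le: "A \<preceq> B"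
  obtain l where l: "l > 0" "\<And>x. l * (norm x)\<^sup>2 \<le> inner x (B x)" using B by (rule pos_inv_opsE) blast
  have sB: "sa B" using B by (rule pos_inv_opsD)
  have step: "fun_calc (\<lambda>t. 1 / f t) (B + \<epsilon> *\<^sub>R one_op) \<preceq> g A" if \<epsilon>: "\<epsilon> > 0" for \<epsilon>
  proof -
    have B': "B + \<epsilon> *\<^sub>R one_op \<in> pos_inv_ops" using \<epsilon> by (intro pos_inv_add B pos_ops_scalar) simp
    have "\<epsilon> * (norm x)\<^sup>2 \<le> inner x ((B + \<epsilon> *\<^sub>R one_op - A) x)" for x
      using op_leD[OF le, of x]
      by (simp add: blinfun.bilinear_simps inner_add_right inner_diff_right power2_norm_eq_inner)
    from g_decreasing_strict[OF strict A B' \<epsilon> this] show ?thesis by (simp only: g_eq[OF B'])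
  qed
  have lim: "((\<lambda>\<epsilon>. fun_calc (\<lambda>t. 1 / f t) (B + \<epsilon> *\<^sub>R one_op)) \<longlongrightarrow> fun_calc (\<lambda>t. 1 / f t) B) (at_right 0)"
  proof (rule fun_calc_tendsto_bounded_below[OF tendsto_add_scalar sB l(2)])
    show "continuous_on {l..} (\<lambda>t. 1 / f t)" using l(1) by (intro continuous_on_subset[OF inverse_f_cont]) auto
    show "\<forall>\<^sub>F \<epsilon> in at_right 0. sa (B + \<epsilon> *\<^sub>R one_op) \<and> (\<forall>x. l * (norm x)\<^sup>2 \<le> inner x ((B + \<epsilon> *\<^sub>R one_op) x))"
      using eventually_at_right_less[of "0::real"]
      by eventually_elim (use l(2) sB in \<open>blast intro: adj_add adj_scaleR adj_one form_add_scalar\<close>)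
  qed
  have "fun_calc (\<lambda>t. 1 / f t) B \<preceq> g A"
  proof (rule op_le_tendsto[OF lim tendsto_const])
    show "\<forall>\<^sub>F \<epsilon> in at_right 0. fun_calc (\<lambda>t. 1 / f t) (B + \<epsilon> *\<^sub>R one_op) \<preceq> g A"
      using eventually_at_right_less[of "0::real"] by eventually_elim (rule step)
  qed simp
  hence le': "g B \<preceq> g A" by (simp only: g_eq[OF B])
  have "op_inv (g A) \<preceq> op_inv (g B)"
    by (rule op_inv_antimono[OF _ _ le']) (intro op_inv_pos_inv f_pos_inv A B)+
  moreover have "op_inv (g X) = fun_calc f X" if "X \<in> pos_inv_ops" for X :: "'a op"
    using f_pos_inv[OF that] by (intro op_inv_inv pos_inv_opsD adj_bounded(1)[OF pos_inv_opsD(3)])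
  ultimately show "fun_calc f A \<preceq> fun_calc f B" using A B by metis
qed

end

section \<open>The equivalence\<close>

context cuntz
begin

section \<open>From means to representing functions, and the geometric mean as an example\<close>

lemma symmetric_mean_imp_symmetric_mean_fun:
  assumes h: "continuous_on {0..} h" "\<And>t. 0 \<le> t \<Longrightarrow> 0 \<le> h t" "h 1 = 1"
      "operator_monotone_on (pos_ops :: 'a op set) h"
    and eq: "mean_eq (\<sigma> :: 'a op \<Rightarrow> 'a op \<Rightarrow> 'a op) (mean_of h)" and sym: "symmetric_mean \<sigma>"
  shows "symmetric_mean_fun V1 V2 W1 W2 h"
proof
  fix A B :: "'a op" assume A: "A \<in> pos_inv_ops" and B: "B \<in> pos_inv_ops"
  have "\<sigma> A B = \<sigma> B A" using sym A B by (simp add: symmetric_mean_def)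
  thus "imean h A B = imean h B A"
    using eq A B by (simp add: mean_eq_def pos_inv_opsD mean_of_pos_inv)
qed (use h in auto)

text \<open>Used contrapositively: a mean other than the harmonic one has a representing function
  that differs from the harmonic function at some positive point. Positive points suffice because
  both extensions are limits of values on invertible operators.\<close>

lemma mean_eq_harm_mean:
  assumes eq: "mean_eq (\<sigma> :: 'a op \<Rightarrow> 'a op \<Rightarrow> 'a op) (mean_of h)" and h: "\<And>t. 0 < t \<Longrightarrow> h t = 2 * t / (1 + t)"
  shows "mean_eq \<sigma> harm_mean"
proof -
  have "mean_of h A B = harm_mean A B" if "A \<in> pos_ops" "B \<in> pos_ops" for A B :: "'a op"
    unfolding mean_of_eq harm_mean_def by (rule extend_mean_cong[OF imean_harmonic[OF _ _ h] that])
  thus ?thesis using eq by (simp add: mean_eq_def)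
qed

lemma geom_mean_operator_mean: "operator_mean (geom_mean :: 'a op \<Rightarrow> 'a op \<Rightarrow> 'a op)"
  unfolding operator_mean_def geom_mean_def
  by (rule exI[of _ sqrt]) (simp add: continuous_intros operator_monotone_sqrt mean_eq_def)

lemma geom_mean_symmetric: "symmetric_mean (geom_mean :: 'a op \<Rightarrow> 'a op \<Rightarrow> 'a op)"
  by (simp add: symmetric_mean_def geom_mean_def mean_of_pos_inv imean_sqrt_commute)

lemma geom_mean_neq_harm_mean: "\<not> mean_eq (geom_mean :: 'a op \<Rightarrow> 'a op \<Rightarrow> 'a op) harm_mean"
proof
  assume *: "mean_eq (geom_mean :: 'a op \<Rightarrow> 'a op \<Rightarrow> 'a op) harm_mean"
  \<comment> \<open>At the scalars 1 and 4 the geometric mean is 2 and the harmonic mean is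
    8/5.\<close>
  define I4 where "I4 = 4 *\<^sub>R (one_op :: 'a op)"
  have I: "1 *\<^sub>R one_op \<in> (pos_inv_ops :: 'a op set)" "I4 \<in> pos_inv_ops"
    unfolding I4_def by (intro pos_inv_scalar; simp)+
  have "geom_mean (1 *\<^sub>R one_op) I4 = imean sqrt (1 *\<^sub>R one_op) I4"
    unfolding geom_mean_def by (rule mean_of_pos_inv[OF I])
  also have "\<dots> = 2 *\<^sub>R one_op"
    by (subst imean_scalar_left) (simp_all add: I4_def fun_calc_scalar del: scaleR_one)
  finally have 1: "geom_mean (1 *\<^sub>R one_op) I4 = 2 *\<^sub>R one_op" .
  have "harm_mean (1 *\<^sub>R one_op) I4 = op_inv ((1/2) *\<^sub>R (op_inv (1 *\<^sub>R one_op) + op_inv I4))"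
    using I unfolding harm_mean_def extend_mean_def by simp
  also have "\<dots> = op_inv ((5/8) *\<^sub>R one_op)"
    unfolding I4_def by (simp add: op_inv_scalar del: scaleR_one flip: scaleR_add_left)
  also have "\<dots> = (8/5) *\<^sub>R one_op" by (simp add: op_inv_scalar)
  finally have 2: "harm_mean (1 *\<^sub>R one_op) I4 = (8/5) *\<^sub>R one_op" .
  have "geom_mean (1 *\<^sub>R one_op) I4 = harm_mean (1 *\<^sub>R one_op) I4"
    using * I pos_inv_opsD(1) unfolding mean_eq_def by blast
  thus False unfolding 1 2 using nontrivial by simp
qed

lemma operator_monotone_cong:
  assumes "\<And>t. 0 < t \<Longrightarrow> f t = f' t"
  shows "operator_monotone_on (pos_inv_ops :: 'a op set) f \<longleftrightarrow> operator_monotone_on (pos_inv_ops :: 'a op set) f'"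
proof -
  have "fun_calc f A = fun_calc f' A" if "A \<in> pos_inv_ops" for A :: "'a op"
    using pos_inv_spectrum_pos[OF that] assms by (intro fun_calc_cong) auto
  thus ?thesis by (simp add: operator_monotone_on_def)
qed

text \<open>A zero at \<open>t\<close> and a positive value at \<open>s\<close> force
  \<open>t < s\<close>; then \<open>t\<close> is a convex combination of \<open>s\<close> and
  \<open>t / 2\<close>, and concavity makes \<open>f t\<close> positive after all. Hence only
  invertible operators and 0 occur as arguments of the mean.\<close>

lemma op_monotone_zero_or_pos:
  assumes f: "continuous_on {0<..} f" "\<And>t. 0 < t \<Longrightarrow> 0 \<le> f t"
    and m: "operator_monotone_on (pos_inv_ops :: 'a op set) f"
  shows "(\<forall>t>0. f t = 0) \<or> (\<forall>t>0. 0 < f t)"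
proof (rule ccontr)
  assume "\<not> ?thesis"
  then obtain s t where st: "0 < s" "f s \<noteq> 0" "0 < t" "f t \<le> 0" by auto
  hence ft: "f t = 0" and fs: "0 < f s" using f(2)[of t] f(2)[of s] by auto
  have ts: "t < s" using op_monotone_imp_mono[OF m, of s t] st ft fs by force
  define y where "y = t / 2"
  have y: "0 < y" "t = 2 * y" "2 * y < s" using st ts by (simp_all add: y_def)
  define l where "l = y / (s - y)"
  have l: "0 < l" "l \<le> 1" using y by (simp_all add: l_def)
  have "l * (s - y) = y" using y by (simp add: l_def)
  hence e: "l * s + (1 - l) * y = t" unfolding y(2) by (simp add: algebra_simps)
  have "l * f s + (1 - l) * f y \<le> f t"
    using op_monotone_imp_concave_real[OF f(1) m, of s y l] l st(1) y(1) unfolding e by simp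
  moreover have "0 \<le> (1 - l) * f y" using l f(2)[OF y(1)] by simp
  moreover have "0 < l * f s" using l fs by simp
  ultimately show False using ft by linarith
qed

text \<open>The mean of 0 with itself is defined only as a limit; it is that of the means of
  \<open>\<epsilon>\<close> with itself, which equal \<open>\<epsilon>\<close> since
  \<open>h 1 = 1\<close>.\<close>

lemma mean_of_zero:
  assumes "symmetric_mean_fun V1 V2 W1 W2 h"
  shows "mean_of h 0 (0 :: 'a op) = 0"
proof -
  interpret symmetric_mean_fun V1 V2 W1 W2 h by fact
  have "\<not> op_invertible (0 :: 'a op)"
    using nontrivial by (auto simp: op_invertible_def comp_op_simps)
  hence n: "\<not> ((0 :: 'a op) \<in> pos_inv_ops \<and> (0 :: 'a op) \<in> pos_inv_ops)" using pos_inv_opsD(2) by blast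
  have "((\<lambda>\<epsilon>. imean h (0 + \<epsilon> *\<^sub>R one_op) (0 + \<epsilon> *\<^sub>R one_op)) \<longlongrightarrow> (0 :: 'a op)) (at_right (0::real))"
  proof (rule Lim_transform_eventually)
    have "((\<lambda>\<epsilon>::real. \<epsilon> *\<^sub>R one_op) \<longlongrightarrow> 0 *\<^sub>R (one_op :: 'a op)) (at_right 0)" by (intro tendsto_intros)
    thus "((\<lambda>\<epsilon>::real. \<epsilon> *\<^sub>R one_op) \<longlongrightarrow> (0 :: 'a op)) (at_right 0)" by simp
    show "\<forall>\<^sub>F \<epsilon> in at_right 0. \<epsilon> *\<^sub>R one_op = imean h (0 + \<epsilon> *\<^sub>R one_op) (0 + \<epsilon> *\<^sub>R (one_op :: 'a op))"
      using eventually_at_right_less[of "0::real"]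
    proof eventually_elim
      case (elim \<epsilon>)
      have "fun_calc h one_op = (one_op :: 'a op)" using fun_calc_scalar[of h 1] by (simp add: h_1)
      thus ?case using elim by (simp add: imean_scalar_left)
    qed
  qed
  thus ?thesis unfolding mean_of_eq by (rule extend_mean_limit[where m = "imean h", OF n])
qed

lemma op_monotone_imp_mean_concave:
  fixes A B :: "'a op"
  assumes f: "continuous_on {0<..} f" "\<And>t. 0 < t \<Longrightarrow> 0 \<le> f t"
    and m: "operator_monotone_on (pos_inv_ops :: 'a op set) f" and h: "symmetric_mean_fun V1 V2 W1 W2 h"
    and A: "A \<in> pos_inv_ops" and B: "B \<in> pos_inv_ops"
  shows "mean_of h (fun_calc f A) (fun_calc f B) \<preceq> fun_calc f ((1/2) *\<^sub>R (A + B))"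
proof -
  interpret symmetric_mean_fun V1 V2 W1 W2 h by fact
  have avg: "(1/2) *\<^sub>R (A + B) \<in> pos_inv_ops"
    by (intro pos_inv_scaleR pos_inv_add A pos_inv_opsD(1)[OF B]) simp
  from op_monotone_zero_or_pos[OF f m] show ?thesis
  proof
    assume z: "\<forall>t>0. f t = 0"
    have "fun_calc f X = 0" if "X \<in> pos_inv_ops" for X :: "'a op"
    proof -
      have "fun_calc f X = fun_calc (\<lambda>t. 0) X"
        using z pos_inv_spectrum_pos[OF that] by (intro fun_calc_cong) auto
      thus ?thesis using fun_calc_const[OF pos_inv_opsD(3)[OF that], of 0] by simp
    qed
    thus ?thesis using A B avg by (simp add: mean_of_zero[OF h] op_le_refl)
  next
    assume p: "\<forall>t>0. 0 < f t"
    have pi: "fun_calc f X \<in> pos_inv_ops" if "X \<in> pos_inv_ops" for X :: "'a op"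
      using pos_inv_spectrum_pos[OF that] that p by (intro fun_calc_pos_inv pos_inv_opsD pos_inv_continuous f) auto
    have cs: "(sqrt (1 / 2))\<^sup>2 + (sqrt (1 / 2))\<^sup>2 = (1 :: real)" by simp
    have "mean_of h (fun_calc f A) (fun_calc f B) \<preceq> (1/2) *\<^sub>R (fun_calc f A + fun_calc f B)"
      using imean_le_arith[OF pi[OF A] pi[OF B]] by (simp add: mean_of_pos_inv pi A B)
    moreover have "(1/2) *\<^sub>R (fun_calc f A + fun_calc f B) \<preceq> fun_calc f ((1/2) *\<^sub>R (A + B))"
      using op_monotone_imp_concave[OF f(1) m A B cs] by (simp add: scaleR_add_right)
    ultimately show ?thesis by (rule op_le_trans)
  qed
qed

lemma mean_concave_imp_op_monotone:
  assumes f: "continuous_on {0<..} f" "\<And>t. 0 < t \<Longrightarrow> 0 \<le> f t" and h: "symmetric_mean_fun V1 V2 W1 W2 h"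
    and strict: "0 < x0" "h x0 \<noteq> 2 * x0 / (1 + x0)"
    and mean: "\<And>A B :: 'a op. A \<in> pos_inv_ops \<Longrightarrow> B \<in> pos_inv_ops \<Longrightarrow>
      mean_of h (fun_calc f A) (fun_calc f B) \<preceq> fun_calc f ((1/2) *\<^sub>R (A + B))"
  shows "operator_monotone_on (pos_inv_ops :: 'a op set) f"
proof -
  interpret symmetric_mean_fun V1 V2 W1 W2 h by fact
  interpret mean_concave_fun V1 V2 W1 W2 h f by unfold_locales (use f mean in auto)
  show ?thesis
  proof (cases "\<exists>t>0. 0 < f t")
    case True
    then interpret pos_mean_concave_fun V1 V2 W1 W2 h f by unfold_locales (use f_pos_spread in blast)
    show ?thesis by (rule f_operator_monotone[OF strict])
  next
    case False
    hence "f t = 0" if "0 < t" for t using f(2)[OF that] that by force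
    moreover have "operator_monotone_on (pos_inv_ops :: 'a op set) (\<lambda>t. 0)"
      by (simp add: operator_monotone_on_def fun_calc_const pos_inv_opsD op_le_refl)
    ultimately show ?thesis using operator_monotone_cong[of f "\<lambda>t. 0"] by blast
  qed
qed

end

theorem theorem2p3:
  fixes f :: "real \<Rightarrow> real"
  assumes separable: "separable_space (euclidean :: 'a::chilbert_space topology)"
    and infinite_dim: "\<not> (\<exists>S :: 'a set. finite S \<and> complex_vector.span S = UNIV)"
    and cont: "continuous_on {0<..} f"
    and nonneg: "\<And>t. 0 < t \<Longrightarrow> 0 \<le> f t"
  defines "b1 \<equiv> operator_monotone_on (pos_inv_ops :: 'a op set) f"
    and "b2 \<equiv> (\<forall>\<sigma> :: 'a op \<Rightarrow> 'a op \<Rightarrow> 'a op. operator_mean \<sigma> \<and> symmetric_mean \<sigma> \<longrightarrow>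
           (\<forall>A\<in>pos_inv_ops. \<forall>B\<in>pos_inv_ops.
              \<sigma> (fun_calc f A) (fun_calc f B) \<preceq> fun_calc f (A \<nabla> B)))"
    and "b3 \<equiv> (\<forall>A\<in>(pos_inv_ops :: 'a op set). \<forall>B\<in>pos_inv_ops.
           fun_calc f A \<sharp> fun_calc f B \<preceq> fun_calc f (A \<nabla> B))"
    and "b4 \<equiv> (\<exists>\<sigma> :: 'a op \<Rightarrow> 'a op \<Rightarrow> 'a op. operator_mean \<sigma> \<and> symmetric_mean \<sigma> \<and>
           \<not> mean_eq \<sigma> harm_mean \<and>
           (\<forall>A\<in>pos_inv_ops. \<forall>B\<in>pos_inv_ops.
              \<sigma> (fun_calc f A) (fun_calc f B) \<preceq> fun_calc f (A \<nabla> B)))"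
  shows "(b1 \<longleftrightarrow> b2) \<and> (b1 \<longleftrightarrow> b3) \<and> (b1 \<longleftrightarrow> b4)"
proof -
  obtain V1 V2 W1 W2 :: "'a op" where "cuntz V1 V2 W1 W2"
    using exists_cuntz[OF separable infinite_dim] .
  then interpret cuntz V1 V2 W1 W2 .
  \<comment> \<open>Means are identified with \<open>mean_of h\<close> on positive operators only,
    so the arguments must be known to be positive.\<close>
  have fp: "fun_calc f A \<in> pos_ops" if "A \<in> pos_inv_ops" for A :: "'a op"
    using pos_inv_spectrum_pos[OF that] that
    by (intro fun_calc_pos pos_inv_opsD pos_inv_continuous cont) (auto intro!: nonneg)
  have "b1 \<Longrightarrow> b2"
    unfolding b1_def b2_def
  proof (intro allI impI ballI)
    fix \<sigma> :: "'a op \<Rightarrow> 'a op \<Rightarrow> 'a op" and A B :: "'a op"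
    assume m: "operator_monotone_on (pos_inv_ops :: 'a op set) f" and \<sigma>: "operator_mean \<sigma> \<and> symmetric_mean \<sigma>"
      and A: "A \<in> pos_inv_ops" and B: "B \<in> pos_inv_ops"
    obtain h where h: "continuous_on {0..} h" "\<And>t. 0 \<le> t \<Longrightarrow> 0 \<le> h t" "h 1 = 1"
      "operator_monotone_on (pos_ops :: 'a op set) h" "mean_eq \<sigma> (mean_of h)"
      using \<sigma> by (auto simp: operator_mean_def)
    have "mean_of h (fun_calc f A) (fun_calc f B) \<preceq> fun_calc f ((1/2) *\<^sub>R (A + B))"
      using op_monotone_imp_mean_concave[OF cont nonneg m symmetric_mean_imp_symmetric_mean_fun[OF h] A B] \<sigma> by blast
    thus "\<sigma> (fun_calc f A) (fun_calc f B) \<preceq> fun_calc f (A \<nabla> B)"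
      using h(5) fp[OF A] fp[OF B] by (simp add: mean_eq_def arith_mean_pos_inv A B)
  qed
  moreover have "b2 \<Longrightarrow> b3"
    unfolding b2_def b3_def using geom_mean_operator_mean geom_mean_symmetric by blast
  moreover have "b3 \<Longrightarrow> b4"
    unfolding b3_def b4_def using geom_mean_operator_mean geom_mean_symmetric geom_mean_neq_harm_mean by blast
  moreover have "b1" if b4
  proof -
    obtain \<sigma> :: "'a op \<Rightarrow> 'a op \<Rightarrow> 'a op" where \<sigma>: "operator_mean \<sigma>" "symmetric_mean \<sigma>" "\<not> mean_eq \<sigma> harm_mean"
      "\<And>A B. A \<in> pos_inv_ops \<Longrightarrow> B \<in> pos_inv_ops \<Longrightarrow> \<sigma> (fun_calc f A) (fun_calc f B) \<preceq> fun_calc f (A \<nabla> B)"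
      using \<open>b4\<close> unfolding b4_def by blast
    obtain h where h: "continuous_on {0..} h" "\<And>t. 0 \<le> t \<Longrightarrow> 0 \<le> h t" "h 1 = 1"
      "operator_monotone_on (pos_ops :: 'a op set) h" "mean_eq \<sigma> (mean_of h)"
      using \<sigma>(1) by (auto simp: operator_mean_def)
    \<comment> \<open>This is where the mean being different from the harmonic one is used; the
      point \<open>x0\<close> carries the strictness.\<close>
    obtain x0 where x0: "0 < x0" "h x0 \<noteq> 2 * x0 / (1 + x0)"
      using mean_eq_harm_mean[OF h(5)] \<sigma>(3) by blast
    show b1 unfolding b1_def
    proof (rule mean_concave_imp_op_monotone[OF cont nonneg symmetric_mean_imp_symmetric_mean_fun[OF h \<sigma>(2)] x0])
      fix A B :: "'a op" assume A: "A \<in> pos_inv_ops" and B: "B \<in> pos_inv_ops"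
      show "mean_of h (fun_calc f A) (fun_calc f B) \<preceq> fun_calc f ((1/2) *\<^sub>R (A + B))"
        using \<sigma>(4)[OF A B] h(5) fp[OF A] fp[OF B] by (simp add: mean_eq_def arith_mean_pos_inv A B)
    qed
  qed
  ultimately show ?thesis by blast
qed

end
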